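(* Let $a>0$ and choose a sign $\pm$. A function $f$ belongs to $A^2(\mathbf R^{m+1}_{\pm,\mp a},\mathbf C^{(m)})$ if and only if $$f(x)=\frac{1}{(2\pi)^m}\int_{\mathbf R^m}e^{\pm}(x,\underline\xi)\,g(\underline\xi)\,d\underline\xi,\qquad x\in\mathbf R^{m+1}_{\pm,\mp a},$$ where $g=\mathcal F(f)\in L^2(\mathbf R^m,\mathbf C^{(m)})$ (the Fourier transform of the restriction of $f$ to $\mathbf R^m=\{x_0=0\}$) satisfies $$\frac{1}{(2\pi)^m}\int_{\mathbf R^m}e^{2a|\underline\xi|}\,\frac{|\chi_\pm(\underline\xi)g(\underline\xi)|^2}{2|\underline\xi|}\,d\underline\xi<\infty .$$
   Context: $\mathbf C^{(m)}$ is the complex Clifford algebra generated by $\mathbf e_1,\dots,\mathbf e_m$ with $\mathbf e_j\mathbf e_k+\mathbf e_k\mathbf e_j=-2\delta_{jk}$, unit $\mathbf e_0=1$, norm $|\sum_T x_T\mathbf e_T|=(\sum_T|x_T|^2)^{1/2}$. Points of $\mathbf R^{m+1}$ are $x=x_0+\underline x$, $\underline x=\sum_{j=1}^m x_j\mathbf e_j$. $F$ is left-monogenic on an open set if $\sum_{k=0}^m\mathbf e_k\partial F/\partial x_k=0$ there. Fourier transform: $\mathcal F(f)(\underline\xi)=\int_{\mathbf R^m}e^{-i\langle\underline x,\underline\xi\rangle}f(\underline x)d\underline x$ (componentwise, extended to $L^2$). For $\underline\xi\ne0$: $\chi_\pm(\underline\xi)=\frac12(1\pm i\underline\xi/|\underline\xi|)$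 and $e^\pm(x,\underline\xi)=e^{i\langle\underline x,\underline\xi\rangle}e^{\mp x_0|\underline\xi|}\chi_\pm(\underline\xi)$. $\mathbf R^{m+1}_{+,-a}=\{x:x_0>-a\}$, $\mathbf R^{m+1}_{-,a}=\{x:x_0<a\}$. $A^2(\mathbf R^{m+1}_{+,-a},\mathbf C^{(m)})$ is the space of left-monogenic $f$ on $\mathbf R^{m+1}_{+,-a}$ with $\int_{-a}^\infty\int_{\mathbf R^m}|f(x_0+\underline x)|^2d\underline x\,dx_0<\infty$, and $A^2(\mathbf R^{m+1}_{-,a},\mathbf C^{(m)})$ the space of left-monogenic $f$ on $\mathbf R^{m+1}_{-,a}$ with $\int_{-\infty}^a\int_{\mathbf R^m}|f(x_0+\underline x)|^2d\underline x\,dx_0<\infty$. *)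

theory Defs
  imports "HOL-Analysis.Analysis"
begin

text \<open>An element of C^(m) is represented by its coefficient family
  u :: nat set => complex, where u T is the coefficient of e_T for T a subset of {1..m}
  (e_{} = e_0 = 1).  Coefficients at other sets are ignored.\<close>

type_synonym cliff = "nat set \<Rightarrow> complex"

text \<open>Sign of e_A e_B = sign * e_(A symmetric difference B), for e_j e_k + e_k e_j = -2 delta_jk.\<close>
definition cl_sign :: "nat set \<Rightarrow> nat set \<Rightarrow> complex" where
  "cl_sign A B = (-1) ^ (card {(p, q). p \<in> A \<and> q \<in> B \<and> q < p} + card (A \<inter> B))"

definition cl_mult :: "nat \<Rightarrow> cliff \<Rightarrow> cliff \<Rightarrow> cliff" where
  "cl_mult m u v = (\<lambda>S. \<Sum>A\<in>Pow {1..m}. \<Sum>B\<in>Pow {1..m}.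
      if (A - B) \<union> (B - A) = S then cl_sign A B * u A * v B else 0)"

definition cl_basis :: "nat \<Rightarrow> cliff" where
  "cl_basis k = (\<lambda>S. if S = {k} then 1 else 0)"

definition cl_norm2 :: "nat \<Rightarrow> cliff \<Rightarrow> real" where
  "cl_norm2 m u = (\<Sum>T\<in>Pow {1..m}. (cmod (u T))\<^sup>2)"

text \<open>A point x = x_0 + sum x_j e_j of R^(m+1) is an extensional function on {0..m};
  a point of R^m is an extensional function on {1..m}.  Lebesgue measure is the product measure.\<close>

definition Rm1 :: "nat \<Rightarrow> (nat \<Rightarrow> real) set" where
  "Rm1 m = PiE {0..m} (\<lambda>_. UNIV)"

definition Mx :: "nat \<Rightarrow> (nat \<Rightarrow> real) measure" where
  "Mx m = PiM {0..m} (\<lambda>_. lborel)"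

definition Mxi :: "nat \<Rightarrow> (nat \<Rightarrow> real) measure" where
  "Mxi m = PiM {1..m} (\<lambda>_. lborel)"

definition vnorm :: "nat \<Rightarrow> (nat \<Rightarrow> real) \<Rightarrow> real" where
  "vnorm m \<xi> = sqrt (\<Sum>j\<in>{1..m}. (\<xi> j)\<^sup>2)"

definition vinner :: "nat \<Rightarrow> (nat \<Rightarrow> real) \<Rightarrow> (nat \<Rightarrow> real) \<Rightarrow> real" where
  "vinner m x \<xi> = (\<Sum>j\<in>{1..m}. x j * \<xi> j)"

definition pd :: "((nat \<Rightarrow> real) \<Rightarrow> cliff) \<Rightarrow> nat \<Rightarrow> (nat \<Rightarrow> real) \<Rightarrow> cliff" where
  "pd F k x = (\<lambda>T. vector_derivative (\<lambda>t. F (x(k := t)) T) (at (x k)))"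

definition left_monogenic :: "nat \<Rightarrow> (nat \<Rightarrow> real) set \<Rightarrow> ((nat \<Rightarrow> real) \<Rightarrow> cliff) \<Rightarrow> bool" where
  "left_monogenic m U F \<longleftrightarrow>
     U \<subseteq> Rm1 m \<and> openin (top_of_set (Rm1 m)) U \<and>
     (\<forall>T\<in>Pow {1..m}. \<forall>k\<in>{0..m}.
        (\<forall>x\<in>U. (\<lambda>t. F (x(k := t)) T) differentiable (at (x k))) \<and>
        continuous_on U (\<lambda>x. pd F k x T)) \<and>
     (\<forall>x\<in>U. \<forall>T\<in>Pow {1..m}.
        pd F 0 x T + (\<Sum>k\<in>{1..m}. cl_mult m (cl_basis k) (pd F k x) T) = 0)"

text \<open>Half-spaces: sign eps = 1 gives {x_0 > -a}, eps = -1 gives {x_0 < a}.\<close>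
definition halfspace :: "nat \<Rightarrow> real \<Rightarrow> real \<Rightarrow> (nat \<Rightarrow> real) set" where
  "halfspace m \<epsilon> a = {x \<in> Rm1 m. \<epsilon> * x 0 > - a}"

definition A2 :: "nat \<Rightarrow> (nat \<Rightarrow> real) set \<Rightarrow> ((nat \<Rightarrow> real) \<Rightarrow> cliff) \<Rightarrow> bool" where
  "A2 m U f \<longleftrightarrow> left_monogenic m U f \<and>
     (\<integral>\<^sup>+ x\<in>U. ennreal (cl_norm2 m (f x)) \<partial>Mx m) < \<infinity>"

definition L2 :: "nat \<Rightarrow> ((nat \<Rightarrow> real) \<Rightarrow> cliff) \<Rightarrow> bool" where
  "L2 m g \<longleftrightarrow> (\<forall>T\<in>Pow {1..m}. (\<lambda>\<xi>. g \<xi> T) \<in> borel_measurable (Mxi m)) \<and>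
     (\<integral>\<^sup>+ \<xi>. ennreal (cl_norm2 m (g \<xi>)) \<partial>Mxi m) < \<infinity>"

definition fourier_trunc :: "nat \<Rightarrow> ((nat \<Rightarrow> real) \<Rightarrow> cliff) \<Rightarrow> real \<Rightarrow> (nat \<Rightarrow> real) \<Rightarrow> cliff" where
  "fourier_trunc m h R \<xi> = (\<lambda>T. \<integral>x. indicator {y. vnorm m y \<le> R} x *\<^sub>R
       (cis (- vinner m x \<xi>) * h x T) \<partial>Mxi m)"

definition is_L2_fourier :: "nat \<Rightarrow> ((nat \<Rightarrow> real) \<Rightarrow> cliff) \<Rightarrow> ((nat \<Rightarrow> real) \<Rightarrow> cliff) \<Rightarrow> bool" where
  "is_L2_fourier m h g \<longleftrightarrow> L2 m h \<and> L2 m g \<and>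
     ((\<lambda>R. \<integral>\<^sup>+ \<xi>. ennreal (cl_norm2 m (\<lambda>T. fourier_trunc m h R \<xi> T - g \<xi> T)) \<partial>Mxi m)
        \<longlongrightarrow> 0) at_top"

definition restr0 :: "((nat \<Rightarrow> real) \<Rightarrow> cliff) \<Rightarrow> (nat \<Rightarrow> real) \<Rightarrow> cliff" where
  "restr0 f = (\<lambda>y. f (y(0 := 0)))"

text \<open>chi_eps(xi) = 1/2 (1 + eps i xi/|xi|), eps = +1 or -1.\<close>
definition chi :: "nat \<Rightarrow> real \<Rightarrow> (nat \<Rightarrow> real) \<Rightarrow> cliff" where
  "chi m \<epsilon> \<xi> = (\<lambda>T. (if T = {} then 1/2 else 0) +
      (\<Sum>j\<in>{1..m}. if T = {j} then \<i> * complex_of_real (\<epsilon> * \<xi> j / (2 * vnorm m \<xi>)) else 0))"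

definition ekernel :: "nat \<Rightarrow> real \<Rightarrow> (nat \<Rightarrow> real) \<Rightarrow> (nat \<Rightarrow> real) \<Rightarrow> cliff" where
  "ekernel m \<epsilon> x \<xi> = (\<lambda>T. cis (vinner m x \<xi>) * complex_of_real (exp (- \<epsilon> * x 0 * vnorm m \<xi>)) * chi m \<epsilon> \<xi> T)"

end

theory Submission
  imports Defs "HOL-Probability.Characteristic_Functions"
begin

text \<open>
  Write \<open>f\<^sub>t\<close> for the restriction of \<open>f\<close> to the hyperplane at height \<open>t\<close>. On the Fourier side the
  monogenic equation becomes the ordinary differential equation \<open>\<partial>\<^sub>t F + i \<xi> F = 0\<close>, and since
  \<open>(i \<xi>)\<^sup>2 = |\<xi>|\<^sup>2\<close> the idempotents \<open>\<chi>\<^sub>\<plusminus>\<close> split it into \<open>e^(\<plusminus> t |\<xi>|) \<chi>\<^sub>\<plusminus> F = const\<close>.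
  Square integrability over the half space kills one of the two components; integrating
  \<open>e^(-2 t |\<xi>|)\<close> in \<open>t\<close> turns the norm of the other one into the stated weight.

  A monogenic \<open>f\<close> is only known to be continuously differentiable, and only almost every slice is known to
  be square integrable. Therefore \<open>f\<^sub>t\<close> is first multiplied by a compactly supported cutoff of width \<open>R\<close>.
  The transform of the product solves the same equation up to an error of order \<open>1/R\<close> in \<open>L\<^sup>2\<close>.
  The component \<open>\<chi>\<^sub>+\<close> is controlled by lower slices and \<open>\<chi>\<^sub>-\<close> by higher ones,
  so every slice is square integrable, and the cutoff can then be removed.

  The Fourier analysis on \<open>L\<^sup>2\<close> rests on one inequality,
  \<open>\<parallel>ft h\<parallel>\<^sup>2 \<le> (2 \<pi>)\<^sup>m \<parallel>h\<parallel>\<^sup>2\<close> for integrable \<open>h\<close>, obtained by inserting a Gaussian weight.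
\<close>

section \<open>Gaussian weights and the bound for the Fourier transform\<close>

text \<open>Constants are irrelevant to finiteness, so one-sided inequalities with explicit factors
  replace Plancherel's identity; only the inversion formula must be exact, and it holds at every
  point because the slices are continuous. The circularity to break is that a slice has to be square
  integrable before it has a transform, while its size can be estimated only on the transform side.
  Cut-off slices are integrable, their transforms are honest integrals, and the reverse inequality
  \<open>l2_le_l2_ft\<close> carries bounds that are uniform in \<open>R\<close> back to the slices.
  The error enters only through an integral over heights, which membership in A^2 controls, so a
  single slice of infinite norm does no harm. In the other direction there is room to spare:
  strictly inside the half space Cauchy-Schwarz turns the weighted square integral into absolute
  integrability of the symbol, even with an extra factor \<open>vnorm m \<xi>\<close>, so the
  representing integral can be differentiated under the sign.\<close>

lemma space_Mxi: "space (Mxi m) = PiE {1..m} (\<lambda>_. UNIV)"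
  by (simp add: Mxi_def space_PiM)

lemma sigma_finite_Mxi: "sigma_finite_measure (Mxi m)"
proof -
  interpret product_sigma_finite "\<lambda>_::nat. lborel :: real measure" ..
  show ?thesis unfolding Mxi_def by (rule sigma_finite) simp
qed

lemma pair_sigma_finite_Mxi: "pair_sigma_finite (Mxi m) (Mxi m)"
  using sigma_finite_Mxi by (simp add: pair_sigma_finite_def)

lemma measurable_component_Mxi [measurable]:
  "j \<in> {1..m} \<Longrightarrow> (\<lambda>x. x j) \<in> borel_measurable (Mxi m)"
  unfolding Mxi_def using measurable_component_singleton[of j "{1..m}" "\<lambda>_. lborel"] by simp

lemma measurable_component_compose_Mxi [measurable (raw)]:
  "f \<in> measurable N (Mxi m) \<Longrightarrow> j \<in> {1..m} \<Longrightarrow> (\<lambda>p. f p j) \<in> borel_measurable N"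
  by (rule measurable_compose[OF _ measurable_component_Mxi])

lemma measurable_vinner_pair [measurable]:
  assumes [measurable]: "f \<in> measurable N (Mxi m)" "g \<in> measurable N (Mxi m)"
  shows "(\<lambda>p. vinner m (f p) (g p)) \<in> borel_measurable N"
  unfolding vinner_def by measurable

lemma measurable_vnorm [measurable]:
  assumes [measurable]: "f \<in> measurable N (Mxi m)"
  shows "(\<lambda>p. vnorm m (f p)) \<in> borel_measurable N"
  unfolding vnorm_def by measurable

lemma vinner_commute: "vinner m x y = vinner m y x"
  by (simp add: vinner_def mult.commute)

lemma borel_measurable_cis [measurable]: "cis \<in> borel_measurable borel"
  by (intro borel_measurable_continuous_onI continuous_on_cis continuous_on_id)

lemma borel_measurable_cnj [measurable]: "cnj \<in> borel_measurable borel"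
  by (intro borel_measurable_continuous_onI continuous_on_cnj continuous_on_id)

text \<open>The sign is a parameter because both the transform (\<open>s = -1\<close>) and the
  synthesis integral (\<open>s = 1\<close>) occur; the estimates treat the two together under
  \<open>s\<^sup>2 = 1\<close>.\<close>

definition ft :: "nat \<Rightarrow> real \<Rightarrow> ((nat \<Rightarrow> real) \<Rightarrow> complex) \<Rightarrow> (nat \<Rightarrow> real) \<Rightarrow> complex" where
  "ft m s h \<xi> = (\<integral>x. cis (s * vinner m x \<xi>) * h x \<partial>Mxi m)"

text \<open>The squared norm, with values in \<open>ennreal\<close>: it makes sense before square
  integrability is known, and Fatou and Tonelli apply to it directly.\<close>

definition l2 :: "nat \<Rightarrow> ((nat \<Rightarrow> real) \<Rightarrow> complex) \<Rightarrow> ennreal" where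
  "l2 m h = (\<integral>\<^sup>+x. ennreal ((cmod (h x))\<^sup>2) \<partial>Mxi m)"

definition gauss :: "nat \<Rightarrow> real \<Rightarrow> (nat \<Rightarrow> real) \<Rightarrow> real" where
  "gauss m d \<xi> = (\<Prod>j\<in>{1..m}. exp (- d * (\<xi> j)\<^sup>2 / 2))"

text \<open>The Gaussian density of variance \<open>d\<close> about \<open>x\<close>, scaled to
  total mass \<open>(2 * pi) ^ m\<close>, which is the scale at which the transform without
  prefactor produces it.\<close>

definition heat :: "nat \<Rightarrow> real \<Rightarrow> (nat \<Rightarrow> real) \<Rightarrow> (nat \<Rightarrow> real) \<Rightarrow> real" where
  "heat m d x y = (\<Prod>j\<in>{1..m}. sqrt (2 * pi / d) * exp (- (y j - x j)\<^sup>2 / (2 * d)))"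

lemma measurable_ft [measurable]:
  assumes [measurable]: "h \<in> borel_measurable (Mxi m)"
  shows "ft m s h \<in> borel_measurable (Mxi m)"
proof -
  interpret sigma_finite_measure "Mxi m" by (rule sigma_finite_Mxi)
  show ?thesis unfolding ft_def by measurable
qed

lemma measurable_gauss [measurable]: "gauss m d \<in> borel_measurable (Mxi m)"
  unfolding gauss_def by measurable

lemma measurable_heat [measurable]:
  assumes [measurable]: "f \<in> measurable N (Mxi m)" "g \<in> measurable N (Mxi m)"
  shows "(\<lambda>p. heat m d (f p) (g p)) \<in> borel_measurable N"
  unfolding heat_def by measurable

lemma gauss_nonneg: "0 \<le> gauss m d \<xi>"
  by (simp add: gauss_def prod_nonneg)

lemma gauss_le_1: "0 \<le> d \<Longrightarrow> gauss m d \<xi> \<le> 1"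
  unfolding gauss_def by (rule prod_le_1) auto

lemma heat_nonneg: "0 < d \<Longrightarrow> 0 \<le> heat m d x y"
  by (simp add: heat_def prod_nonneg)

lemma heat_commute: "heat m d x y = heat m d y x"
  by (simp add: heat_def power2_commute)

text \<open>A rescaling of the characteristic function of the standard normal distribution. Every
  explicit transform below comes from this one.\<close>

lemma gaussian_fourier_1d:
  fixes d t :: real assumes d: "0 < d"
  shows "integrable lborel (\<lambda>x. exp (- d * x\<^sup>2 / 2))"
    and "(\<integral>x. cis (t * x) * complex_of_real (exp (- d * x\<^sup>2 / 2)) \<partial>lborel)
           = complex_of_real (sqrt (2 * pi / d) * exp (- t\<^sup>2 / (2 * d)))"
proof -
  have i1: "integrable lborel (\<lambda>x::real. exp (- x\<^sup>2 / 2))"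
  proof -
    have "integrable lborel (\<lambda>x. sqrt (2*pi) * std_normal_density x)"
      using integrable_normal_moment[of 1 0 0] by simp
    then show ?thesis by (simp add: std_normal_density_def)
  qed
  have e: "exp (- (0 + sqrt d * x)\<^sup>2 / 2) = exp (- d * x\<^sup>2 / 2)" for x
    using d by (simp add: power_mult_distrib)
  show "integrable lborel (\<lambda>x. exp (- d * x\<^sup>2 / 2))"
    using lborel_integrable_real_affine[OF i1, of "sqrt d" 0] d unfolding e by simp
  \<comment> \<open>The frequency that becomes \<open>t\<close> when \<open>sqrt d * x\<close> is
    substituted for \<open>x\<close>.\<close>
  define u where "u = t / sqrt d"
  have "char std_normal_distribution u = (\<integral>x. std_normal_density x *\<^sub>R iexp (u * x) \<partial>lborel)"
    unfolding char_def by (subst integral_density) auto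
  also have "\<dots> = (\<integral>x. complex_of_real (1 / sqrt (2 * pi)) * (cis (u * x) * complex_of_real (exp (- x\<^sup>2 / 2))) \<partial>lborel)"
    by (intro Bochner_Integration.integral_cong refl)
       (simp add: std_normal_density_def cis_conv_exp scaleR_conv_of_real)
  also have "\<dots> = complex_of_real (1 / sqrt (2 * pi)) * (\<integral>x. (cis (u * x) * complex_of_real (exp (- x\<^sup>2 / 2))) \<partial>lborel)"
    by (rule integral_mult_right_zero)
  finally have 1: "(\<integral>x. (cis (u * x) * complex_of_real (exp (- x\<^sup>2 / 2))) \<partial>lborel)
       = complex_of_real (sqrt (2 * pi) * exp (- u\<^sup>2 / 2))"
    by (simp add: char_std_normal_distribution field_simps)
  have "(\<integral>x. (cis (u * x) * complex_of_real (exp (- x\<^sup>2 / 2))) \<partial>lborel)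
     = \<bar>sqrt d\<bar> *\<^sub>R (\<integral>x. cis (u * (0 + sqrt d * x)) * complex_of_real (exp (- (0 + sqrt d * x)\<^sup>2 / 2)) \<partial>lborel)"
    by (rule lborel_integral_real_affine) (use d in simp)
  also have "\<dots> = complex_of_real (sqrt d) * (\<integral>x. cis (t * x) * complex_of_real (exp (- d * x\<^sup>2 / 2)) \<partial>lborel)"
    unfolding e using d by (simp add: u_def scaleR_conv_of_real)
  finally have "complex_of_real (sqrt d) * (\<integral>x. cis (t * x) * complex_of_real (exp (- d * x\<^sup>2 / 2)) \<partial>lborel)
       = complex_of_real (sqrt (2 * pi) * exp (- u\<^sup>2 / 2))" using 1 by simp
  then show "(\<integral>x. cis (t * x) * complex_of_real (exp (- d * x\<^sup>2 / 2)) \<partial>lborel)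
           = complex_of_real (sqrt (2 * pi / d) * exp (- t\<^sup>2 / (2 * d)))"
    using d by (simp add: u_def power_divide real_sqrt_divide field_simps)
qed

lemma integrable_gauss: assumes "0 < d" shows "integrable (Mxi m) (gauss m d)"
proof -
  interpret product_sigma_finite "\<lambda>_::nat. lborel :: real measure" ..
  show ?thesis unfolding Mxi_def gauss_def
    by (rule product_integrable_prod) (use gaussian_fourier_1d(1)[OF assms] in auto)
qed

lemma integrable_cis_mult [simp]:
  fixes h :: "'a \<Rightarrow> complex"
  assumes [measurable]: "\<phi> \<in> borel_measurable N" and "integrable N h"
  shows "integrable N (\<lambda>x. cis (\<phi> x) * h x)"
  by (rule Bochner_Integration.integrable_bound[OF assms(2)])
     (use assms in \<open>auto simp: norm_mult\<close>)

lemma cis_sum: "finite A \<Longrightarrow> cis (\<Sum>j\<in>A. f j) = (\<Prod>j\<in>A. cis (f j))"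
  by (induction rule: finite_induct) (auto simp flip: cis_mult)

text \<open>Modulation and Gaussian both factor over the coordinates, so a product of
  one-dimensional transforms remains; the modulation only moves the centre to
  \<open>x\<close>.\<close>

lemma ft_gauss_modulated:
  assumes d: "0 < d" and s: "s\<^sup>2 = 1"
  shows "ft m s (\<lambda>\<xi>. cis (- s * vinner m x \<xi>) * complex_of_real (gauss m d \<xi>)) y = complex_of_real (heat m d x y)"
proof -
  interpret product_sigma_finite "\<lambda>_::nat. lborel :: real measure" ..
  have "ft m s (\<lambda>\<xi>. cis (- s * vinner m x \<xi>) * complex_of_real (gauss m d \<xi>)) y
     = (\<integral>\<xi>. (\<Prod>j\<in>{1..m}. cis (s * (y j - x j) * \<xi> j) * complex_of_real (exp (- d * (\<xi> j)\<^sup>2 / 2))) \<partial>Mxi m)"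
    unfolding ft_def
    by (intro Bochner_Integration.integral_cong refl)
       (simp add: gauss_def prod.distrib vinner_def flip: cis_sum,
        simp add: cis_mult algebra_simps sum_distrib_left sum_subtractf)
  also have "\<dots> = (\<Prod>j\<in>{1..m}. \<integral>t. cis (s * (y j - x j) * t) * complex_of_real (exp (- d * t\<^sup>2 / 2)) \<partial>lborel)"
    unfolding Mxi_def
    by (rule product_integral_prod)
       (auto intro!: integrable_cis_mult integrable_of_real gaussian_fourier_1d(1)[OF d, simplified])
  also have "\<dots> = complex_of_real (heat m d x y)"
    unfolding heat_def of_real_prod
    by (intro prod.cong refl, subst gaussian_fourier_1d(2)[OF d]) (simp add: power_mult_distrib s)
  finally show ?thesis .
qed

lemma has_integral_heat:
  assumes d: "0 < d"
  shows "integrable (Mxi m) (heat m d x)" and "(\<integral>y. heat m d x y \<partial>Mxi m) = (2 * pi) ^ m"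
proof -
  interpret product_sigma_finite "\<lambda>_::nat. lborel :: real measure" ..
  have i: "integrable lborel (\<lambda>t. sqrt (2 * pi / d) * exp (- (t - c)\<^sup>2 / (2 * d)))" for c
    using lborel_integrable_real_affine[OF gaussian_fourier_1d(1)[of "1/d"], of 1 "-c"] d
    by (auto simp: field_simps)
  have v: "(\<integral>t. sqrt (2 * pi / d) * exp (- (t - c)\<^sup>2 / (2 * d)) \<partial>lborel) = 2 * pi" for c
  proof -
    \<comment> \<open>The total mass is the transform at frequency 0, taken with \<open>1/d\<close>
      in place of \<open>d\<close>.\<close>
    have "complex_of_real (\<integral>t. exp (- (1/d) * t\<^sup>2 / 2) \<partial>lborel) = complex_of_real (sqrt (2 * pi / (1/d)))"
      using gaussian_fourier_1d(2)[of "1/d" 0] d by simp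
    then have "(\<integral>t. exp (- (1/d) * t\<^sup>2 / 2) \<partial>lborel) = sqrt (2 * pi * d)"
      by (simp only: of_real_eq_iff) (simp)
    then have "(\<integral>t. exp (- (t - c)\<^sup>2 / (2 * d)) \<partial>lborel) = sqrt (2 * pi * d)"
      by (subst lborel_integral_real_affine[of 1 _ c]) (auto simp: field_simps)
    then show ?thesis using d
      by (simp add: real_sqrt_mult[symmetric]) (simp add: power2_eq_square[symmetric] real_sqrt_mult)
  qed
  show "integrable (Mxi m) (heat m d x)" unfolding Mxi_def heat_def
    by (rule product_integrable_prod) (use i in auto)
  have "(\<integral>y. heat m d x y \<partial>Mxi m) = (\<Prod>j\<in>{1..m}. \<integral>t. sqrt (2 * pi / d) * exp (- (t - x j)\<^sup>2 / (2 * d)) \<partial>lborel)"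
    unfolding Mxi_def heat_def by (rule product_integral_prod) (use i in auto)
  then show "(\<integral>y. heat m d x y \<partial>Mxi m) = (2 * pi) ^ m" by (simp only: v) simp
qed

lemma nn_integral_heat:
  assumes d: "0 < d" shows "(\<integral>\<^sup>+y. ennreal (heat m d x y) \<partial>Mxi m) = ennreal ((2 * pi) ^ m)"
  by (subst nn_integral_eq_integral) (auto simp: has_integral_heat[OF d] heat_nonneg[OF d])

section \<open>Multiplication formula and Bessel inequality\<close>

lemma norm_ft_le: "integrable (Mxi m) h \<Longrightarrow> cmod (ft m s h \<xi>) \<le> (\<integral>x. cmod (h x) \<partial>Mxi m)"
  unfolding ft_def by (rule order_trans[OF integral_norm_bound]) (simp add: norm_mult)

text \<open>The kernel is symmetric in its two variables and of modulus 1, so Fubini applies as soon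
  as both functions are integrable.\<close>

lemma ft_multiplication_formula:
  assumes u: "integrable (Mxi m) u" and v: "integrable (Mxi m) v"
  shows "(\<integral>\<xi>. ft m s u \<xi> * v \<xi> \<partial>Mxi m) = (\<integral>x. u x * ft m s v x \<partial>Mxi m)"
proof -
  interpret pair_sigma_finite "Mxi m" "Mxi m" by (rule pair_sigma_finite_Mxi)
  have [measurable]: "u \<in> borel_measurable (Mxi m)" "v \<in> borel_measurable (Mxi m)"
    using u v by auto
  have int: "integrable (Mxi m \<Otimes>\<^sub>M Mxi m) (\<lambda>(x, \<xi>). cis (s * vinner m x \<xi>) * (u x * v \<xi>))"
  proof (rule Fubini_integrable)
    show "integrable (Mxi m) (\<lambda>x. \<integral>y. cmod (case (x, y) of (x, \<xi>) \<Rightarrow> cis (s * vinner m x \<xi>) * (u x * v \<xi>)) \<partial>Mxi m)"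
      using u by (simp add: norm_mult)
    show "AE x in Mxi m. integrable (Mxi m) (\<lambda>y. case (x, y) of (x, \<xi>) \<Rightarrow> cis (s * vinner m x \<xi>) * (u x * v \<xi>))"
      using v by (auto intro!: integrable_cis_mult)
  qed measurable
  have "(\<integral>\<xi>. ft m s u \<xi> * v \<xi> \<partial>Mxi m) = (\<integral>\<xi>. (\<integral>x. cis (s * vinner m x \<xi>) * (u x * v \<xi>) \<partial>Mxi m) \<partial>Mxi m)"
    unfolding ft_def by (simp flip: integral_mult_left_zero add: mult.assoc)
  also have "\<dots> = (\<integral>x. (\<integral>\<xi>. cis (s * vinner m x \<xi>) * (u x * v \<xi>) \<partial>Mxi m) \<partial>Mxi m)"
    by (rule Fubini_integral[OF int])
  also have "\<dots> = (\<integral>x. u x * ft m s v x \<partial>Mxi m)"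
    unfolding ft_def by (simp flip: integral_mult_right_zero add: mult_ac vinner_commute)
  finally show ?thesis .
qed

text \<open>The multiplication formula moves the transform from \<open>h\<close> to the modulated
  Gaussian. Damping a transform by a Gaussian and inverting it is therefore an average of
  \<open>h\<close> against \<open>heat\<close>; both the norm bounds and the inversion formula start
  from this.\<close>

lemma ft_gauss_smoothing:
  assumes d: "0 < d" and s: "s\<^sup>2 = 1" and h: "integrable (Mxi m) h" and x: "x \<in> space (Mxi m)"
  shows "(\<integral>\<xi>. ft m s h \<xi> * (cis (- s * vinner m x \<xi>) * complex_of_real (gauss m d \<xi>)) \<partial>Mxi m)
          = (\<integral>y. h y * complex_of_real (heat m d x y) \<partial>Mxi m)"
proof -
  have "integrable (Mxi m) (\<lambda>\<xi>. cis (- s * vinner m x \<xi>) * complex_of_real (gauss m d \<xi>))"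
    using x by (intro integrable_cis_mult integrable_of_real integrable_gauss d) measurable
  from ft_multiplication_formula[OF h this, of s] show ?thesis
    by (simp only: ft_gauss_modulated[OF d s])
qed

lemma gauss_tendsto_1: "(\<lambda>n. gauss m (1 / real (Suc n)) \<xi>) \<longlonglongrightarrow> 1"
proof -
  have "(\<lambda>n. \<Prod>j\<in>{1..m}. exp (- (1 / real (Suc n)) * (\<xi> j)\<^sup>2 / 2)) \<longlonglongrightarrow> (\<Prod>j\<in>{1..m}. exp (- 0 * (\<xi> j)\<^sup>2 / 2))"
    by (intro tendsto_intros LIMSEQ_inverse_real_of_nat[simplified inverse_eq_divide])
       auto
  then show ?thesis by (simp add: gauss_def)
qed

text \<open>With \<open>v\<close> the conjugate transform times the Gaussian, the left side is the
  integral of \<open>ft h * v\<close>, which the multiplication formula turns into a double integral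
  of \<open>h x * cnj (h y)\<close> against \<open>heat\<close>. That kernel is nonnegative,
  symmetric and has mass \<open>(2 * pi) ^ m\<close> in each variable, so a Schur test (half of each
  square in place of the product) gives the constant without loss.\<close>

lemma Bessel_ft_gauss:
  assumes d: "0 < d" and s: "s\<^sup>2 = 1" and h: "integrable (Mxi m) h"
  shows "(\<integral>\<^sup>+\<xi>. ennreal ((cmod (ft m s h \<xi>))\<^sup>2 * gauss m d \<xi>) \<partial>Mxi m) \<le> ennreal ((2 * pi) ^ m) * l2 m h"
proof -
  interpret pair_sigma_finite "Mxi m" "Mxi m" by (rule pair_sigma_finite_Mxi)
  have [measurable]: "h \<in> borel_measurable (Mxi m)" using h by auto
  define B where "B = (\<integral>x. cmod (h x) \<partial>Mxi m)"
  have B: "cmod (ft m s h \<xi>) \<le> B" for \<xi> using norm_ft_le[OF h] by (simp add: B_def)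
  define v where "v = (\<lambda>\<xi>. cnj (ft m s h \<xi>) * complex_of_real (gauss m d \<xi>))"
  have vint: "integrable (Mxi m) v" unfolding v_def
    by (rule Bochner_Integration.integrable_bound[OF integrable_mult_right[where c=B, OF integrable_gauss[OF d]]])
       (auto simp: norm_mult gauss_nonneg abs_mult intro!: mult_mono order_trans[OF B])
  have int2: "integrable (Mxi m) (\<lambda>\<xi>. (cmod (ft m s h \<xi>))\<^sup>2 * gauss m d \<xi>)"
    by (rule Bochner_Integration.integrable_bound[OF integrable_mult_right[where c="B\<^sup>2", OF integrable_gauss[OF d]]])
       (auto simp: norm_mult gauss_nonneg abs_mult intro!: mult_mono power_mono B)
  have ftv: "ft m s v x = cnj (\<integral>y. h y * complex_of_real (heat m d x y) \<partial>Mxi m)" if "x \<in> space (Mxi m)" for x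
    unfolding ft_gauss_smoothing[OF d s h that, symmetric]
    by (subst Bochner_Integration.integral_cnj[symmetric]) (simp add: ft_def v_def mult_ac vinner_commute cis_cnj)
  have "complex_of_real (\<integral>\<xi>. (cmod (ft m s h \<xi>))\<^sup>2 * gauss m d \<xi> \<partial>Mxi m) = (\<integral>\<xi>. ft m s h \<xi> * v \<xi> \<partial>Mxi m)"
    unfolding integral_complex_of_real[symmetric] v_def
    by (intro Bochner_Integration.integral_cong refl)
       (simp add: complex_norm_square[symmetric] flip: mult.assoc)
  also have "\<dots> = (\<integral>x. h x * ft m s v x \<partial>Mxi m)"
    by (rule ft_multiplication_formula[OF h vint])
  finally have eq: "(\<integral>\<xi>. (cmod (ft m s h \<xi>))\<^sup>2 * gauss m d \<xi> \<partial>Mxi m) = cmod (\<integral>x. h x * ft m s v x \<partial>Mxi m)"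
    by (metis (no_types, lifting) abs_of_nonneg gauss_nonneg integral_nonneg_AE AE_I2 mult_nonneg_nonneg norm_of_real zero_le_power2)
  have [simp]: "0 \<le> heat m d x y" for x y by (rule heat_nonneg[OF d])
  have "(\<integral>\<^sup>+\<xi>. ennreal ((cmod (ft m s h \<xi>))\<^sup>2 * gauss m d \<xi>) \<partial>Mxi m) = ennreal (\<integral>\<xi>. (cmod (ft m s h \<xi>))\<^sup>2 * gauss m d \<xi> \<partial>Mxi m)"
    by (rule nn_integral_eq_integral[OF int2]) (simp add: gauss_nonneg)
  also have "\<dots> \<le> (\<integral>\<^sup>+x. ennreal (cmod (h x * ft m s v x)) \<partial>Mxi m)"
    unfolding eq by (rule integral_norm_bound_ennreal)
     (rule Bochner_Integration.integrable_bound[OF integrable_mult_right[where c="complex_of_real (\<integral>x. cmod (v x) \<partial>Mxi m)", OF h]],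
       use vint in \<open>auto simp: norm_mult mult.commute intro!: mult_left_mono order_trans[OF norm_ft_le]\<close>)
  also have "\<dots> \<le> (\<integral>\<^sup>+x. (\<integral>\<^sup>+y. ennreal ((cmod (h x))\<^sup>2/2 * heat m d x y) + ennreal ((cmod (h y))\<^sup>2/2 * heat m d x y) \<partial>Mxi m) \<partial>Mxi m)"
  proof (rule nn_integral_mono)
    fix x assume x: "x \<in> space (Mxi m)"
    have "ennreal (cmod (h x * ft m s v x)) = ennreal (cmod (h x)) * ennreal (cmod (\<integral>y. h y * complex_of_real (heat m d x y) \<partial>Mxi m))"
      using ftv[OF x] by (simp add: norm_mult ennreal_mult)
    also have "\<dots> \<le> ennreal (cmod (h x)) * (\<integral>\<^sup>+y. ennreal (cmod (h y * complex_of_real (heat m d x y))) \<partial>Mxi m)"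
    proof (intro mult_left_mono)
      \<comment> \<open>If the product is not integrable, its Bochner integral is 0 by convention
        and the bound is trivial.\<close>
      show "ennreal (cmod (\<integral>y. h y * complex_of_real (heat m d x y) \<partial>Mxi m)) \<le> (\<integral>\<^sup>+y. ennreal (cmod (h y * complex_of_real (heat m d x y))) \<partial>Mxi m)"
        by (cases "integrable (Mxi m) (\<lambda>y. h y * complex_of_real (heat m d x y))")
           (auto intro: integral_norm_bound_ennreal simp: not_integrable_integral_eq)
    qed simp
    also have "\<dots> = (\<integral>\<^sup>+y. ennreal (cmod (h x)) * ennreal (cmod (h y * complex_of_real (heat m d x y))) \<partial>Mxi m)"
      using x by (subst nn_integral_cmult) auto
    also have "\<dots> \<le> (\<integral>\<^sup>+y. ennreal ((cmod (h x))\<^sup>2/2 * heat m d x y) + ennreal ((cmod (h y))\<^sup>2/2 * heat m d x y) \<partial>Mxi m)"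
    proof (rule nn_integral_mono)
      fix y
      have "cmod (h x) * cmod (h y) \<le> (cmod (h x))\<^sup>2/2 + (cmod (h y))\<^sup>2/2"
        using sum_squares_bound[of "cmod (h x)" "cmod (h y)"] by simp
      from mult_right_mono[OF this, of "heat m d x y"]
      show "ennreal (cmod (h x)) * ennreal (cmod (h y * complex_of_real (heat m d x y)))
        \<le> ennreal ((cmod (h x))\<^sup>2/2 * heat m d x y) + ennreal ((cmod (h y))\<^sup>2/2 * heat m d x y)"
        by (simp add: norm_mult mult.assoc distrib_right flip: ennreal_mult' ennreal_plus)
    qed
    finally show "ennreal (cmod (h x * ft m s v x)) \<le> \<dots>" .
  qed
  also have "\<dots> = (\<integral>\<^sup>+x. (\<integral>\<^sup>+y. ennreal ((cmod (h x))\<^sup>2/2 * heat m d x y) \<partial>Mxi m) \<partial>Mxi m) + (\<integral>\<^sup>+x. (\<integral>\<^sup>+y. ennreal ((cmod (h y))\<^sup>2/2 * heat m d x y) \<partial>Mxi m) \<partial>Mxi m)"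
  proof -
    have "(\<integral>\<^sup>+y. ennreal ((cmod (h x))\<^sup>2/2 * heat m d x y) + ennreal ((cmod (h y))\<^sup>2/2 * heat m d x y) \<partial>Mxi m)
       = (\<integral>\<^sup>+y. ennreal ((cmod (h x))\<^sup>2/2 * heat m d x y) \<partial>Mxi m) + (\<integral>\<^sup>+y. ennreal ((cmod (h y))\<^sup>2/2 * heat m d x y) \<partial>Mxi m)"
       if "x \<in> space (Mxi m)" for x
      using that by (intro nn_integral_add) auto
    then show ?thesis
      by (subst nn_integral_add[symmetric]) (auto intro!: nn_integral_cong)
  qed
  also have "(\<integral>\<^sup>+x. (\<integral>\<^sup>+y. ennreal ((cmod (h y))\<^sup>2/2 * heat m d x y) \<partial>Mxi m) \<partial>Mxi m)
    = (\<integral>\<^sup>+x. (\<integral>\<^sup>+y. ennreal ((cmod (h x))\<^sup>2/2 * heat m d x y) \<partial>Mxi m) \<partial>Mxi m)"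
    by (subst Fubini') (auto simp: heat_commute)
  also have "(\<integral>\<^sup>+x. (\<integral>\<^sup>+y. ennreal ((cmod (h x))\<^sup>2/2 * heat m d x y) \<partial>Mxi m) \<partial>Mxi m)
     = (\<integral>\<^sup>+x. ennreal ((cmod (h x))\<^sup>2/2) * ennreal ((2*pi)^m) \<partial>Mxi m)"
  proof (rule nn_integral_cong)
    fix x assume x: "x \<in> space (Mxi m)"
    have "(\<integral>\<^sup>+y. ennreal ((cmod (h x))\<^sup>2/2 * heat m d x y) \<partial>Mxi m) = (\<integral>\<^sup>+y. ennreal ((cmod (h x))\<^sup>2/2) * ennreal (heat m d x y) \<partial>Mxi m)"
      by (intro nn_integral_cong ennreal_mult) auto
    also have "\<dots> = ennreal ((cmod (h x))\<^sup>2/2) * ennreal ((2*pi)^m)"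
      using x by (subst nn_integral_cmult) (auto simp only: nn_integral_heat[OF d], measurable)
    finally show "(\<integral>\<^sup>+y. ennreal ((cmod (h x))\<^sup>2/2 * heat m d x y) \<partial>Mxi m) = \<dots>" .
  qed
  also have "\<dots> + \<dots> = (\<integral>\<^sup>+x. ennreal ((2*pi)^m) * ennreal ((cmod (h x))\<^sup>2) \<partial>Mxi m)"
    by (subst nn_integral_add[symmetric])
       (auto intro!: nn_integral_cong simp: mult.commute simp flip: ennreal_mult' ennreal_plus distrib_left)
  also have "\<dots> = ennreal ((2 * pi) ^ m) * l2 m h"
    by (simp add: nn_integral_cmult l2_def)
  finally show ?thesis .
qed

text \<open>Fatou's lemma in the form that removes Gaussians and cutoffs: a uniform bound passes to
  the limit without a dominating function.\<close>

lemma nn_integral_le_of_pointwise_limit: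
  fixes u :: "nat \<Rightarrow> 'a \<Rightarrow> ennreal"
  assumes [measurable]: "\<And>n. u n \<in> borel_measurable N"
    and lim: "AE x in N. (\<lambda>n. u n x) \<longlonglongrightarrow> v x"
    and bound: "\<And>n. (\<integral>\<^sup>+x. u n x \<partial>N) \<le> C"
  shows "(\<integral>\<^sup>+x. v x \<partial>N) \<le> C"
proof -
  have "(\<integral>\<^sup>+x. v x \<partial>N) = (\<integral>\<^sup>+x. liminf (\<lambda>n. u n x) \<partial>N)"
    by (intro nn_integral_cong_AE) (use lim in eventually_elim, simp add: lim_imp_Liminf)
  also have "\<dots> \<le> liminf (\<lambda>n. \<integral>\<^sup>+x. u n x \<partial>N)"
    by (rule nn_integral_liminf) measurable
  also have "\<dots> \<le> liminf (\<lambda>_::nat. C)"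
    by (rule Liminf_mono) (simp add: bound)
  finally show ?thesis by (simp add: Liminf_const)
qed

text \<open>The bound of \<open>Bessel_ft_gauss\<close> does not depend on \<open>d\<close>, so the
  Gaussian may tend to 1.\<close>

lemma l2_ft_le:
  assumes s: "s\<^sup>2 = 1" and h: "integrable (Mxi m) h"
  shows "l2 m (ft m s h) \<le> ennreal ((2 * pi) ^ m) * l2 m h"
  unfolding l2_def[of m "ft m s h"]
proof (rule nn_integral_le_of_pointwise_limit)
  have [measurable]: "h \<in> borel_measurable (Mxi m)" using h by auto
  let ?f = "\<lambda>n \<xi>. ennreal ((cmod (ft m s h \<xi>))\<^sup>2 * gauss m (1 / real (Suc n)) \<xi>)"
  show "?f n \<in> borel_measurable (Mxi m)" for n by measurable
  have "(\<lambda>n. ?f n \<xi>) \<longlonglongrightarrow> ennreal ((cmod (ft m s h \<xi>))\<^sup>2)" for \<xi>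
    using tendsto_mult[OF tendsto_const gauss_tendsto_1, of "(cmod (ft m s h \<xi>))\<^sup>2" m \<xi>]
    by (intro tendsto_ennrealI) simp
  then show "AE \<xi> in Mxi m. (\<lambda>n. ?f n \<xi>) \<longlonglongrightarrow> ennreal ((cmod (ft m s h \<xi>))\<^sup>2)" by simp
  show "(\<integral>\<^sup>+\<xi>. ?f n \<xi> \<partial>Mxi m) \<le> ennreal ((2 * pi) ^ m) * l2 m h" for n
    by (rule Bessel_ft_gauss[OF _ s h]) simp
qed

section \<open>The Fourier transform on square integrable functions\<close>

lemma tendsto_coordinatewise:
  fixes y :: "'b \<Rightarrow> 'i \<Rightarrow> 'a::topological_space"
  assumes "\<And>i. ((\<lambda>n. y n i) \<longlongrightarrow> x i) F"
  shows "(y \<longlongrightarrow> x) F"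
  using assms limitin_componentwise[of "\<lambda>_. euclidean" UNIV y x F]
  by (simp add: euclidean_product_topology)

text \<open>Continuity refers to the product topology on all functions from \<open>nat\<close>.
  Coordinates outside \<open>I\<close> are frozen at \<open>undefined\<close>, so counterexamples
  for the radii \<open>inverse (Suc n)\<close> would form a sequence converging to
  \<open>x\<close>.\<close>

lemma continuous_on_PiE_box:
  fixes h :: "(nat \<Rightarrow> real) \<Rightarrow> 'a::metric_space"
  assumes c: "continuous_on S h" and S: "S \<subseteq> PiE I (\<lambda>_. UNIV)" and x: "x \<in> S" and e: "0 < e"
  shows "\<exists>r>0. \<forall>y\<in>S. (\<forall>j\<in>I. \<bar>y j - x j\<bar> < r) \<longrightarrow> dist (h y) (h x) < e"
proof (rule ccontr)
  assume "\<not> ?thesis"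
  then have "\<forall>n. \<exists>y\<in>S. (\<forall>j\<in>I. \<bar>y j - x j\<bar> < inverse (real (Suc n))) \<and> \<not> dist (h y) (h x) < e"
    by (metis inverse_positive_iff_positive of_nat_0_less_iff zero_less_Suc)
  then obtain y where y: "\<And>n. y n \<in> S" "\<And>n j. j \<in> I \<Longrightarrow> \<bar>y n j - x j\<bar> < inverse (real (Suc n))"
      "\<And>n. \<not> dist (h (y n)) (h x) < e" by metis
  have "y \<longlonglongrightarrow> x"
  proof (rule tendsto_coordinatewise)
    fix i show "(\<lambda>n. y n i) \<longlonglongrightarrow> x i"
    proof (cases "i \<in> I")
      case True
      then have "norm (y n i - x i) \<le> inverse (real (Suc n))" for n using y(2)[of i n] by simp
      then have "(\<lambda>n. y n i - x i) \<longlonglongrightarrow> 0"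
        by (intro Lim_null_comparison[OF always_eventually LIMSEQ_inverse_real_of_nat]) auto
      then show ?thesis by (simp add: LIM_zero_iff)
    next
      case False
      then have "y n i = x i" for n
        using subsetD[OF S y(1)[of n]] subsetD[OF S x] by (auto simp: PiE_def extensional_def)
      then show ?thesis by simp
    qed
  qed
  then have "(h \<circ> y) \<longlonglongrightarrow> h x"
    using c x y(1) unfolding continuous_on_sequentially by blast
  then have "eventually (\<lambda>n. dist (h (y n)) (h x) < e) sequentially"
    using e by (auto dest: tendstoD simp: comp_def)
  then show False using y(3) by (auto simp: eventually_sequentially)
qed

lemma tendsto_0_ennreal_le:
  fixes f g :: "'a \<Rightarrow> ennreal"
  assumes "\<And>x. f x \<le> g x" and "(g \<longlongrightarrow> 0) F"
  shows "(f \<longlongrightarrow> 0) F"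
  by (rule tendsto_sandwich[OF always_eventually always_eventually tendsto_const assms(2)])
     (use assms(1) in auto)

section \<open>Calculus of squared norms\<close>

lemma l2_cong: "(\<And>x. x \<in> space (Mxi m) \<Longrightarrow> cmod (u x) = cmod (v x)) \<Longrightarrow> l2 m u = l2 m v"
  unfolding l2_def by (rule nn_integral_cong) simp

lemma l2_mono: "(\<And>x. x \<in> space (Mxi m) \<Longrightarrow> cmod (u x) \<le> cmod (v x)) \<Longrightarrow> l2 m u \<le> l2 m v"
  unfolding l2_def by (intro nn_integral_mono ennreal_leI power_mono) auto

lemma l2_cmult:
  assumes [measurable]: "u \<in> borel_measurable (Mxi m)"
  shows "l2 m (\<lambda>x. c * u x) = ennreal ((cmod c)\<^sup>2) * l2 m u"
  unfolding l2_def
  by (subst nn_integral_cmult[symmetric]) (auto simp: norm_mult power_mult_distrib ennreal_mult')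

text \<open>For squared norms the triangle inequality takes the form
  \<open>(a + b)\<^sup>2 \<le> 2 * a\<^sup>2 + 2 * b\<^sup>2\<close>, which is enough for finiteness
  and for limits equal to 0.\<close>

lemma l2_add_le:
  assumes [measurable]: "u \<in> borel_measurable (Mxi m)" "v \<in> borel_measurable (Mxi m)"
  shows "l2 m (\<lambda>x. u x + v x) \<le> 2 * l2 m u + 2 * l2 m v"
proof -
  have "l2 m (\<lambda>x. u x + v x) \<le> (\<integral>\<^sup>+x. 2 * ennreal ((cmod (u x))\<^sup>2) + 2 * ennreal ((cmod (v x))\<^sup>2) \<partial>Mxi m)"
    unfolding l2_def
  proof (rule nn_integral_mono)
    fix x
    have "(cmod (u x + v x))\<^sup>2 \<le> (cmod (u x) + cmod (v x))\<^sup>2"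
      by (intro power_mono norm_triangle_ineq) auto
    also have "\<dots> \<le> 2 * (cmod (u x))\<^sup>2 + 2 * (cmod (v x))\<^sup>2"
      using sum_squares_bound[of "cmod (u x)" "cmod (v x)"] by (simp add: power2_sum)
    finally have "ennreal ((cmod (u x + v x))\<^sup>2) \<le> ennreal (2 * (cmod (u x))\<^sup>2 + 2 * (cmod (v x))\<^sup>2)"
      by (rule ennreal_leI)
    also have "\<dots> = 2 * ennreal ((cmod (u x))\<^sup>2) + 2 * ennreal ((cmod (v x))\<^sup>2)"
      by (simp add: ennreal_plus ennreal_mult')
    finally show "ennreal ((cmod (u x + v x))\<^sup>2) \<le> 2 * ennreal ((cmod (u x))\<^sup>2) + 2 * ennreal ((cmod (v x))\<^sup>2)" .
  qed
  also have "\<dots> = 2 * l2 m u + 2 * l2 m v"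
    unfolding l2_def by (subst nn_integral_add) (auto simp: nn_integral_cmult)
  finally show ?thesis .
qed

lemma l2_uminus: "l2 m (\<lambda>x. - u x) = l2 m u"
  by (simp add: l2_def)

lemma l2_diff_le:
  assumes [measurable]: "u \<in> borel_measurable (Mxi m)" "v \<in> borel_measurable (Mxi m)"
  shows "l2 m (\<lambda>x. u x - v x) \<le> 2 * l2 m u + 2 * l2 m v"
  using l2_add_le[of u m "\<lambda>x. - v x"] by (simp add: l2_uminus)

lemma l2_triangle:
  assumes [measurable]: "u \<in> borel_measurable (Mxi m)" "v \<in> borel_measurable (Mxi m)" "w \<in> borel_measurable (Mxi m)"
  shows "l2 m (\<lambda>x. u x - w x) \<le> 2 * l2 m (\<lambda>x. u x - v x) + 2 * l2 m (\<lambda>x. v x - w x)"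
  using l2_add_le[of "\<lambda>x. u x - v x" m "\<lambda>x. v x - w x"] by simp

lemma Cauchy_Schwarz_l2:
  assumes [measurable]: "u \<in> borel_measurable (Mxi m)" "v \<in> borel_measurable (Mxi m)"
  shows "(\<integral>\<^sup>+x. ennreal (cmod (u x * v x)) \<partial>Mxi m)\<^sup>2 \<le> l2 m u * l2 m v"
  using Cauchy_Schwarz_nn_integral[of "\<lambda>x. ennreal (cmod (u x))" "Mxi m" "\<lambda>x. ennreal (cmod (v x))"]
  by (simp add: l2_def norm_mult ennreal_mult' ennreal_power)

lemma integrable_mult_l2:
  assumes [measurable]: "u \<in> borel_measurable (Mxi m)" "v \<in> borel_measurable (Mxi m)"
    and "l2 m u < \<infinity>" "l2 m v < \<infinity>"
  shows "integrable (Mxi m) (\<lambda>x. u x * v x)"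
proof (rule integrableI_bounded)
  have "(\<integral>\<^sup>+x. ennreal (cmod (u x * v x)) \<partial>Mxi m)\<^sup>2 < \<infinity>"
    using Cauchy_Schwarz_l2[of u m v] assms by (auto simp: ennreal_mult_less_top intro: le_less_trans)
  then show "(\<integral>\<^sup>+x. ennreal (cmod (u x * v x)) \<partial>Mxi m) < \<infinity>"
    by (simp add: power_less_top_ennreal)
qed measurable

text \<open>Norm convergence implies weak convergence: Cauchy-Schwarz bounds the squared difference
  of the integrals by \<open>l2 m (u n - g) * l2 m v\<close>.\<close>

lemma l2_pairing_tendsto:
  assumes [measurable]: "\<And>n::nat. u n \<in> borel_measurable (Mxi m)" "g \<in> borel_measurable (Mxi m)" "v \<in> borel_measurable (Mxi m)"
    and lim: "(\<lambda>n. l2 m (\<lambda>x. u n x - g x)) \<longlonglongrightarrow> 0" and v: "l2 m v < \<infinity>"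
    and int: "\<And>n. integrable (Mxi m) (\<lambda>x. u n x * v x)" "integrable (Mxi m) (\<lambda>x. g x * v x)"
  shows "(\<lambda>n. \<integral>x. u n x * v x \<partial>Mxi m) \<longlonglongrightarrow> (\<integral>x. g x * v x \<partial>Mxi m)"
proof -
  let ?d = "\<lambda>n. (\<integral>x. u n x * v x \<partial>Mxi m) - (\<integral>x. g x * v x \<partial>Mxi m)"
  have le: "ennreal ((cmod (?d n))\<^sup>2) \<le> l2 m (\<lambda>x. u n x - g x) * l2 m v" for n
  proof -
    have "?d n = (\<integral>x. (u n x - g x) * v x \<partial>Mxi m)"
      using int by (simp add: left_diff_distrib)
    moreover have i: "integrable (Mxi m) (\<lambda>x. (u n x - g x) * v x)"
      using int by (simp add: left_diff_distrib)
    ultimately have "ennreal (cmod (?d n)) \<le> (\<integral>\<^sup>+x. ennreal (cmod ((u n x - g x) * v x)) \<partial>Mxi m)"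
      by (simp only: integral_norm_bound_ennreal[OF i])
    then have "(ennreal (cmod (?d n)))\<^sup>2 \<le> (\<integral>\<^sup>+x. ennreal (cmod ((u n x - g x) * v x)) \<partial>Mxi m)\<^sup>2"
      by (rule power_mono) simp
    also have "\<dots> \<le> l2 m (\<lambda>x. u n x - g x) * l2 m v"
      by (rule Cauchy_Schwarz_l2) measurable
    finally show ?thesis by (simp add: ennreal_power)
  qed
  have "(\<lambda>n. l2 m (\<lambda>x. u n x - g x) * l2 m v) \<longlonglongrightarrow> 0 * l2 m v"
    using v by (intro tendsto_mult_ennreal lim tendsto_const) auto
  then have "(\<lambda>n. ennreal ((cmod (?d n))\<^sup>2)) \<longlonglongrightarrow> 0"
    by (intro tendsto_0_ennreal_le[OF le]) simp
  then have "(\<lambda>n. (cmod (?d n))\<^sup>2) \<longlonglongrightarrow> 0"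
    by (simp add: ennreal_0[symmetric] del: ennreal_0)
  then have "(\<lambda>n. sqrt ((cmod (?d n))\<^sup>2)) \<longlonglongrightarrow> sqrt 0" by (rule tendsto_real_sqrt)
  then have "(\<lambda>n. ?d n) \<longlonglongrightarrow> 0" by (simp add: tendsto_norm_zero_iff)
  then show ?thesis by (simp add: LIM_zero_iff)
qed

section \<open>The heat kernel as an approximate identity\<close>

lemma gauss_eq_exp_vnorm: "gauss m d \<xi> = exp (- d * (vnorm m \<xi>)\<^sup>2 / 2)"
  by (simp add: gauss_def vnorm_def sum_nonneg exp_sum[symmetric] sum_distrib_left sum_negf sum_divide_distrib)

lemma l2_gauss: assumes "0 < d" shows "l2 m (\<lambda>x. complex_of_real (gauss m d x)) < \<infinity>"
proof -
  have "l2 m (\<lambda>x. complex_of_real (gauss m d x)) \<le> (\<integral>\<^sup>+x. ennreal (gauss m d x) \<partial>Mxi m)"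
    unfolding l2_def using assms
    by (intro nn_integral_mono ennreal_leI)
       (auto simp: power2_eq_square gauss_nonneg intro!: mult_left_le gauss_le_1)
  also have "\<dots> < \<infinity>"
    by (subst nn_integral_eq_integral[OF integrable_gauss[OF assms]]) (auto simp: gauss_nonneg)
  finally show ?thesis .
qed

lemma l2_cis_mult: "l2 m (\<lambda>x. cis (\<phi> x) * u x) = l2 m u"
  by (simp add: l2_def norm_mult)

lemma heat_le: assumes "0 < d" shows "heat m d x y \<le> sqrt (2 * pi / d) ^ m"
proof -
  have "heat m d x y \<le> (\<Prod>j\<in>{1..m}. sqrt (2 * pi / d))"
    unfolding heat_def using assms by (intro prod_mono conjI mult_left_le) auto
  then show ?thesis by simp
qed

lemma l2_heat: assumes "0 < d" shows "l2 m (\<lambda>y. complex_of_real (heat m d x y)) < \<infinity>"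
proof -
  note b = heat_le[OF assms, of m x]
  have "l2 m (\<lambda>y. complex_of_real (heat m d x y)) \<le> (\<integral>\<^sup>+y. ennreal (sqrt (2 * pi / d) ^ m * heat m d x y) \<partial>Mxi m)"
    unfolding l2_def using assms
    by (intro nn_integral_mono ennreal_leI)
       (auto simp: power2_eq_square heat_nonneg intro!: mult_right_mono b)
  also have "\<dots> < \<infinity>"
    using has_integral_heat(1)[OF assms, of m x] assms
    by (subst nn_integral_eq_integral) (auto simp: heat_nonneg)
  finally show ?thesis .
qed

text \<open>The exponent is split in two halves: one yields the decay in \<open>r\<close>, the other
  is dominated, because \<open>d \<le> 1\<close>, by the fixed kernel with \<open>d = 2\<close>. The
  case \<open>r = 0\<close> is the global comparison from which integrability follows.\<close>

lemma heat_tail_bound: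
  assumes d: "0 < d" "d \<le> 1" and far: "r = 0 \<or> (\<exists>j\<in>{1..m}. r \<le> \<bar>y j - x j\<bar>)" and r: "0 \<le> r"
  shows "heat m d x y \<le> sqrt (2 / d) ^ m * exp (- r\<^sup>2 / (4 * d)) * heat m 2 x y"
proof -
  have "heat m d x y = sqrt (2 / d) ^ m * (\<Prod>j\<in>{1..m}. sqrt (2 * pi / 2) * (exp (- (y j - x j)\<^sup>2 / (4 * d)) * exp (- (y j - x j)\<^sup>2 / (4 * d))))"
  proof -
    have "sqrt (2 * pi / d) * exp (- (y j - x j)\<^sup>2 / (2 * d))
        = sqrt (2 / d) * (sqrt (2 * pi / 2) * (exp (- (y j - x j)\<^sup>2 / (4 * d)) * exp (- (y j - x j)\<^sup>2 / (4 * d))))" for j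
      using d by (simp add: exp_add[symmetric] real_sqrt_mult[symmetric] real_sqrt_divide field_simps)
    then show ?thesis unfolding heat_def by (simp only: prod.distrib) simp
  qed
  also have "\<dots> = sqrt (2 / d) ^ m * ((\<Prod>j\<in>{1..m}. exp (- (y j - x j)\<^sup>2 / (4 * d))) * (\<Prod>j\<in>{1..m}. sqrt (2 * pi / 2) * exp (- (y j - x j)\<^sup>2 / (4 * d))))"
    by (simp add: prod.distrib)
  also have "\<dots> \<le> sqrt (2 / d) ^ m * (exp (- r\<^sup>2 / (4 * d)) * heat m 2 x y)"
  proof (intro mult_left_mono mult_mono)
    have s: "(\<Prod>j\<in>{1..m}. exp (- (y j - x j)\<^sup>2 / (4 * d))) = exp (- (\<Sum>j\<in>{1..m}. (y j - x j)\<^sup>2) / (4 * d))"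
      by (simp add: exp_sum[symmetric] sum_negf sum_divide_distrib)
    have "r\<^sup>2 \<le> (\<Sum>j\<in>{1..m}. (y j - x j)\<^sup>2)"
    proof (cases "r = 0")
      case False
      then obtain j where j: "j \<in> {1..m}" "r \<le> \<bar>y j - x j\<bar>" using far by auto
      have "r\<^sup>2 \<le> \<bar>y j - x j\<bar>\<^sup>2" using j r by (intro power_mono) auto
      also have "\<dots> \<le> (\<Sum>j\<in>{1..m}. (y j - x j)\<^sup>2)"
        using j member_le_sum[of j "{1..m}" "\<lambda>j. (y j - x j)\<^sup>2"] by simp
      finally show ?thesis .
    qed (simp add: sum_nonneg)
    then show "(\<Prod>j\<in>{1..m}. exp (- (y j - x j)\<^sup>2 / (4 * d))) \<le> exp (- r\<^sup>2 / (4 * d))"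
      unfolding s using d by (simp add: divide_right_mono)
    show "(\<Prod>j\<in>{1..m}. sqrt (2 * pi / 2) * exp (- (y j - x j)\<^sup>2 / (4 * d))) \<le> heat m 2 x y"
      unfolding heat_def
    proof (intro prod_mono conjI mult_left_mono)
      fix j
      have "(y j - x j)\<^sup>2 / 4 \<le> (y j - x j)\<^sup>2 / (4 * d)"
        using d by (intro divide_left_mono) auto
      then show "exp (- (y j - x j)\<^sup>2 / (4 * d)) \<le> exp (- (y j - x j)\<^sup>2 / (2 * 2))" by simp
    qed auto
  qed (use d in \<open>auto intro!: prod_nonneg\<close>)
  finally show ?thesis by (simp add: mult.assoc)
qed

lemma heat_tail_coefficient_tendsto_0:
  assumes r: "0 < r"
  shows "(\<lambda>n. sqrt (2 / (1 / real (Suc n))) ^ m * exp (- r\<^sup>2 / (4 * (1 / real (Suc n))))) \<longlonglongrightarrow> 0"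
proof -
  define c where "c = r\<^sup>2 / 4"
  have c: "0 < c" using r by (simp add: c_def)
  have lim: "filterlim (\<lambda>n. c * real (Suc n)) at_top sequentially"
    using filterlim_real_sequentially[THEN filterlim_compose, OF filterlim_Suc]
    by (intro filterlim_tendsto_pos_mult_at_top[OF tendsto_const c]) (simp add: comp_def)
  have "(\<lambda>n. (2 / c) ^ m * ((c * real (Suc n)) ^ m / exp (c * real (Suc n)))) \<longlonglongrightarrow> (2 / c) ^ m * 0"
    by (intro tendsto_mult tendsto_const filterlim_compose[OF tendsto_power_div_exp_0 lim])
  then have l: "(\<lambda>n. (2 / c) ^ m * ((c * real (Suc n)) ^ m / exp (c * real (Suc n)))) \<longlonglongrightarrow> 0" by simp
  show ?thesis
  proof (rule tendsto_sandwich[OF always_eventually always_eventually tendsto_const l]; intro allI)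
    fix n
    let ?N = "real (Suc n)"
    \<comment> \<open>A crude bound that removes the square root, leaving an integer power against
      the exponential.\<close>
    have "sqrt (2 / (1 / ?N)) \<le> 2 * ?N"
      by (rule real_le_lsqrt) (auto simp: power2_eq_square)
    then have "sqrt (2 / (1 / ?N)) ^ m * exp (- r\<^sup>2 / (4 * (1 / ?N))) \<le> (2 * ?N) ^ m * exp (- r\<^sup>2 / (4 * (1 / ?N)))"
      by (intro mult_right_mono power_mono) auto
    also have "\<dots> = (2 / c) ^ m * ((c * ?N) ^ m / exp (c * ?N))"
    proof -
      have "exp (- r\<^sup>2 / (4 * (1 / ?N))) = 1 / exp (c * ?N)"
      proof -
        have "- r\<^sup>2 / (4 * (1 / ?N)) = - (c * ?N)" by (simp add: c_def)
        then show ?thesis by (simp only: exp_minus inverse_eq_divide)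
      qed
      moreover have "(2 * ?N) ^ m = (2 / c) ^ m * (c * ?N) ^ m"
        using c by (simp add: power_mult_distrib[symmetric])
      ultimately show ?thesis by simp
    qed
    finally show "sqrt (2 / (1 / ?N)) ^ m * exp (- r\<^sup>2 / (4 * (1 / ?N))) \<le> \<dots>" .
  qed simp
qed

text \<open>Near \<open>x\<close> the oscillation of \<open>h\<close> is below
  \<open>\<eta>\<close>; away from \<open>x\<close> the tail bound leaves a vanishing coefficient
  times one fixed integral \<open>K\<close>. Integrability is asked only against the kernel with
  \<open>d = 2\<close>, so that the result covers integrable as well as square integrable
  \<open>h\<close>.\<close>

lemma heat_approximate_identity:
  assumes [measurable]: "h \<in> borel_measurable (Mxi m)"
    and int: "integrable (Mxi m) (\<lambda>y. h y * complex_of_real (heat m 2 x y))"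
    and cont: "continuous_on (space (Mxi m)) h" and x: "x \<in> space (Mxi m)"
  shows "(\<lambda>n. \<integral>y. h y * complex_of_real (heat m (1 / real (Suc n)) x y) \<partial>Mxi m) \<longlonglongrightarrow> complex_of_real ((2 * pi) ^ m) * h x"
proof -
  let ?d = "\<lambda>n. 1 / real (Suc n)"
  have d: "0 < ?d n" "?d n \<le> 1" for n by auto
  have [measurable]: "heat m d x \<in> borel_measurable (Mxi m)" for d using x by measurable
  have hint: "integrable (Mxi m) (\<lambda>y. h y * complex_of_real (heat m (?d n) x y))" for n
  proof (rule Bochner_Integration.integrable_bound[OF integrable_mult_right[where c="complex_of_real (sqrt (2 / ?d n) ^ m)", OF int]])
    show "AE y in Mxi m. cmod (h y * complex_of_real (heat m (?d n) x y))
       \<le> cmod (complex_of_real (sqrt (2 / ?d n) ^ m) * (h y * complex_of_real (heat m 2 x y)))"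
    proof (intro AE_I2)
      fix y
      have "heat m (?d n) x y \<le> sqrt (2 / ?d n) ^ m * heat m 2 x y"
        using heat_tail_bound[OF d, of 0 m y x] by simp
      then have "cmod (h y) * heat m (?d n) x y \<le> cmod (h y) * (sqrt (2 / ?d n) ^ m * heat m 2 x y)"
        by (rule mult_left_mono) simp
      then show "cmod (h y * complex_of_real (heat m (?d n) x y))
         \<le> cmod (complex_of_real (sqrt (2 / ?d n) ^ m) * (h y * complex_of_real (heat m 2 x y)))"
        using d[of n] heat_nonneg[OF d(1)[of n], of m x y] heat_nonneg[of 2 m x y]
        by (simp only: norm_mult norm_of_real) (simp add: mult.left_commute)
    qed
  qed measurable
  have heatint: "integrable (Mxi m) (heat m (?d n) x)" for n by (rule has_integral_heat(1)[OF d(1)])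
  define K where "K = (\<integral>y. cmod (h y - h x) * heat m 2 x y \<partial>Mxi m)"
  have Kint: "integrable (Mxi m) (\<lambda>y. cmod (h y - h x) * heat m 2 x y)"
  proof -
    have "integrable (Mxi m) (\<lambda>y. h y * complex_of_real (heat m 2 x y) - h x * complex_of_real (heat m 2 x y))"
      using int has_integral_heat(1)[of 2 m x] by (intro Bochner_Integration.integrable_diff integrable_mult_right integrable_of_real) auto
    from integrable_norm[OF this] show ?thesis
      by (simp add: left_diff_distrib[symmetric] norm_mult heat_nonneg)
  qed
  show ?thesis
    unfolding tendsto_iff dist_norm
  proof (intro allI impI)
    fix e :: real assume e: "0 < e"
    \<comment> \<open>Half of \<open>e\<close>, divided by the mass of the kernel; the other half of
      \<open>e\<close> is for the tail.\<close>
    define \<eta> where "\<eta> = e / (2 * (2 * pi) ^ m)"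
    have \<eta>: "0 < \<eta>" using e by (simp add: \<eta>_def)
    obtain r where r: "0 < r" "\<And>y. y \<in> space (Mxi m) \<Longrightarrow> (\<forall>j\<in>{1..m}. \<bar>y j - x j\<bar> < r) \<Longrightarrow> cmod (h y - h x) < \<eta>"
      using continuous_on_PiE_box[OF cont _ x \<eta>, of "{1..m}"] by (auto simp: space_Mxi dist_norm)
    define c where "c n = sqrt (2 / ?d n) ^ m * exp (- r\<^sup>2 / (4 * ?d n))" for n
    have c0: "c \<longlonglongrightarrow> 0" unfolding c_def by (rule heat_tail_coefficient_tendsto_0[OF r(1)])
    have "(\<lambda>n. c n * K) \<longlonglongrightarrow> 0 * K" by (intro tendsto_mult c0 tendsto_const)
    then have "eventually (\<lambda>n. c n * K < e / 2) sequentially"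
      using e by (intro order_tendstoD) auto
    then show "eventually (\<lambda>n. cmod ((\<integral>y. h y * complex_of_real (heat m (?d n) x y) \<partial>Mxi m) - complex_of_real ((2 * pi) ^ m) * h x) < e) sequentially"
    proof eventually_elim
      case (elim n)
      have "(\<integral>y. h y * complex_of_real (heat m (?d n) x y) \<partial>Mxi m) - complex_of_real ((2 * pi) ^ m) * h x
        = (\<integral>y. h y * complex_of_real (heat m (?d n) x y) \<partial>Mxi m) - (\<integral>y. h x * complex_of_real (heat m (?d n) x y) \<partial>Mxi m)"
        using has_integral_heat(2)[OF d(1)[of n], of m x]
        by (simp add: integral_mult_right_zero integral_complex_of_real mult.commute)
      also have "\<dots> = (\<integral>y. (h y - h x) * complex_of_real (heat m (?d n) x y) \<partial>Mxi m)"
        using hint[of n] heatint[of n]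
        by (subst Bochner_Integration.integral_diff[symmetric]) (auto simp: left_diff_distrib)
      also have "cmod \<dots> \<le> (\<integral>y. cmod (h y - h x) * heat m (?d n) x y \<partial>Mxi m)"
        by (rule order_trans[OF integral_norm_bound]) (simp add: norm_mult heat_nonneg)
      also have "\<dots> \<le> (\<integral>y. \<eta> * heat m (?d n) x y + c n * (cmod (h y - h x) * heat m 2 x y) \<partial>Mxi m)"
      proof (rule integral_mono_AE)
        show "integrable (Mxi m) (\<lambda>y. cmod (h y - h x) * heat m (?d n) x y)"
        proof -
          have "integrable (Mxi m) (\<lambda>y. h y * complex_of_real (heat m (?d n) x y) - h x * complex_of_real (heat m (?d n) x y))"
            using hint heatint by (intro Bochner_Integration.integrable_diff integrable_mult_right integrable_of_real) auto
          from integrable_norm[OF this] show ?thesis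
            by (simp add: left_diff_distrib[symmetric] norm_mult heat_nonneg)
        qed
        show "integrable (Mxi m) (\<lambda>y. \<eta> * heat m (?d n) x y + c n * (cmod (h y - h x) * heat m 2 x y))"
          using heatint Kint by auto
        show "AE y in Mxi m. cmod (h y - h x) * heat m (?d n) x y \<le> \<eta> * heat m (?d n) x y + c n * (cmod (h y - h x) * heat m 2 x y)"
        proof (intro AE_I2)
          fix y assume y: "y \<in> space (Mxi m)"
          have h0: "0 \<le> heat m (?d n) x y" "0 \<le> heat m 2 x y" "0 \<le> c n"
            using d[of n] by (auto simp: heat_nonneg c_def)
          show "cmod (h y - h x) * heat m (?d n) x y \<le> \<eta> * heat m (?d n) x y + c n * (cmod (h y - h x) * heat m 2 x y)"
          proof (cases "\<forall>j\<in>{1..m}. \<bar>y j - x j\<bar> < r")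
            case True
            then have "cmod (h y - h x) * heat m (?d n) x y \<le> \<eta> * heat m (?d n) x y"
              using r(2)[OF y] h0 by (intro mult_right_mono) auto
            then show ?thesis using h0 by (simp add: add_increasing2)
          next
            case False
            then have "heat m (?d n) x y \<le> c n * heat m 2 x y"
              unfolding c_def using r(1) by (intro heat_tail_bound[OF d]) (auto simp: not_less)
            then have "cmod (h y - h x) * heat m (?d n) x y \<le> cmod (h y - h x) * (c n * heat m 2 x y)"
              by (rule mult_left_mono) simp
            then show ?thesis using h0 \<eta> by (simp add: mult_ac add_increasing)
          qed
        qed
      qed
      also have "\<dots> = \<eta> * (2 * pi) ^ m + c n * K"
        using heatint[of n] Kint has_integral_heat(2)[OF d(1)[of n], of m x]
        by (subst Bochner_Integration.integral_add) (auto simp: K_def)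
      also have "\<dots> < e" using elim by (simp add: \<eta>_def)
      finally show ?case .
    qed
  qed
qed


text \<open>The upper bound \<open>l2_ft_le\<close>, applied with the opposite sign to the
  Gaussian-damped transform, controls approximations \<open>k n\<close> of \<open>h\<close>. They
  converge at every point because \<open>h\<close> is continuous, and Fatou finishes.\<close>

lemma l2_le_l2_ft:
  assumes s: "s\<^sup>2 = 1" and h: "integrable (Mxi m) h" and cont: "continuous_on (space (Mxi m)) h"
  shows "l2 m h \<le> ennreal (1 / (2 * pi) ^ m) * l2 m (ft m s h)"
  unfolding l2_def[of m h]
proof (rule nn_integral_le_of_pointwise_limit)
  have [measurable]: "h \<in> borel_measurable (Mxi m)" using h by auto
  let ?d = "\<lambda>n. 1 / real (Suc n)"
  define B where "B = (\<integral>x. cmod (h x) \<partial>Mxi m)"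
  have B: "cmod (ft m s h \<xi>) \<le> B" for \<xi> using norm_ft_le[OF h] by (simp add: B_def)
  define v where "v n \<xi> = ft m s h \<xi> * complex_of_real (gauss m (?d n) \<xi>)" for n \<xi>
  have [measurable]: "v n \<in> borel_measurable (Mxi m)" for n unfolding v_def by measurable
  have vint: "integrable (Mxi m) (v n)" for n unfolding v_def
    by (rule Bochner_Integration.integrable_bound[OF integrable_mult_right[where c=B, OF integrable_gauss[of "?d n"]]])
       (auto simp: norm_mult gauss_nonneg abs_mult intro!: mult_mono order_trans[OF B])
  \<comment> \<open>The prefactor cancels the mass of \<open>heat\<close>. It enters squared, and
    one of its two powers is used up by the constant of \<open>l2_ft_le\<close>.\<close>
  define k where "k n x = complex_of_real (1 / (2 * pi) ^ m) * ft m (-s) (v n) x" for n x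
  have [measurable]: "k n \<in> borel_measurable (Mxi m)" for n unfolding k_def by measurable
  show "(\<lambda>x. ennreal ((cmod (k n x))\<^sup>2)) \<in> borel_measurable (Mxi m)" for n by measurable
  show "AE x in Mxi m. (\<lambda>n. ennreal ((cmod (k n x))\<^sup>2)) \<longlonglongrightarrow> ennreal ((cmod (h x))\<^sup>2)"
  proof (intro AE_I2 tendsto_ennrealI tendsto_power tendsto_norm)
    fix x assume x: "x \<in> space (Mxi m)"
    have "integrable (Mxi m) (\<lambda>y. h y * complex_of_real (heat m 2 x y))"
      by (rule Bochner_Integration.integrable_bound[OF integrable_mult_right[where c="complex_of_real (sqrt (2 * pi / 2) ^ m)", OF h]])
         (use x heat_le[of 2 m x] heat_nonneg[of 2 m x] in \<open>auto simp: norm_mult norm_power mult.commute intro!: mult_left_mono\<close>)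
    from heat_approximate_identity[OF _ this cont x]
    have "(\<lambda>n. complex_of_real (1 / (2 * pi) ^ m) * (\<integral>y. h y * complex_of_real (heat m (?d n) x y) \<partial>Mxi m))
            \<longlonglongrightarrow> complex_of_real (1 / (2 * pi) ^ m) * (complex_of_real ((2 * pi) ^ m) * h x)"
      by (intro tendsto_mult tendsto_const) simp
    moreover have "(\<integral>y. h y * complex_of_real (heat m (?d n) x y) \<partial>Mxi m) = ft m (-s) (v n) x" for n
      using ft_gauss_smoothing[OF _ s h x, of "?d n"]
      by (simp add: ft_def[of m "-s"] v_def mult_ac vinner_commute)
    ultimately show "(\<lambda>n. k n x) \<longlonglongrightarrow> h x" by (simp add: k_def)
  qed
  show "(\<integral>\<^sup>+x. ennreal ((cmod (k n x))\<^sup>2) \<partial>Mxi m) \<le> ennreal (1 / (2 * pi) ^ m) * l2 m (ft m s h)" for n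
  proof -
    have "(\<integral>\<^sup>+x. ennreal ((cmod (k n x))\<^sup>2) \<partial>Mxi m) = ennreal ((1 / (2 * pi) ^ m)\<^sup>2) * l2 m (ft m (-s) (v n))"
      unfolding l2_def[symmetric] k_def by (subst l2_cmult) (auto simp: norm_divide norm_power norm_mult)
    also have "\<dots> \<le> ennreal ((1 / (2 * pi) ^ m)\<^sup>2) * (ennreal ((2 * pi) ^ m) * l2 m (v n))"
      using s by (intro mult_left_mono l2_ft_le vint) auto
    also have "\<dots> = ennreal (1 / (2 * pi) ^ m) * l2 m (v n)"
    proof -
      have "(1 / (2 * pi) ^ m)\<^sup>2 * (2 * pi) ^ m = 1 / (2 * pi) ^ m"
        by (simp only: power2_eq_square) simp
      then show ?thesis by (simp only: mult.assoc[symmetric] ennreal_mult'[symmetric] zero_le_power2)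
    qed
    also have "\<dots> \<le> ennreal (1 / (2 * pi) ^ m) * l2 m (ft m s h)"
      unfolding v_def by (intro mult_left_mono l2_mono) (auto simp: norm_mult gauss_nonneg intro!: mult_left_le gauss_le_1)
    finally show ?thesis .
  qed
qed

text \<open>Along a subsequence with increments of squared norm at most \<open>4^(-n)\<close> the series of \<open>2^n |d\<^sub>n|\<^sup>2\<close>
  converges almost everywhere, and \<open>|d\<^sub>n| \<le> 2^n |d\<^sub>n|\<^sup>2 + 2^(-n)\<close> makes the increments summable.\<close>

lemma L2_complete:
  fixes u :: "real \<Rightarrow> 'a \<Rightarrow> complex"
  assumes [measurable]: "\<And>R. u R \<in> borel_measurable N"
    and Cauchy: "\<And>e::real. 0 < e \<Longrightarrow> \<exists>R0. \<forall>R\<ge>R0. \<forall>S\<ge>R0. (\<integral>\<^sup>+x. ennreal ((cmod (u R x - u S x))\<^sup>2) \<partial>N) \<le> ennreal e"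
  shows "\<exists>g\<in>borel_measurable N. ((\<lambda>R. \<integral>\<^sup>+x. ennreal ((cmod (u R x - g x))\<^sup>2) \<partial>N) \<longlongrightarrow> 0) at_top"
proof -
  have "\<exists>\<rho>. \<forall>n. \<forall>R\<ge>\<rho> n. \<forall>S\<ge>\<rho> n. (\<integral>\<^sup>+x. ennreal ((cmod (u R x - u S x))\<^sup>2) \<partial>N) \<le> ennreal ((1/4)^n)"
    using Cauchy by (intro choice allI) auto
  then obtain \<rho> :: "nat \<Rightarrow> real" where \<rho>: "\<And>n R S. R \<ge> \<rho> n \<Longrightarrow> S \<ge> \<rho> n \<Longrightarrow>
     (\<integral>\<^sup>+x. ennreal ((cmod (u R x - u S x))\<^sup>2) \<partial>N) \<le> ennreal ((1/4)^n)" by blast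
  \<comment> \<open>A sum of absolute values exceeds each of its terms, so \<open>R j\<close> lies
    beyond all thresholds \<open>\<rho> n\<close> with \<open>n \<le> j\<close>.\<close>
  define R where "R n = (\<Sum>k\<le>n. \<bar>\<rho> k\<bar>)" for n
  have R: "\<rho> n \<le> R j" if "n \<le> j" for n j
    unfolding R_def using that member_le_sum[of n "{..j}" "\<lambda>k. \<bar>\<rho> k\<bar>"] by simp
  define v where "v n = u (R n)" for n
  have [measurable]: "v n \<in> borel_measurable N" for n unfolding v_def by measurable
  define d where "d n x = v (Suc n) x - v n x" for n x
  have [measurable]: "d n \<in> borel_measurable N" for n unfolding d_def by measurable
  have "(\<integral>\<^sup>+x. (\<Sum>n. ennreal (2^n * (cmod (d n x))\<^sup>2)) \<partial>N) = (\<Sum>n. \<integral>\<^sup>+x. ennreal (2^n * (cmod (d n x))\<^sup>2) \<partial>N)"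
    by (rule nn_integral_suminf) measurable
  also have "\<dots> \<le> (\<Sum>n. ennreal ((1/2)^n))"
  proof (intro suminf_le summableI)
    fix n
    have "(\<integral>\<^sup>+x. ennreal (2^n * (cmod (d n x))\<^sup>2) \<partial>N) = ennreal (2^n) * (\<integral>\<^sup>+x. ennreal ((cmod (d n x))\<^sup>2) \<partial>N)"
      by (subst nn_integral_cmult[symmetric]) (auto simp: ennreal_mult')
    also have "\<dots> \<le> ennreal (2^n) * ennreal ((1/4)^n)"
      unfolding d_def v_def by (intro mult_left_mono \<rho> R) auto
    also have "\<dots> = ennreal ((1/2)^n)"
      by (simp add: ennreal_mult'[symmetric] power_mult_distrib[symmetric])
    finally show "(\<integral>\<^sup>+x. ennreal (2^n * (cmod (d n x))\<^sup>2) \<partial>N) \<le> ennreal ((1/2)^n)" .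
  qed
  also have "\<dots> < \<infinity>"
    by (subst suminf_ennreal2) (auto intro: summable_geometric)
  finally have "AE x in N. (\<Sum>n. ennreal (2^n * (cmod (d n x))\<^sup>2)) \<noteq> \<infinity>"
    by (intro nn_integral_PInf_AE) auto
  then have conv: "AE x in N. (\<lambda>n. v n x) \<longlonglongrightarrow> lim (\<lambda>n. v n x)"
  proof eventually_elim
    case (elim x)
    then have 1: "summable (\<lambda>n. 2^n * (cmod (d n x))\<^sup>2)"
      by (intro summable_suminf_not_top) auto
    have 2: "summable (\<lambda>n. 2^n * (cmod (d n x))\<^sup>2 + (1/2)^n)"
      by (intro summable_add 1 summable_geometric) simp
    have "summable (\<lambda>n. norm (d n x))"
    proof (rule summable_comparison_test'[OF 2])
      fix n
      let ?a = "cmod (d n x)"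
      show "norm (norm (d n x)) \<le> 2^n * ?a\<^sup>2 + (1/2)^n"
      proof (cases "?a \<le> (1/2)^n")
        case True then show ?thesis by (simp add: add_increasing)
      next
        case False
        then have "2^n * (?a * (1/2)^n) \<le> 2^n * (?a * ?a)" by (intro mult_left_mono) auto
        moreover have "2^n * (?a * (1/2)^n) = ?a" by (simp add: power_divide)
        ultimately have "?a \<le> 2^n * ?a\<^sup>2" by (simp only: power2_eq_square)
        then show ?thesis by (simp add: add_increasing2)
      qed
    qed
    then have "summable (\<lambda>n. d n x)" by (rule summable_norm_cancel)
    then have "(\<lambda>n. v 0 x + (\<Sum>i<n. d i x)) \<longlonglongrightarrow> v 0 x + suminf (\<lambda>n. d n x)"
      by (intro tendsto_add tendsto_const summable_LIMSEQ)
    moreover have "v 0 x + (\<Sum>i<n. d i x) = v n x" for n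
      unfolding d_def by (subst sum_lessThan_telescope) simp
    ultimately have "(\<lambda>n. v n x) \<longlonglongrightarrow> v 0 x + suminf (\<lambda>n. d n x)" by simp
    then show ?case by (simp add: limI)
  qed
  define g where "g x = lim (\<lambda>n. v n x)" for x
  have [measurable]: "g \<in> borel_measurable N" unfolding g_def by measurable
  \<comment> \<open>The Cauchy estimate survives the limit in its second argument by Fatou. Since
    the first argument is any \<open>S \<ge> \<rho> n\<close>, the whole family converges and not
    only the subsequence.\<close>
  have bound: "(\<integral>\<^sup>+x. ennreal ((cmod (u S x - g x))\<^sup>2) \<partial>N) \<le> ennreal ((1/4)^n)" if S: "S \<ge> \<rho> n" for n S
  proof (rule nn_integral_le_of_pointwise_limit[where u="\<lambda>k x. ennreal ((cmod (u S x - v (k + n) x))\<^sup>2)"])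
    show "AE x in N. (\<lambda>k. ennreal ((cmod (u S x - v (k + n) x))\<^sup>2)) \<longlonglongrightarrow> ennreal ((cmod (u S x - g x))\<^sup>2)"
      using conv
    proof eventually_elim
      case (elim x)
      then show ?case unfolding g_def
        by (intro tendsto_ennrealI tendsto_intros LIMSEQ_ignore_initial_segment)
    qed
    show "(\<integral>\<^sup>+x. ennreal ((cmod (u S x - v (k + n) x))\<^sup>2) \<partial>N) \<le> ennreal ((1/4)^n)" for k
      unfolding v_def by (intro \<rho> S R) simp
  qed measurable
  have "((\<lambda>S. \<integral>\<^sup>+x. ennreal ((cmod (u S x - g x))\<^sup>2) \<partial>N) \<longlongrightarrow> 0) at_top"
  proof (rule order_tendstoI)
    fix a :: ennreal assume a: "0 < a"
    have "(\<lambda>n. (1/4::real)^n) \<longlonglongrightarrow> 0" by (intro LIMSEQ_power_zero) simp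
    then have "(\<lambda>n. ennreal ((1/4)^n)) \<longlonglongrightarrow> ennreal 0" by (intro tendsto_ennrealI)
    then have "(\<lambda>n. ennreal ((1/4)^n)) \<longlonglongrightarrow> 0" by simp
    from order_tendstoD(2)[OF this a] obtain n where n: "ennreal ((1/4)^n) < a"
      by (auto simp: eventually_sequentially)
    show "eventually (\<lambda>S. (\<integral>\<^sup>+x. ennreal ((cmod (u S x - g x))\<^sup>2) \<partial>N) < a) at_top"
      unfolding eventually_at_top_linorder
      by (intro exI[of _ "\<rho> n"] allI impI) (rule le_less_trans[OF bound n])
  qed simp
  then show ?thesis by (intro bexI[of _ g]) auto
qed

section \<open>The transform as a limit over balls\<close>

definition trunc :: "nat \<Rightarrow> real \<Rightarrow> ((nat \<Rightarrow> real) \<Rightarrow> complex) \<Rightarrow> (nat \<Rightarrow> real) \<Rightarrow> complex" where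
  "trunc m R h x = indicator {y. vnorm m y \<le> R} x *\<^sub>R h x"

text \<open>The scalar counterpart of \<open>is_L2_fourier\<close>, for one coefficient at a
  time.\<close>

definition is_ft :: "nat \<Rightarrow> ((nat \<Rightarrow> real) \<Rightarrow> complex) \<Rightarrow> ((nat \<Rightarrow> real) \<Rightarrow> complex) \<Rightarrow> bool" where
  "is_ft m h g \<longleftrightarrow> h \<in> borel_measurable (Mxi m) \<and> g \<in> borel_measurable (Mxi m) \<and> l2 m h < \<infinity> \<and> l2 m g < \<infinity> \<and>
     ((\<lambda>R. l2 m (\<lambda>\<xi>. ft m (-1) (trunc m R h) \<xi> - g \<xi>)) \<longlongrightarrow> 0) at_top"

lemma measurable_indicator_vnorm [measurable]:
  "(\<lambda>x. indicator {y. vnorm m y \<le> R} x :: real) \<in> borel_measurable (Mxi m)"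
proof -
  have "(\<lambda>x. if vnorm m x \<le> R then 1 else 0 :: real) \<in> borel_measurable (Mxi m)" by measurable
  then show ?thesis by (simp add: indicator_def)
qed

lemma measurable_trunc [measurable]:
  "h \<in> borel_measurable (Mxi m) \<Longrightarrow> trunc m R h \<in> borel_measurable (Mxi m)"
  unfolding trunc_def by measurable

text \<open>On the ball \<open>exp (R\<^sup>2 / 2) * gauss m 1 x\<close> is at least 1, so
  \<open>h\<close> times a Gaussian, integrable by Cauchy-Schwarz, is a majorant. The Gaussian takes
  the place of the volume of the ball.\<close>

lemma integrable_trunc:
  assumes [measurable]: "h \<in> borel_measurable (Mxi m)" and "l2 m h < \<infinity>"
  shows "integrable (Mxi m) (trunc m R h)"
proof -
  let ?g = "\<lambda>x. complex_of_real (gauss m 1 x)"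
  have "integrable (Mxi m) (\<lambda>x. h x * ?g x)"
    by (rule integrable_mult_l2[OF _ _ assms(2) l2_gauss]) auto
  then have "integrable (Mxi m) (\<lambda>x. complex_of_real (exp (R\<^sup>2 / 2)) * (h x * ?g x))"
    by (rule integrable_mult_right)
  then show ?thesis
  proof (rule Bochner_Integration.integrable_bound)
    show "AE x in Mxi m. cmod (trunc m R h x) \<le> cmod (complex_of_real (exp (R\<^sup>2 / 2)) * (h x * ?g x))"
    proof (intro AE_I2)
      fix x
      show "cmod (trunc m R h x) \<le> cmod (complex_of_real (exp (R\<^sup>2 / 2)) * (h x * ?g x))"
      proof (cases "vnorm m x \<le> R")
        case True
        have "0 \<le> vnorm m x" by (simp add: vnorm_def sum_nonneg)
        then have "(vnorm m x)\<^sup>2 \<le> R\<^sup>2" using True by (intro power_mono) auto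
        then have "1 \<le> exp (R\<^sup>2 / 2) * gauss m 1 x"
          by (simp add: gauss_eq_exp_vnorm exp_add[symmetric])
        from mult_left_mono[OF this, of "cmod (h x)"] True show ?thesis
          by (simp add: trunc_def norm_mult gauss_nonneg mult_ac)
      qed (simp add: trunc_def)
    qed
  qed measurable
qed

lemma l2_multiplier_tendsto:
  assumes [measurable]: "h \<in> borel_measurable (Mxi m)" "\<And>n. w n \<in> borel_measurable (Mxi m)"
    and h: "l2 m h < \<infinity>" and le: "\<And>n x. \<bar>w n x\<bar> \<le> (1::real)"
    and lim: "\<And>x. x \<in> space (Mxi m) \<Longrightarrow> (\<lambda>n. w n x) \<longlonglongrightarrow> 1"
  shows "(\<lambda>n. l2 m (\<lambda>x. w n x *\<^sub>R h x - h x)) \<longlonglongrightarrow> 0"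
proof -
  have "(\<lambda>n. \<integral>\<^sup>+x. ennreal ((cmod (w n x *\<^sub>R h x - h x))\<^sup>2) \<partial>Mxi m) \<longlonglongrightarrow> (\<integral>\<^sup>+x. 0 \<partial>Mxi m)"
  proof (rule nn_integral_dominated_convergence[where w="\<lambda>x. 4 * ennreal ((cmod (h x))\<^sup>2)"])
    show "AE x in Mxi m. ennreal ((cmod (w n x *\<^sub>R h x - h x))\<^sup>2) \<le> 4 * ennreal ((cmod (h x))\<^sup>2)" for n
    proof (intro AE_I2)
      fix x
      have "cmod (w n x *\<^sub>R h x - h x) = \<bar>w n x - 1\<bar> * cmod (h x)"
        using norm_scaleR[of "w n x - 1" "h x"] by (simp add: scaleR_left_diff_distrib)
      also have "\<dots> \<le> 2 * cmod (h x)" using le[of n x] by (intro mult_right_mono) auto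
      finally have "(cmod (w n x *\<^sub>R h x - h x))\<^sup>2 \<le> (2 * cmod (h x))\<^sup>2" by (rule power_mono) simp
      then have "ennreal ((cmod (w n x *\<^sub>R h x - h x))\<^sup>2) \<le> ennreal (4 * (cmod (h x))\<^sup>2)"
        by (intro ennreal_leI) (simp add: power_mult_distrib)
      then show "ennreal ((cmod (w n x *\<^sub>R h x - h x))\<^sup>2) \<le> 4 * ennreal ((cmod (h x))\<^sup>2)"
        by (simp add: ennreal_mult')
    qed
    show "(\<integral>\<^sup>+x. 4 * ennreal ((cmod (h x))\<^sup>2) \<partial>Mxi m) < \<infinity>"
      using h by (simp add: nn_integral_cmult l2_def ennreal_mult_less_top)
    show "AE x in Mxi m. (\<lambda>n. ennreal ((cmod (w n x *\<^sub>R h x - h x))\<^sup>2)) \<longlonglongrightarrow> 0"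
    proof (intro AE_I2)
      fix x assume x: "x \<in> space (Mxi m)"
      have "(\<lambda>n. ennreal ((cmod (w n x *\<^sub>R h x - h x))\<^sup>2)) \<longlonglongrightarrow> ennreal ((cmod (1 *\<^sub>R h x - h x))\<^sup>2)"
        by (intro tendsto_ennrealI tendsto_intros lim x)
      then show "(\<lambda>n. ennreal ((cmod (w n x *\<^sub>R h x - h x))\<^sup>2)) \<longlonglongrightarrow> 0" by simp
    qed
  qed measurable
  then show ?thesis by (simp add: l2_def)
qed

lemma l2_trunc_tendsto:
  assumes [measurable]: "h \<in> borel_measurable (Mxi m)" and h: "l2 m h < \<infinity>"
  shows "((\<lambda>R. l2 m (\<lambda>x. trunc m R h x - h x)) \<longlongrightarrow> 0) at_top"
proof (rule tendsto_at_topI_sequentially)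
  fix X :: "nat \<Rightarrow> real" assume X: "filterlim X at_top sequentially"
  show "(\<lambda>n. l2 m (\<lambda>x. trunc m (X n) h x - h x)) \<longlonglongrightarrow> 0"
    unfolding trunc_def
  proof (rule l2_multiplier_tendsto[OF _ _ h])
    fix x
    have "eventually (\<lambda>n. vnorm m x \<le> X n) sequentially"
      using X by (simp add: filterlim_at_top)
    then have "eventually (\<lambda>n. indicator {y. vnorm m y \<le> X n} x = (1::real)) sequentially"
      by eventually_elim simp
    then show "(\<lambda>n. indicator {y. vnorm m y \<le> X n} x :: real) \<longlonglongrightarrow> 1"
      by (rule tendsto_eventually)
  qed (auto simp: indicator_def)
qed

lemma ft_diff:
  assumes "\<xi> \<in> space (Mxi m)" "integrable (Mxi m) u" "integrable (Mxi m) v"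
  shows "ft m s (\<lambda>x. u x - v x) \<xi> = ft m s u \<xi> - ft m s v \<xi>"
  unfolding ft_def right_diff_distrib using assms
  by (intro Bochner_Integration.integral_diff integrable_cis_mult) auto

lemma l2_ft_diff_le:
  assumes "s\<^sup>2 = 1" "integrable (Mxi m) u" "integrable (Mxi m) v"
  shows "l2 m (\<lambda>\<xi>. ft m s u \<xi> - ft m s v \<xi>) \<le> ennreal ((2 * pi) ^ m) * l2 m (\<lambda>x. u x - v x)"
proof -
  have "l2 m (\<lambda>\<xi>. ft m s u \<xi> - ft m s v \<xi>) = l2 m (ft m s (\<lambda>x. u x - v x))"
    by (intro l2_cong) (simp add: ft_diff assms)
  also have "\<dots> \<le> ennreal ((2 * pi) ^ m) * l2 m (\<lambda>x. u x - v x)"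
    using assms by (intro l2_ft_le) auto
  finally show ?thesis .
qed

text \<open>Truncations converge to \<open>h\<close> in norm; the Bessel inequality makes their
  transforms Cauchy, and completeness supplies the limit.\<close>

lemma is_ft_exists:
  assumes [measurable]: "h \<in> borel_measurable (Mxi m)" and h: "l2 m h < \<infinity>"
  shows "\<exists>g. is_ft m h g"
proof -
  let ?C = "ennreal ((2 * pi) ^ m)"
  let ?t = "\<lambda>R. l2 m (\<lambda>x. trunc m R h x - h x)"
  have le: "l2 m (\<lambda>\<xi>. ft m (-1) (trunc m R h) \<xi> - ft m (-1) (trunc m S h) \<xi>) \<le> ?C * (2 * ?t R + 2 * ?t S)" for R S
  proof -
    have "l2 m (\<lambda>\<xi>. ft m (-1) (trunc m R h) \<xi> - ft m (-1) (trunc m S h) \<xi>) \<le> ?C * l2 m (\<lambda>x. trunc m R h x - trunc m S h x)"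
      by (rule l2_ft_diff_le) (auto intro!: integrable_trunc h)
    also have "\<dots> \<le> ?C * (2 * ?t R + 2 * ?t S)"
    proof (rule mult_left_mono)
      have "l2 m (\<lambda>x. trunc m R h x - trunc m S h x) \<le> 2 * ?t R + 2 * l2 m (\<lambda>x. h x - trunc m S h x)"
        by (rule l2_triangle) measurable
      then show "l2 m (\<lambda>x. trunc m R h x - trunc m S h x) \<le> 2 * ?t R + 2 * ?t S"
        by (simp add: l2_def norm_minus_commute)
    qed simp
    finally show ?thesis .
  qed
  have t0: "(?t \<longlongrightarrow> 0) at_top" by (rule l2_trunc_tendsto) (use h in auto)
  have "\<exists>g\<in>borel_measurable (Mxi m). ((\<lambda>R. \<integral>\<^sup>+x. ennreal ((cmod (ft m (-1) (trunc m R h) x - g x))\<^sup>2) \<partial>Mxi m) \<longlongrightarrow> 0) at_top"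
  proof (rule L2_complete)
    fix e :: real assume e: "0 < e"
    \<comment> \<open>Chosen so that the factor \<open>(2 * pi) ^ m\<close> of the transform and the
      factors 2 of the triangle inequality combine to exactly \<open>e\<close>.\<close>
    define c where "c = e / (4 * (2 * pi) ^ m)"
    have c: "0 < c" using e by (simp add: c_def)
    from order_tendstoD(2)[OF t0, of "ennreal c"] c
    obtain R0 where R0: "\<And>R. R \<ge> R0 \<Longrightarrow> ?t R < ennreal c" by (auto simp: eventually_at_top_linorder)
    show "\<exists>R0. \<forall>R\<ge>R0. \<forall>S\<ge>R0. (\<integral>\<^sup>+x. ennreal ((cmod (ft m (-1) (trunc m R h) x - ft m (-1) (trunc m S h) x))\<^sup>2) \<partial>Mxi m) \<le> ennreal e"
    proof (intro exI[of _ R0] allI impI)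
      fix R S assume RS: "R0 \<le> R" "R0 \<le> S"
      have "l2 m (\<lambda>\<xi>. ft m (-1) (trunc m R h) \<xi> - ft m (-1) (trunc m S h) \<xi>) \<le> ?C * (2 * ?t R + 2 * ?t S)" by (rule le)
      also have "\<dots> \<le> ?C * (2 * ennreal c + 2 * ennreal c)"
        using R0[OF RS(1)] R0[OF RS(2)] by (intro mult_left_mono add_mono) auto
      also have "2 * ennreal c + 2 * ennreal c = ennreal (4 * c)"
        using c by (simp add: ennreal_mult' distrib_right[symmetric])
      also have "?C * ennreal (4 * c) = ennreal e"
        using c by (simp add: ennreal_mult'[symmetric] c_def)
      finally show "(\<integral>\<^sup>+x. ennreal ((cmod (ft m (-1) (trunc m R h) x - ft m (-1) (trunc m S h) x))\<^sup>2) \<partial>Mxi m) \<le> ennreal e"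
        by (simp add: l2_def)
    qed
  qed measurable
  then obtain g where [measurable]: "g \<in> borel_measurable (Mxi m)"
    and g: "((\<lambda>R. l2 m (\<lambda>\<xi>. ft m (-1) (trunc m R h) \<xi> - g \<xi>)) \<longlongrightarrow> 0) at_top"
    unfolding l2_def by blast
  have "eventually (\<lambda>R. l2 m (\<lambda>\<xi>. ft m (-1) (trunc m R h) \<xi> - g \<xi>) < 1) at_top"
    by (rule order_tendstoD(2)[OF g]) simp
  then obtain R where R: "l2 m (\<lambda>\<xi>. ft m (-1) (trunc m R h) \<xi> - g \<xi>) < 1"
    by (auto simp: eventually_at_top_linorder)
  have "l2 m g = l2 m (\<lambda>\<xi>. ft m (-1) (trunc m R h) \<xi> - (ft m (-1) (trunc m R h) \<xi> - g \<xi>))" by simp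
  also have "\<dots> \<le> 2 * l2 m (ft m (-1) (trunc m R h)) + 2 * l2 m (\<lambda>\<xi>. ft m (-1) (trunc m R h) \<xi> - g \<xi>)"
    by (rule l2_diff_le) measurable
  also have "\<dots> \<le> 2 * (?C * l2 m h) + 2 * 1"
  proof (intro add_mono mult_left_mono)
    have "l2 m (ft m (-1) (trunc m R h)) \<le> ?C * l2 m (trunc m R h)"
      by (rule l2_ft_le) (auto intro!: integrable_trunc h)
    also have "\<dots> \<le> ?C * l2 m h"
      by (intro mult_left_mono l2_mono) (auto simp: trunc_def indicator_def)
    finally show "l2 m (ft m (-1) (trunc m R h)) \<le> ?C * l2 m h" .
  qed (use R in auto)
  also have "\<dots> < \<infinity>" using h by (auto simp: ennreal_mult_less_top)
  finally have "l2 m g < \<infinity>" .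
  then show ?thesis using g h by (intro exI[of _ g]) (simp add: is_ft_def)
qed

text \<open>The limit does not depend on the way of truncating. This links the balls in the
  definition of the transform to the smoother cutoffs for which the differential equation is
  derived.\<close>

lemma is_ft_multiplier_tendsto:
  assumes ft: "is_ft m h g" and [measurable]: "\<And>n. w n \<in> borel_measurable (Mxi m)"
    and le: "\<And>n x. \<bar>w n x\<bar> \<le> (1::real)"
    and lim: "\<And>x. x \<in> space (Mxi m) \<Longrightarrow> (\<lambda>n. w n x) \<longlonglongrightarrow> 1"
    and int: "\<And>n. integrable (Mxi m) (\<lambda>x. w n x *\<^sub>R h x)"
  shows "(\<lambda>n. l2 m (\<lambda>\<xi>. ft m (-1) (\<lambda>x. w n x *\<^sub>R h x) \<xi> - g \<xi>)) \<longlonglongrightarrow> 0"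
proof -
  have [measurable]: "h \<in> borel_measurable (Mxi m)" "g \<in> borel_measurable (Mxi m)" and h: "l2 m h < \<infinity>"
    and lg: "((\<lambda>R. l2 m (\<lambda>\<xi>. ft m (-1) (trunc m R h) \<xi> - g \<xi>)) \<longlongrightarrow> 0) at_top"
    using ft by (auto simp: is_ft_def)
  let ?C = "ennreal ((2 * pi) ^ m)"
  let ?t = "\<lambda>n. l2 m (\<lambda>x. trunc m (real n) h x - h x)"
  let ?w = "\<lambda>n. l2 m (\<lambda>x. w n x *\<^sub>R h x - h x)"
  let ?g = "\<lambda>n. l2 m (\<lambda>\<xi>. ft m (-1) (trunc m (real n) h) \<xi> - g \<xi>)"
  have L: "l2 m (\<lambda>\<xi>. ft m (-1) (\<lambda>x. w n x *\<^sub>R h x) \<xi> - g \<xi>) \<le> 2 * (?C * (2 * ?w n + 2 * ?t n)) + 2 * ?g n" for n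
  proof -
    have "l2 m (\<lambda>\<xi>. ft m (-1) (\<lambda>x. w n x *\<^sub>R h x) \<xi> - g \<xi>)
       \<le> 2 * l2 m (\<lambda>\<xi>. ft m (-1) (\<lambda>x. w n x *\<^sub>R h x) \<xi> - ft m (-1) (trunc m (real n) h) \<xi>) + 2 * ?g n"
      by (rule l2_triangle) measurable
    also have "l2 m (\<lambda>\<xi>. ft m (-1) (\<lambda>x. w n x *\<^sub>R h x) \<xi> - ft m (-1) (trunc m (real n) h) \<xi>)
       \<le> ?C * l2 m (\<lambda>x. w n x *\<^sub>R h x - trunc m (real n) h x)"
      by (rule l2_ft_diff_le) (auto intro!: integrable_trunc h int)
    also have "l2 m (\<lambda>x. w n x *\<^sub>R h x - trunc m (real n) h x) \<le> 2 * ?w n + 2 * l2 m (\<lambda>x. h x - trunc m (real n) h x)"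
      by (rule l2_triangle) measurable
    also have "l2 m (\<lambda>x. h x - trunc m (real n) h x) = ?t n"
      by (simp add: l2_def norm_minus_commute)
    finally show ?thesis by (simp add: add_mono mult_left_mono)
  qed
  have "(\<lambda>n. 2 * (?C * (2 * ?w n + 2 * ?t n)) + 2 * ?g n) \<longlonglongrightarrow> 2 * (?C * (2 * 0 + 2 * 0)) + 2 * 0"
    by (intro tendsto_add tendsto_mult_ennreal tendsto_const l2_multiplier_tendsto le lim h
          filterlim_compose[OF l2_trunc_tendsto filterlim_real_sequentially]
          filterlim_compose[OF lg filterlim_real_sequentially]) auto
  then show ?thesis by (intro tendsto_0_ennreal_le[OF L]) simp
qed

lemma l2_is_ft_le:
  assumes "is_ft m h g" shows "l2 m g \<le> ennreal (2 * (2 * pi) ^ m) * l2 m h"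
proof -
  have [measurable]: "h \<in> borel_measurable (Mxi m)" "g \<in> borel_measurable (Mxi m)" and h: "l2 m h < \<infinity>"
    and lg: "((\<lambda>R. l2 m (\<lambda>\<xi>. ft m (-1) (trunc m R h) \<xi> - g \<xi>)) \<longlongrightarrow> 0) at_top"
    using assms by (auto simp: is_ft_def)
  have "l2 m g \<le> ennreal (2 * (2 * pi) ^ m) * l2 m h + 2 * l2 m (\<lambda>\<xi>. ft m (-1) (trunc m R h) \<xi> - g \<xi>)" for R
  proof -
    have "l2 m g = l2 m (\<lambda>\<xi>. ft m (-1) (trunc m R h) \<xi> - (ft m (-1) (trunc m R h) \<xi> - g \<xi>))" by simp
    also have "\<dots> \<le> 2 * l2 m (ft m (-1) (trunc m R h)) + 2 * l2 m (\<lambda>\<xi>. ft m (-1) (trunc m R h) \<xi> - g \<xi>)"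
      by (rule l2_diff_le) measurable
    also have "l2 m (ft m (-1) (trunc m R h)) \<le> ennreal ((2 * pi) ^ m) * l2 m (trunc m R h)"
      by (rule l2_ft_le) (auto intro!: integrable_trunc h)
    also have "l2 m (trunc m R h) \<le> l2 m h"
      by (intro l2_mono) (auto simp: trunc_def indicator_def)
    finally show ?thesis by (simp add: ennreal_mult' mult.assoc mult_left_mono)
  qed
  moreover have "((\<lambda>R. ennreal (2 * (2 * pi) ^ m) * l2 m h + 2 * l2 m (\<lambda>\<xi>. ft m (-1) (trunc m R h) \<xi> - g \<xi>)) \<longlongrightarrow>
     ennreal (2 * (2 * pi) ^ m) * l2 m h + 2 * 0) at_top"
    by (intro tendsto_add tendsto_const tendsto_mult_ennreal lg) auto
  ultimately show ?thesis
    by (intro tendsto_lowerbound[where F=at_top]) (auto intro!: always_eventually)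
qed

text \<open>For each \<open>d\<close> the Gaussian average of \<open>h\<close> equals the damped
  integral of \<open>g\<close>. As \<open>d\<close> tends to 0 the former converges to a multiple of
  \<open>h x\<close> by continuity, the latter to the plain integral by integrability of
  \<open>g\<close>, so equality holds at every point.\<close>

lemma fourier_inversion:
  assumes ft: "is_ft m h g" and g: "integrable (Mxi m) g"
    and cont: "continuous_on (space (Mxi m)) h" and x: "x \<in> space (Mxi m)"
  shows "h x = complex_of_real (1 / (2 * pi) ^ m) * (\<integral>\<xi>. cis (vinner m x \<xi>) * g \<xi> \<partial>Mxi m)"
proof -
  have [measurable]: "h \<in> borel_measurable (Mxi m)" "g \<in> borel_measurable (Mxi m)" and h: "l2 m h < \<infinity>" and g2: "l2 m g < \<infinity>"
    and lg: "((\<lambda>R. l2 m (\<lambda>\<xi>. ft m (-1) (trunc m R h) \<xi> - g \<xi>)) \<longlongrightarrow> 0) at_top"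
    using ft by (auto simp: is_ft_def)
  have [measurable]: "heat m d x \<in> borel_measurable (Mxi m)" for d using x by measurable
  let ?c = "\<lambda>\<xi>. cis (vinner m x \<xi>)"
  have [measurable]: "?c \<in> borel_measurable (Mxi m)" using x by measurable
  have eq: "(\<integral>y. h y * complex_of_real (heat m d x y) \<partial>Mxi m) = (\<integral>\<xi>. g \<xi> * (?c \<xi> * complex_of_real (gauss m d \<xi>)) \<partial>Mxi m)"
    if d: "0 < d" for d
  proof (rule LIMSEQ_unique)
    \<comment> \<open>One sequence has two limits: weak convergence of the transforms gives the
      right side, and smoothing followed by dominated convergence of the truncations gives the left
      side.\<close>
    let ?v = "\<lambda>\<xi>. ?c \<xi> * complex_of_real (gauss m d \<xi>)"
    have v2: "l2 m ?v < top" unfolding l2_cis_mult using l2_gauss[OF d] by simp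
    have ft2: "l2 m (ft m (-1) (trunc m (real n) h)) < \<infinity>" for n
    proof -
      have "l2 m (ft m (-1) (trunc m (real n) h)) \<le> ennreal ((2 * pi) ^ m) * l2 m (trunc m (real n) h)"
        by (rule l2_ft_le) (auto intro!: integrable_trunc h)
      also have "l2 m (trunc m (real n) h) \<le> l2 m h"
        by (intro l2_mono) (auto simp: trunc_def indicator_def)
      also have "ennreal ((2 * pi) ^ m) * l2 m h < \<infinity>" using h by (auto simp: ennreal_mult_less_top)
      finally show ?thesis by (simp add: mult_left_mono)
    qed
    show "(\<lambda>n. \<integral>\<xi>. ft m (-1) (trunc m (real n) h) \<xi> * ?v \<xi> \<partial>Mxi m) \<longlonglongrightarrow> (\<integral>\<xi>. g \<xi> * ?v \<xi> \<partial>Mxi m)"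
      by (rule l2_pairing_tendsto)
         (auto intro!: filterlim_compose[OF lg filterlim_real_sequentially] integrable_mult_l2 ft2[simplified] g2[simplified] v2)
    have hh: "integrable (Mxi m) (\<lambda>y. h y * complex_of_real (heat m d x y))"
      by (rule integrable_mult_l2[OF _ _ h l2_heat[OF d]]) auto
    have "(\<lambda>n. \<integral>y. trunc m (real n) h y * complex_of_real (heat m d x y) \<partial>Mxi m) \<longlonglongrightarrow> (\<integral>y. h y * complex_of_real (heat m d x y) \<partial>Mxi m)"
    proof (rule integral_dominated_convergence[where w="\<lambda>y. cmod (h y * complex_of_real (heat m d x y))"])
      show "AE y in Mxi m. (\<lambda>n. trunc m (real n) h y * complex_of_real (heat m d x y)) \<longlonglongrightarrow> h y * complex_of_real (heat m d x y)"
      proof (intro AE_I2 tendsto_mult tendsto_const tendsto_eventually)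
        fix y
        have "eventually (\<lambda>n. vnorm m y \<le> real n) sequentially"
          using filterlim_real_sequentially by (simp add: filterlim_at_top)
        then show "eventually (\<lambda>n. trunc m (real n) h y = h y) sequentially"
          by eventually_elim (simp add: trunc_def)
      qed
      show "AE y in Mxi m. cmod (trunc m (real n) h y * complex_of_real (heat m d x y)) \<le> cmod (h y * complex_of_real (heat m d x y))" for n
        by (auto simp: trunc_def indicator_def)
    qed (use hh in auto)
    then show "(\<lambda>n. \<integral>\<xi>. ft m (-1) (trunc m (real n) h) \<xi> * ?v \<xi> \<partial>Mxi m) \<longlonglongrightarrow> (\<integral>y. h y * complex_of_real (heat m d x y) \<partial>Mxi m)"
      using ft_gauss_smoothing[OF d _ integrable_trunc[OF _ h] x, of "-1"] by simp
  qed
  let ?d = "\<lambda>n. 1 / real (Suc n)"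
  have "(\<lambda>n. \<integral>y. h y * complex_of_real (heat m (?d n) x y) \<partial>Mxi m) \<longlonglongrightarrow> complex_of_real ((2 * pi) ^ m) * h x"
    by (rule heat_approximate_identity[OF _ _ cont x]) (auto intro!: integrable_mult_l2 h l2_heat)
  moreover have "(\<lambda>n. \<integral>\<xi>. g \<xi> * (?c \<xi> * complex_of_real (gauss m (?d n) \<xi>)) \<partial>Mxi m) \<longlonglongrightarrow> (\<integral>\<xi>. g \<xi> * (?c \<xi> * complex_of_real 1) \<partial>Mxi m)"
  proof (rule integral_dominated_convergence[where w="\<lambda>\<xi>. cmod (g \<xi>)"])
    show "AE \<xi> in Mxi m. (\<lambda>n. g \<xi> * (?c \<xi> * complex_of_real (gauss m (?d n) \<xi>))) \<longlonglongrightarrow> g \<xi> * (?c \<xi> * complex_of_real 1)"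
      by (intro AE_I2 tendsto_mult tendsto_const tendsto_of_real gauss_tendsto_1)
    show "AE \<xi> in Mxi m. cmod (g \<xi> * (?c \<xi> * complex_of_real (gauss m (?d n) \<xi>))) \<le> cmod (g \<xi>)" for n
      by (auto simp: norm_mult gauss_nonneg intro!: mult_left_le gauss_le_1)
  qed (use g in auto)
  moreover have "(\<integral>y. h y * complex_of_real (heat m (?d n) x y) \<partial>Mxi m) = (\<integral>\<xi>. g \<xi> * (?c \<xi> * complex_of_real (gauss m (?d n) \<xi>)) \<partial>Mxi m)" for n
    by (rule eq) simp
  ultimately have "complex_of_real ((2 * pi) ^ m) * h x = (\<integral>\<xi>. g \<xi> * (?c \<xi> * complex_of_real 1) \<partial>Mxi m)"
    by (simp only: LIMSEQ_unique)
  then show ?thesis by (simp add: mult.commute field_simps)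
qed

section \<open>Left multiplication in the Clifford algebra\<close>

text \<open>The index of \<open>e_k e_T\<close> up to sign, that is, the symmetric difference with
  \<open>{k}\<close>.\<close>

definition toggle :: "nat \<Rightarrow> nat set \<Rightarrow> nat set" where
  "toggle k T = (if k \<in> T then T - {k} else insert k T)"

text \<open>\<open>e_mult\<close>, \<open>vec_mult\<close> and \<open>chi_mult\<close> are left multiplication by \<open>e\<^sub>k\<close>, by the vector \<open>\<xi>\<close>
  and by \<open>\<chi>\<^sub>\<sigma>(\<xi>)\<close>; the sign of \<open>e\<^sub>k e\<^sub>B\<close> is the parity of the number of elements of \<open>B\<close> up to \<open>k\<close>.\<close>

definition e_mult :: "nat \<Rightarrow> cliff \<Rightarrow> cliff" where
  "e_mult k v T = (-1) ^ card (toggle k T \<inter> {..k}) * v (toggle k T)"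

definition vec_mult :: "nat \<Rightarrow> (nat \<Rightarrow> real) \<Rightarrow> cliff \<Rightarrow> cliff" where
  "vec_mult m \<xi> v T = (\<Sum>k\<in>{1..m}. complex_of_real (\<xi> k) * e_mult k v T)"

definition chi_mult :: "nat \<Rightarrow> real \<Rightarrow> (nat \<Rightarrow> real) \<Rightarrow> cliff \<Rightarrow> cliff" where
  "chi_mult m \<sigma> \<xi> v T = v T / 2 + \<i> * complex_of_real (\<sigma> / (2 * vnorm m \<xi>)) * vec_mult m \<xi> v T"

lemma toggle_in_Pow [simp]: "k \<in> {1..m} \<Longrightarrow> toggle k T \<in> Pow {1..m} \<longleftrightarrow> T \<in> Pow {1..m}"
  by (auto simp: toggle_def split: if_splits)

lemma toggle_toggle [simp]: "toggle k (toggle k T) = T"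
  by (auto simp: toggle_def)

lemma toggle_commute: "toggle k (toggle j T) = toggle j (toggle k T)"
  by (auto simp: toggle_def)

text \<open>Toggling \<open>j\<close> changes the number of elements up to \<open>k\<close> by one
  exactly when \<open>j \<le> k\<close>. For \<open>j \<noteq> k\<close> just one of
  \<open>j \<le> k\<close> and \<open>k \<le> j\<close> holds, which is where anticommutation comes
  from.\<close>

lemma sign_toggle:
  assumes "finite T"
  shows "(-1 :: complex) ^ card (toggle j T \<inter> {..k}) = (if j \<le> k then - ((-1) ^ card (T \<inter> {..k})) else (-1) ^ card (T \<inter> {..k}))"
proof (cases "j \<in> T")
  case True
  show ?thesis
  proof (cases "j \<le> k")
    case jk: True
    have "card (T \<inter> {..k}) = Suc (card ((T \<inter> {..k}) - {j}))"
      using True jk assms by (subst card_Suc_Diff1) auto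
    moreover have "toggle j T \<inter> {..k} = (T \<inter> {..k}) - {j}" using True by (auto simp: toggle_def)
    ultimately show ?thesis using jk by simp
  next
    case False
    then have "toggle j T \<inter> {..k} = T \<inter> {..k}" using True by (auto simp: toggle_def)
    then show ?thesis using False by simp
  qed
next
  case nT: False
  show ?thesis
  proof (cases "j \<le> k")
    case True
    then have "toggle j T \<inter> {..k} = insert j (T \<inter> {..k})" using nT by (auto simp: toggle_def)
    then show ?thesis using True nT assms by simp
  next
    case False
    then have "toggle j T \<inter> {..k} = T \<inter> {..k}" using nT by (auto simp: toggle_def)
    then show ?thesis using False by simp
  qed
qed

text \<open>The two counts in \<open>cl_sign\<close> merge: elements below \<open>k\<close> are
  transpositions, and \<open>k\<close> itself, if present, contributes the sign of its
  square.\<close>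

lemma cl_sign_singleton:
  assumes "finite B" shows "cl_sign {k} B = (-1) ^ card (B \<inter> {..k})"
proof -
  have "{(p, q). p \<in> {k} \<and> q \<in> B \<and> q < p} = Pair k ` (B \<inter> {..<k})" by auto
  then have "card {(p, q). p \<in> {k} \<and> q \<in> B \<and> q < p} = card (B \<inter> {..<k})"
    by (simp add: card_image inj_on_def)
  moreover have "card (B \<inter> {..k}) = card (B \<inter> {..<k}) + card ({k} \<inter> B)"
  proof -
    have "B \<inter> {..k} = (B \<inter> {..<k}) \<union> ({k} \<inter> B)" by auto
    then show ?thesis using assms by (simp only:) (rule card_Un_disjoint; auto)
  qed
  ultimately show ?thesis by (simp add: cl_sign_def)
qed

text \<open>Symmetric difference is a group operation, so \<open>A\<close> and the target
  \<open>T\<close> determine the second factor and one of the two sums collapses.\<close>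

lemma cl_mult_eq:
  assumes T: "T \<in> Pow {1..m}"
  shows "cl_mult m u v T = (\<Sum>A\<in>Pow {1..m}. cl_sign A ((T - A) \<union> (A - T)) * u A * v ((T - A) \<union> (A - T)))"
  unfolding cl_mult_def
proof (rule sum.cong[OF refl])
  fix A assume A: "A \<in> Pow {1..m}"
  have "(\<Sum>B\<in>Pow {1..m}. if A - B \<union> (B - A) = T then cl_sign A B * u A * v B else 0)
    = (\<Sum>B\<in>Pow {1..m}. if B = (T - A) \<union> (A - T) then cl_sign A B * u A * v B else 0)"
    by (rule sum.cong[OF refl]) (rule if_cong; auto)
  also have "\<dots> = cl_sign A ((T - A) \<union> (A - T)) * u A * v ((T - A) \<union> (A - T))"
    using T A by (subst sum.delta) auto
  finally show "(\<Sum>B\<in>Pow {1..m}. if A - B \<union> (B - A) = T then cl_sign A B * u A * v B else 0) = \<dots>" .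
qed

lemma e_mult_eq_sign:
  assumes "finite T" shows "cl_sign {k} ((T - {k}) \<union> ({k} - T)) * v ((T - {k}) \<union> ({k} - T)) = e_mult k v T"
proof -
  have "(T - {k}) \<union> ({k} - T) = toggle k T" by (auto simp: toggle_def)
  moreover have "finite (toggle k T)" using assms by (simp add: toggle_def)
  ultimately show ?thesis by (simp add: e_mult_def cl_sign_singleton)
qed

lemma cl_mult_basis:
  assumes k: "k \<in> {1..m}" and T: "T \<in> Pow {1..m}"
  shows "cl_mult m (cl_basis k) v T = e_mult k v T"
proof -
  have fin: "finite T" using T by (auto intro: finite_subset)
  have "cl_mult m (cl_basis k) v T = (\<Sum>A\<in>Pow {1..m}. if A = {k} then cl_sign A ((T - A) \<union> (A - T)) * v ((T - A) \<union> (A - T)) else 0)"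
    unfolding cl_mult_eq[OF T] by (rule sum.cong) (auto simp: cl_basis_def)
  also have "\<dots> = e_mult k v T"
    using k by (subst sum.delta) (simp_all add: e_mult_eq_sign[OF fin])
  finally show ?thesis .
qed

lemma cl_mult_chi:
  assumes T: "T \<in> Pow {1..m}"
  shows "cl_mult m (chi m \<sigma> \<xi>) v T = chi_mult m \<sigma> \<xi> v T"
proof -
  have fin: "finite T" using T by (auto intro: finite_subset)
  let ?c = "\<lambda>j. \<i> * complex_of_real (\<sigma> * \<xi> j / (2 * vnorm m \<xi>))"
  let ?s = "\<lambda>A. cl_sign A ((T - A) \<union> (A - T))" and ?v = "\<lambda>A. v ((T - A) \<union> (A - T))"
  have "cl_mult m (chi m \<sigma> \<xi>) v T = (\<Sum>A\<in>Pow {1..m}. (if A = {} then ?s A * (1/2) * ?v A else 0)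
       + (\<Sum>j\<in>{1..m}. if A = {j} then ?s A * ?c j * ?v A else 0))"
    unfolding cl_mult_eq[OF T] chi_def
  proof (rule sum.cong[OF refl])
    fix A
    have "?s A * (\<Sum>j\<in>{1..m}. if A = {j} then ?c j else 0) * ?v A = (\<Sum>j\<in>{1..m}. if A = {j} then ?s A * ?c j * ?v A else 0)"
      unfolding sum_distrib_left sum_distrib_right by (intro sum.cong refl) (simp split: if_split)
    then show "?s A * ((if A = {} then 1/2 else 0) + (\<Sum>j\<in>{1..m}. if A = {j} then ?c j else 0)) * ?v A
      = (if A = {} then ?s A * (1/2) * ?v A else 0) + (\<Sum>j\<in>{1..m}. if A = {j} then ?s A * ?c j * ?v A else 0)"
      by (simp only: distrib_left distrib_right) (simp split: if_split)
  qed
  also have "\<dots> = (\<Sum>A\<in>Pow {1..m}. (if A = {} then ?s A * (1/2) * ?v A else 0))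
       + (\<Sum>j\<in>{1..m}. \<Sum>A\<in>Pow {1..m}. if A = {j} then ?s A * ?c j * ?v A else 0)"
    by (simp only: sum.distrib) (subst (2) sum.swap, rule refl)
  also have "(\<Sum>A\<in>Pow {1..m}. (if A = {} then ?s A * (1/2) * ?v A else 0)) = v T / 2"
    by (subst sum.delta) (simp_all add: cl_sign_def)
  also have "(\<Sum>j\<in>{1..m}. \<Sum>A\<in>Pow {1..m}. if A = {j} then ?s A * ?c j * ?v A else 0) = (\<Sum>j\<in>{1..m}. ?c j * e_mult j v T)"
  proof (rule sum.cong[OF refl])
    fix j assume j: "j \<in> {1..m}"
    have "(\<Sum>A\<in>Pow {1..m}. if A = {j} then ?s A * ?c j * ?v A else 0) = ?s {j} * ?c j * ?v {j}"
      using j by (subst sum.delta) auto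
    also have "\<dots> = ?c j * (?s {j} * ?v {j})" by (simp only: mult_ac)
    finally show "(\<Sum>A\<in>Pow {1..m}. if A = {j} then ?s A * ?c j * ?v A else 0) = ?c j * e_mult j v T"
      by (simp only: e_mult_eq_sign[OF fin])
  qed
  also have "\<dots> = \<i> * complex_of_real (\<sigma> / (2 * vnorm m \<xi>)) * vec_mult m \<xi> v T"
    by (simp add: vec_mult_def sum_distrib_left mult_ac)
  finally show ?thesis by (simp add: chi_mult_def)
qed

lemma cl_mult_scale: "cl_mult m (\<lambda>A. c * u A) v T = c * cl_mult m u v T"
  unfolding cl_mult_def sum_distrib_left
  by (intro sum.cong refl) (simp add: mult_ac)

lemma cl_mult_ekernel:
  assumes T: "T \<in> Pow {1..m}"
  shows "cl_mult m (ekernel m \<epsilon> x \<xi>) v T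
    = cis (vinner m x \<xi>) * (complex_of_real (exp (- \<epsilon> * x 0 * vnorm m \<xi>)) * chi_mult m \<epsilon> \<xi> v T)"
  unfolding ekernel_def cl_mult_scale cl_mult_chi[OF T] by (simp add: mult.assoc)

lemma cl_norm2_cl_mult_chi: "cl_norm2 m (cl_mult m (chi m \<sigma> \<xi>) v) = (\<Sum>T\<in>Pow {1..m}. (cmod (chi_mult m \<sigma> \<xi> v T))\<^sup>2)"
  unfolding cl_norm2_def by (intro sum.cong refl) (simp add: cl_mult_chi)

lemma e_mult_anticommute:
  assumes "finite T"
  shows "e_mult j (e_mult k v) T + e_mult k (e_mult j v) T = (if j = k then - 2 * v T else 0)"
proof -
  have sq: "(-1 :: complex) ^ n * ((-1) ^ n * z) = z" for n z by (simp flip: mult.assoc power_mult_distrib)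
  have fin: "finite (toggle i T)" for i using assms by (simp add: toggle_def)
  show ?thesis
    unfolding e_mult_def
    using toggle_commute[of k j T] assms
    by (cases j k rule: linorder_cases) (simp_all add: sign_toggle fin sq mult_ac)
qed

text \<open>Adding the double sum to its transpose leaves only the diagonal, by
  anticommutation.\<close>

lemma vec_mult_vec_mult:
  assumes "finite T"
  shows "vec_mult m \<xi> (vec_mult m \<xi> v) T = - complex_of_real ((vnorm m \<xi>)\<^sup>2) * v T"
proof -
  let ?a = "\<lambda>j k. complex_of_real (\<xi> j * \<xi> k) * e_mult j (e_mult k v) T"
  have S: "vec_mult m \<xi> (vec_mult m \<xi> v) T = (\<Sum>j\<in>{1..m}. \<Sum>k\<in>{1..m}. ?a j k)"
    by (simp add: vec_mult_def e_mult_def sum_distrib_left mult_ac)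
  have "2 * (\<Sum>j\<in>{1..m}. \<Sum>k\<in>{1..m}. ?a j k) = (\<Sum>j\<in>{1..m}. \<Sum>k\<in>{1..m}. ?a j k) + (\<Sum>j\<in>{1..m}. \<Sum>k\<in>{1..m}. ?a k j)"
    by (subst (3) sum.swap) simp
  also have "\<dots> = (\<Sum>j\<in>{1..m}. \<Sum>k\<in>{1..m}. if k = j then - 2 * complex_of_real ((\<xi> j)\<^sup>2) * v T else 0)"
    unfolding sum.distrib[symmetric]
  proof (intro sum.cong refl)
    fix j k
    have "?a j k + ?a k j = complex_of_real (\<xi> j * \<xi> k) * (e_mult j (e_mult k v) T + e_mult k (e_mult j v) T)"
      by (simp add: distrib_left mult_ac)
    also have "\<dots> = (if k = j then - 2 * complex_of_real ((\<xi> j)\<^sup>2) * v T else 0)"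
      by (simp add: e_mult_anticommute[OF assms] power2_eq_square)
    finally show "?a j k + ?a k j = (if k = j then - 2 * complex_of_real ((\<xi> j)\<^sup>2) * v T else 0)" .
  qed
  also have "\<dots> = 2 * (- complex_of_real ((vnorm m \<xi>)\<^sup>2) * v T)"
    by (simp add: vnorm_def sum_nonneg sum_distrib_left sum_distrib_right sum_negf mult_ac)
  finally show ?thesis unfolding S
    by (rule mult_left_cancel[THEN iffD1, rotated]) simp
qed

section \<open>The eigenprojections \<open>chi_mult\<close>\<close>

lemma vec_mult_linear: "vec_mult m \<xi> (\<lambda>T. a * u T + b * v T) T = a * vec_mult m \<xi> u T + b * vec_mult m \<xi> v T"
  by (simp add: vec_mult_def e_mult_def sum.distrib sum_distrib_left distrib_left mult_ac)

lemma chi_mult_linear: "chi_mult m \<sigma> \<xi> (\<lambda>T. a * u T + b * v T) T = a * chi_mult m \<sigma> \<xi> u T + b * chi_mult m \<sigma> \<xi> v T"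
  unfolding chi_mult_def vec_mult_linear by (simp add: algebra_simps add_divide_distrib)

lemma chi_mult_diff: "chi_mult m \<sigma> \<xi> (\<lambda>T. u T - v T) T = chi_mult m \<sigma> \<xi> u T - chi_mult m \<sigma> \<xi> v T"
  using chi_mult_linear[of m \<sigma> \<xi> 1 u "-1" v T] by simp

lemma chi_mult_add_opposite: "chi_mult m \<sigma> \<xi> v T + chi_mult m (- \<sigma>) \<xi> v T = v T"
  by (simp add: chi_mult_def)

text \<open>Since the square of \<open>\<i> * \<xi>\<close> is the scalar
  \<open>(vnorm m \<xi>)\<^sup>2\<close>, its eigenvalues are plus and minus
  \<open>vnorm m \<xi>\<close>, and \<open>chi_mult\<close> maps onto the eigenspace for
  \<open>\<sigma>\<close>. In this order the identity shows that the representing integral is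
  monogenic.\<close>

lemma vec_mult_chi_mult:
  assumes "finite T" "\<sigma>\<^sup>2 = 1" "vnorm m \<xi> \<noteq> 0"
  shows "\<i> * vec_mult m \<xi> (chi_mult m \<sigma> \<xi> v) T = complex_of_real (\<sigma> * vnorm m \<xi>) * chi_mult m \<sigma> \<xi> v T"
proof -
  let ?n = "complex_of_real (vnorm m \<xi>)" and ?s = "complex_of_real \<sigma>"
  have s: "?s * ?s = 1" using assms(2) by (metis of_real_1 of_real_mult power2_eq_square)
  have "chi_mult m \<sigma> \<xi> v = (\<lambda>T. (1/2) * v T + (\<i> * complex_of_real (\<sigma> / (2 * vnorm m \<xi>))) * vec_mult m \<xi> v T)"
    by (simp add: chi_mult_def fun_eq_iff)
  then have "vec_mult m \<xi> (chi_mult m \<sigma> \<xi> v) T = (1/2) * vec_mult m \<xi> v T + (\<i> * (?s / (2 * ?n))) * (- ?n\<^sup>2 * v T)"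
    by (simp only: vec_mult_linear vec_mult_vec_mult[OF assms(1)]) simp
  also have "\<dots> = vec_mult m \<xi> v T / 2 - \<i> * ?s * ?n * v T / 2"
    using assms(3) by (simp add: power2_eq_square field_simps)
  finally have "\<i> * vec_mult m \<xi> (chi_mult m \<sigma> \<xi> v) T = \<i> * vec_mult m \<xi> v T / 2 + ?s * ?n * v T / 2"
    by (simp only: right_diff_distrib) (simp add: mult.assoc)
  also have "\<dots> = ?s * ?n * (v T / 2) + \<i> * (?s * ?s) * vec_mult m \<xi> v T / 2" unfolding s by simp
  also have "\<dots> = complex_of_real (\<sigma> * vnorm m \<xi>) * chi_mult m \<sigma> \<xi> v T"
    using assms(3) by (simp add: chi_mult_def field_simps)
  finally show ?thesis .
qed

text \<open>\<open>chi_mult\<close> is a polynomial in multiplication by \<open>\<xi>\<close> and so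
  commutes with it. In this order the identity decouples the differential equation of the
  transform.\<close>

lemma chi_mult_vec_mult:
  assumes "finite T" "\<sigma>\<^sup>2 = 1" "vnorm m \<xi> \<noteq> 0"
  shows "chi_mult m \<sigma> \<xi> (\<lambda>T. \<i> * vec_mult m \<xi> v T) T = complex_of_real (\<sigma> * vnorm m \<xi>) * chi_mult m \<sigma> \<xi> v T"
proof -
  have "chi_mult m \<sigma> \<xi> v = (\<lambda>T. (1/2) * v T + (\<i> * complex_of_real (\<sigma> / (2 * vnorm m \<xi>))) * vec_mult m \<xi> v T)"
    by (simp add: chi_mult_def fun_eq_iff)
  then have 1: "vec_mult m \<xi> (chi_mult m \<sigma> \<xi> v) T = (1/2) * vec_mult m \<xi> v T
      + (\<i> * complex_of_real (\<sigma> / (2 * vnorm m \<xi>))) * vec_mult m \<xi> (vec_mult m \<xi> v) T"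
    by (simp only: vec_mult_linear)
  have 2: "vec_mult m \<xi> (\<lambda>T. \<i> * vec_mult m \<xi> v T) T = \<i> * vec_mult m \<xi> (vec_mult m \<xi> v) T"
    using vec_mult_linear[of m \<xi> \<i> "vec_mult m \<xi> v" 0 v T] by simp
  have "\<i> * vec_mult m \<xi> (chi_mult m \<sigma> \<xi> v) T = chi_mult m \<sigma> \<xi> (\<lambda>T. \<i> * vec_mult m \<xi> v T) T"
    unfolding 1 chi_mult_def 2 by (simp add: algebra_simps)
  then show ?thesis using vec_mult_chi_mult[OF assms, of v] by simp
qed

lemma abs_component_le_vnorm: "k \<in> {1..m} \<Longrightarrow> \<bar>\<xi> k\<bar> \<le> vnorm m \<xi>"
  unfolding vnorm_def
  by (rule real_le_rsqrt) (use member_le_sum[of k "{1..m}" "\<lambda>k. (\<xi> k)\<^sup>2"] in simp)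

lemma vnorm_nonneg [simp]: "0 \<le> vnorm m \<xi>"
  by (simp add: vnorm_def sum_nonneg)

lemma norm_e_mult: "cmod (e_mult k v T) = cmod (v (toggle k T))"
  by (simp add: e_mult_def norm_mult norm_power)

lemma cmod2_le_cl_norm2: "T \<in> Pow {1..m} \<Longrightarrow> (cmod (v T))\<^sup>2 \<le> cl_norm2 m v"
  unfolding cl_norm2_def by (rule member_le_sum) auto

text \<open>There are \<open>m + 1\<close> terms, each at most the norm of \<open>v\<close> because
  \<open>\<bar>\<xi> k\<bar> \<le> vnorm m \<xi>\<close>. At frequency 0 division by zero gives 0
  and only \<open>v T / 2\<close> is left, so the bound holds everywhere.\<close>

lemma norm_chi_mult_le:
  assumes T: "T \<in> Pow {1..m}" and s: "\<bar>\<sigma>\<bar> = 1"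
  shows "(cmod (chi_mult m \<sigma> \<xi> v T))\<^sup>2 \<le> (real m + 1)\<^sup>2 * cl_norm2 m v"
proof -
  define q where "q = sqrt (cl_norm2 m v)"
  have q: "cmod (v S) \<le> q" if "S \<in> Pow {1..m}" for S
    unfolding q_def by (rule real_le_rsqrt) (rule cmod2_le_cl_norm2[OF that])
  have q0: "0 \<le> q" using q[of "{}"] norm_ge_zero[of "v {}"] by (meson Pow_bottom order_trans)
  have "cmod (\<i> * complex_of_real (\<sigma> / (2 * vnorm m \<xi>)) * vec_mult m \<xi> v T)
     = cmod (\<Sum>k\<in>{1..m}. \<i> * complex_of_real (\<sigma> * \<xi> k / (2 * vnorm m \<xi>)) * e_mult k v T)"
    by (simp add: vec_mult_def sum_distrib_left mult_ac)
  also have "\<dots> \<le> (\<Sum>k\<in>{1..m}. q)"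
  proof (intro sum_norm_le)
    fix k assume k: "k \<in> {1..m}"
    have "\<bar>\<xi> k\<bar> / (2 * vnorm m \<xi>) \<le> 1"
      using abs_component_le_vnorm[OF k, of \<xi>] vnorm_nonneg[of m \<xi>]
      by (cases "vnorm m \<xi> = 0") (simp_all add: divide_le_eq)
    moreover have "cmod (e_mult k v T) \<le> q" unfolding norm_e_mult using k T by (intro q) (simp only: toggle_in_Pow)
    ultimately have "\<bar>\<xi> k\<bar> / (2 * vnorm m \<xi>) * cmod (e_mult k v T) \<le> 1 * q"
      by (intro mult_mono) auto
    then show "cmod (\<i> * complex_of_real (\<sigma> * \<xi> k / (2 * vnorm m \<xi>)) * e_mult k v T) \<le> q"
      using s by (simp add: norm_mult norm_divide abs_mult)
  qed
  finally have 1: "cmod (\<i> * complex_of_real (\<sigma> / (2 * vnorm m \<xi>)) * vec_mult m \<xi> v T) \<le> real m * q" by simp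
  have "cmod (chi_mult m \<sigma> \<xi> v T) \<le> cmod (v T / 2) + cmod (\<i> * complex_of_real (\<sigma> / (2 * vnorm m \<xi>)) * vec_mult m \<xi> v T)"
    unfolding chi_mult_def by (rule norm_triangle_ineq)
  also have "\<dots> \<le> q + real m * q" using 1 q[OF T] q0 by (intro add_mono) (simp_all add: norm_divide)
  finally have "cmod (chi_mult m \<sigma> \<xi> v T) \<le> (real m + 1) * q" by (simp add: algebra_simps)
  then have "(cmod (chi_mult m \<sigma> \<xi> v T))\<^sup>2 \<le> ((real m + 1) * q)\<^sup>2" by (rule power_mono) simp
  also have "\<dots> = (real m + 1)\<^sup>2 * cl_norm2 m v"
    by (simp add: power_mult_distrib q_def cl_norm2_def sum_nonneg)
  finally show ?thesis .
qed

lemma measurable_chi_mult [measurable (raw)]: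
  assumes T: "T \<in> Pow {1..m}" and [measurable]: "\<And>S. S \<in> Pow {1..m} \<Longrightarrow> (\<lambda>p. g p S) \<in> borel_measurable N"
    and [measurable]: "X \<in> measurable N (Mxi m)"
  shows "(\<lambda>p. chi_mult m \<sigma> (X p) (g p) T) \<in> borel_measurable N"
proof -
  have [measurable]: "(\<lambda>p. e_mult k (g p) T) \<in> borel_measurable N" if "k \<in> {1..m}" for k
    unfolding e_mult_def using that T
    by (intro borel_measurable_times borel_measurable_const assms(2)) (simp only: toggle_in_Pow)
  have [measurable]: "(\<lambda>p. g p T) \<in> borel_measurable N" using T by (rule assms(2))
  show ?thesis unfolding chi_mult_def vec_mult_def by measurable
qed

section \<open>Partial derivatives and cutoffs\<close>

lemma norm_diff_le_vector_derivative_bound: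
  fixes f :: "real \<Rightarrow> 'a::real_normed_vector"
  assumes "\<And>t. t \<in> closed_segment a b \<Longrightarrow> (f has_vector_derivative f' t) (at t)"
    and "\<And>t. t \<in> closed_segment a b \<Longrightarrow> norm (f' t) \<le> B"
  shows "norm (f b - f a) \<le> B * \<bar>b - a\<bar>"
proof -
  have "norm (f b - f a) \<le> B * norm (b - a)"
  proof (rule differentiable_bound[where S="closed_segment a b" and f'="\<lambda>t h. h *\<^sub>R f' t"])
    fix t assume t: "t \<in> closed_segment a b"
    show "(f has_derivative (\<lambda>h. h *\<^sub>R f' t)) (at t within closed_segment a b)"
      using assms(1)[OF t] by (auto simp: has_vector_derivative_def intro: has_derivative_at_withinI)
    have "onorm (\<lambda>h::real. h *\<^sub>R f' t) = norm (f' t)"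
      using onorm_scaleR_left[of "\<lambda>h::real. h" "f' t"] onorm_id[where 'a=real] by simp
    then show "onorm (\<lambda>h::real. h *\<^sub>R f' t) \<le> B" using assms(2)[OF t] by simp
  qed auto
  then show ?thesis by simp
qed

text \<open>The mean value inequality bounds the remainder quotient by \<open>2 * B\<close>;
  dominated convergence then applies along every sequence tending to \<open>t0\<close>.\<close>

lemma has_vector_derivative_integral:
  fixes u :: "real \<Rightarrow> 'a \<Rightarrow> complex"
  assumes d: "0 < d"
    and int: "\<And>t. \<bar>t - t0\<bar> < d \<Longrightarrow> integrable N (u t)"
    and deriv: "\<And>t x. \<bar>t - t0\<bar> < d \<Longrightarrow> x \<in> space N \<Longrightarrow> ((\<lambda>t. u t x) has_vector_derivative u' t x) (at t)"
    and bound: "\<And>t x. \<bar>t - t0\<bar> < d \<Longrightarrow> x \<in> space N \<Longrightarrow> cmod (u' t x) \<le> B x"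
    and B: "integrable N B" and [measurable]: "u' t0 \<in> borel_measurable N"
  shows "((\<lambda>t. \<integral>x. u t x \<partial>N) has_vector_derivative (\<integral>x. u' t0 x \<partial>N)) (at t0)"
proof -
  have u'int: "integrable N (u' t0)"
    by (rule Bochner_Integration.integrable_bound[OF B])
       (use bound[of t0] d in \<open>auto intro!: AE_I2 intro: order_trans[OF _ abs_ge_self]\<close>)
  let ?q = "\<lambda>t x. (u t x - u t0 x - (t - t0) *\<^sub>R u' t0 x) /\<^sub>R norm (t - t0)"
  let ?U = "\<lambda>t. \<integral>x. u t x \<partial>N" and ?D = "\<integral>x. u' t0 x \<partial>N"
  have "((\<lambda>t. (?U t - ?U t0 - (t - t0) *\<^sub>R ?D) /\<^sub>R norm (t - t0)) \<longlongrightarrow> 0) (at t0)"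
    unfolding tendsto_at_iff_sequentially
  proof (intro allI impI)
    fix X assume X: "\<forall>i. X i \<in> UNIV - {t0}" "X \<longlonglongrightarrow> t0"
    have "eventually (\<lambda>n. \<bar>X n - t0\<bar> < d) sequentially"
      using tendstoD[OF X(2) d] by (simp add: dist_real_def)
    then obtain K where K: "\<And>n. n \<ge> K \<Longrightarrow> \<bar>X n - t0\<bar> < d" by (auto simp: eventually_sequentially)
    define Y where "Y n = X (n + K)" for n
    have Y: "Y n \<noteq> t0" "\<bar>Y n - t0\<bar> < d" for n using X(1) K by (auto simp: Y_def)
    have Ylim: "Y \<longlonglongrightarrow> t0" unfolding Y_def using X(2) by (rule LIMSEQ_ignore_initial_segment)
    have um [measurable]: "u (Y n) \<in> borel_measurable N" "u t0 \<in> borel_measurable N" for n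
      using int[OF Y(2)] int[of t0] d by auto
    have lim: "(\<lambda>n. \<integral>x. ?q (Y n) x \<partial>N) \<longlonglongrightarrow> (\<integral>x. 0 \<partial>N)"
    proof (rule integral_dominated_convergence[where w="\<lambda>x. 2 * B x"])
      show "AE x in N. (\<lambda>n. ?q (Y n) x) \<longlonglongrightarrow> 0"
      proof (intro AE_I2)
        fix x assume x: "x \<in> space N"
        have "((\<lambda>t. ?q t x) \<longlongrightarrow> 0) (at t0)"
          using deriv[of t0 x] x d by (simp add: has_vector_derivative_def has_derivative_at_within)
        then show "(\<lambda>n. ?q (Y n) x) \<longlonglongrightarrow> 0"
          unfolding tendsto_at_iff_sequentially comp_def using Y(1) Ylim by auto
      qed
      show "AE x in N. norm (?q (Y n) x) \<le> 2 * B x" for n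
      proof (intro AE_I2)
        fix x assume x: "x \<in> space N"
        have seg: "\<bar>t - t0\<bar> < d" if "t \<in> closed_segment t0 (Y n)" for t
          using that Y(2)[of n] by (auto simp: closed_segment_eq_real_ivl split: if_splits)
        have "norm (u (Y n) x - u t0 x) \<le> B x * \<bar>Y n - t0\<bar>"
          by (rule norm_diff_le_vector_derivative_bound[where f="\<lambda>t. u t x"]) (auto intro!: deriv bound seg x)
        moreover have "norm ((Y n - t0) *\<^sub>R u' t0 x) \<le> B x * \<bar>Y n - t0\<bar>"
          using bound[of t0 x] d x by (simp add: mult.commute mult_right_mono)
        ultimately have "norm (u (Y n) x - u t0 x - (Y n - t0) *\<^sub>R u' t0 x) \<le> 2 * B x * \<bar>Y n - t0\<bar>"
          using norm_triangle_ineq4[of "u (Y n) x - u t0 x" "(Y n - t0) *\<^sub>R u' t0 x"] by simp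
        then show "norm (?q (Y n) x) \<le> 2 * B x"
          using Y(1)[of n] by (simp add: divide_simps)
      qed
    qed (use B in auto)
    have q: "(\<integral>x. ?q (Y n) x \<partial>N) = (?U (Y n) - ?U t0 - (Y n - t0) *\<^sub>R ?D) /\<^sub>R norm (Y n - t0)" for n
      using int[OF Y(2)] int[of t0] d u'int
      by (simp add: Bochner_Integration.integral_diff)
    have "(\<lambda>n. (?U (Y n) - ?U t0 - (Y n - t0) *\<^sub>R ?D) /\<^sub>R norm (Y n - t0)) \<longlonglongrightarrow> 0"
      using lim unfolding q by simp
    then show "((\<lambda>t. (?U t - ?U t0 - (t - t0) *\<^sub>R ?D) /\<^sub>R norm (t - t0)) \<circ> X) \<longlonglongrightarrow> 0"
      unfolding Y_def comp_def by (rule LIMSEQ_offset)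
  qed
  then show ?thesis
    by (simp add: has_vector_derivative_def has_derivative_at_within bounded_linear_scaleR_left)
qed

text \<open>The converse of \<open>continuous_on_PiE_box\<close>; finiteness of \<open>I\<close>
  lets the coordinatewise conditions hold simultaneously along a sequence.\<close>

lemma continuous_on_PiE_boxI:
  fixes h :: "(nat \<Rightarrow> real) \<Rightarrow> 'a::metric_space"
  assumes I: "finite I"
    and box: "\<And>x e. x \<in> S \<Longrightarrow> 0 < e \<Longrightarrow> \<exists>r>0. \<forall>y\<in>S. (\<forall>j\<in>I. \<bar>y j - x j\<bar> < r) \<longrightarrow> dist (h y) (h x) < e"
  shows "continuous_on S h"
  unfolding continuous_on_sequentially
proof (intro allI ballI impI)
  fix y x assume x: "x \<in> S" and y: "(\<forall>n. y n \<in> S) \<and> y \<longlonglongrightarrow> x"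
  show "(h \<circ> y) \<longlonglongrightarrow> h x"
  proof (rule tendstoI)
    fix e :: real assume "0 < e"
    then obtain r where r: "0 < r" "\<And>z. z \<in> S \<Longrightarrow> (\<forall>j\<in>I. \<bar>z j - x j\<bar> < r) \<Longrightarrow> dist (h z) (h x) < e"
      using box[OF x] by blast
    have "(\<lambda>n. y n j) \<longlonglongrightarrow> x j" for j
      using y continuous_on_tendsto_compose[OF continuous_on_product_coordinates[of j], of y x sequentially] by auto
    then have "eventually (\<lambda>n. \<bar>y n j - x j\<bar> < r) sequentially" for j
      using tendstoD[of "\<lambda>n. y n j" "x j" sequentially r] r(1) by (simp add: dist_real_def)
    then have "eventually (\<lambda>n. \<forall>j\<in>I. \<bar>y n j - x j\<bar> < r) sequentially"
      using I by (simp add: eventually_ball_finite)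
    then show "eventually (\<lambda>n. dist ((h \<circ> y) n) (h x) < e) sequentially"
      by eventually_elim (use y r(2) in auto)
  qed
qed

text \<open>\<open>left_monogenic\<close> speaks of partial derivatives only, so joint continuity
  has to be derived. The path from \<open>x\<close> to \<open>y\<close> changes one coordinate at a
  time, and near \<open>x\<close> all partial derivatives are bounded by one constant
  \<open>C\<close>.\<close>

lemma continuous_on_of_partial_derivatives:
  fixes \<phi> :: "(nat \<Rightarrow> real) \<Rightarrow> complex"
  assumes I: "finite I" and S: "S \<subseteq> PiE I (\<lambda>_. UNIV)"
    and op: "\<And>x. x \<in> S \<Longrightarrow> \<exists>r>0. \<forall>y\<in>PiE I (\<lambda>_. UNIV). (\<forall>j\<in>I. \<bar>y j - x j\<bar> < r) \<longrightarrow> y \<in> S"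
    and deriv: "\<And>k x. k \<in> I \<Longrightarrow> x \<in> S \<Longrightarrow> ((\<lambda>t. \<phi> (x(k := t))) has_vector_derivative D k x) (at (x k))"
    and cont: "\<And>k. k \<in> I \<Longrightarrow> continuous_on S (D k)"
  shows "continuous_on S \<phi>"
proof (rule continuous_on_PiE_boxI[OF I])
  fix x and e :: real assume x: "x \<in> S" and e: "0 < e"
  obtain r0 where r0: "0 < r0" "\<And>y. y \<in> PiE I (\<lambda>_. UNIV) \<Longrightarrow> (\<forall>j\<in>I. \<bar>y j - x j\<bar> < r0) \<Longrightarrow> y \<in> S"
    using op[OF x] by blast
  have "\<forall>k\<in>I. \<exists>r>0. \<forall>y\<in>S. (\<forall>j\<in>I. \<bar>y j - x j\<bar> < r) \<longrightarrow> dist (D k y) (D k x) < 1"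
    using continuous_on_PiE_box[OF cont S x] by simp
  then obtain \<rho> where \<rho>: "\<And>k. k \<in> I \<Longrightarrow> 0 < \<rho> k"
     "\<And>k y. k \<in> I \<Longrightarrow> y \<in> S \<Longrightarrow> (\<forall>j\<in>I. \<bar>y j - x j\<bar> < \<rho> k) \<Longrightarrow> dist (D k y) (D k x) < 1"
    by (metis (no_types, lifting))
  define r where "r = Min (insert r0 (\<rho> ` I))"
  have r: "0 < r" "r \<le> r0" "\<And>k. k \<in> I \<Longrightarrow> r \<le> \<rho> k"
    using I r0(1) \<rho>(1) by (auto simp: r_def)
  define C where "C = (\<Sum>k\<in>I. cmod (D k x)) + 1"
  have C: "0 < C" unfolding C_def by (simp add: sum_nonneg add_nonneg_pos)
  have bd: "cmod (D k y) \<le> C" if "k \<in> I" "y \<in> S" "\<forall>j\<in>I. \<bar>y j - x j\<bar> < r" for k y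
  proof -
    have "dist (D k y) (D k x) < 1" using that r(3)[of k] by (intro \<rho>(2)) force+
    then have "cmod (D k y) \<le> cmod (D k x) + 1"
      using norm_triangle_ineq2[of "D k y" "D k x"] by (simp add: dist_norm)
    also have "cmod (D k x) \<le> (\<Sum>k\<in>I. cmod (D k x))" using that I by (intro member_le_sum) auto
    finally show ?thesis by (simp add: C_def)
  qed
  \<comment> \<open>At most \<open>card I\<close> moves of length below \<open>r'\<close> cost less
    than \<open>e\<close> in total; the added 1 keeps the inequality strict and the denominator
    positive.\<close>
  define r' where "r' = min r (e / (C * (real (card I) + 1)))"
  have r': "0 < r'" "r' \<le> r" using r e C by (auto simp: r'_def)
  have xE: "x \<in> PiE I (\<lambda>_. UNIV)" using S x by auto
  show "\<exists>r>0. \<forall>y\<in>S. (\<forall>j\<in>I. \<bar>y j - x j\<bar> < r) \<longrightarrow> dist (\<phi> y) (\<phi> x) < e"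
  proof (intro exI[of _ r'] conjI r' ballI impI)
    fix y assume y: "y \<in> S" "\<forall>j\<in>I. \<bar>y j - x j\<bar> < r'"
    \<comment> \<open>The intermediate points of the path: coordinates in \<open>J\<close> have
      already moved to \<open>y\<close>.\<close>
    define z where "z J i = (if i \<in> J then y i else x i)" for J i
    have box: "(z J)(k := t) \<in> S \<and> (\<forall>j\<in>I. \<bar>((z J)(k := t)) j - x j\<bar> < r)"
      if "J \<subseteq> I" "k \<in> I" "\<bar>t - x k\<bar> < r" for J k t
    proof -
      have 1: "(z J)(k := t) \<in> PiE I (\<lambda>_. UNIV)" using that xE by (auto simp: z_def PiE_def extensional_def)
      have 2: "\<bar>((z J)(k := t)) j - x j\<bar> < r" if "j \<in> I" for j
      proof -
        have "\<bar>y j - x j\<bar> < r" using y(2) that r'(2) by (meson less_le_trans)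
        then show ?thesis using \<open>\<bar>t - x k\<bar> < r\<close> r(1) by (simp add: z_def)
      qed
      have "(z J)(k := t) \<in> S" by (rule r0(2)[OF 1]) (use 2 r(2) in \<open>blast intro: less_le_trans\<close>)
      then show ?thesis using 2 by blast
    qed
    have "cmod (\<phi> (z J) - \<phi> x) \<le> C * r' * real (card J)" if "J \<subseteq> I" for J
      using finite_subset[OF that I] that
    proof (induction J rule: finite_induct)
      case empty
      have "z {} = x" by (simp add: z_def fun_eq_iff)
      then show ?case by simp
    next
      case (insert k J)
      have zk: "(z J)(k := y k) = z (insert k J)" "(z J)(k := x k) = z J"
        using insert by (auto simp: z_def fun_eq_iff)
      have seg: "\<bar>t - x k\<bar> < r" if "t \<in> closed_segment (x k) (y k)" for t
      proof -
        have "\<bar>y k - x k\<bar> < r" using y(2) insert.prems r'(2) by (meson insert_subset less_le_trans)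
        then show ?thesis using that by (auto simp: closed_segment_eq_real_ivl split: if_splits)
      qed
      have "norm (\<phi> ((z J)(k := y k)) - \<phi> ((z J)(k := x k))) \<le> C * \<bar>y k - x k\<bar>"
      proof (rule norm_diff_le_vector_derivative_bound[where f="\<lambda>t. \<phi> ((z J)(k := t))" and f'="\<lambda>t. D k ((z J)(k := t))"])
        fix t assume "t \<in> closed_segment (x k) (y k)"
        then have b: "(z J)(k := t) \<in> S \<and> (\<forall>j\<in>I. \<bar>((z J)(k := t)) j - x j\<bar> < r)"
          using insert.prems by (intro box seg) auto
        then show "((\<lambda>t. \<phi> ((z J)(k := t))) has_vector_derivative D k ((z J)(k := t))) (at t)"
          using deriv[of k "(z J)(k := t)"] insert.prems by simp
        show "cmod (D k ((z J)(k := t))) \<le> C" using b insert.prems by (intro bd) auto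
      qed
      also have "\<dots> \<le> C * r'" using y(2) insert.prems C by (intro mult_left_mono) auto
      finally have "cmod (\<phi> (z (insert k J)) - \<phi> (z J)) \<le> C * r'" by (simp add: zk)
      then have "cmod (\<phi> (z (insert k J)) - \<phi> x) \<le> C * r' + C * r' * real (card J)"
        using insert norm_triangle_ineq[of "\<phi> (z (insert k J)) - \<phi> (z J)" "\<phi> (z J) - \<phi> x"] by auto
      then show ?case using insert by (simp add: algebra_simps)
    qed
    from this[of I] have "cmod (\<phi> (z I) - \<phi> x) \<le> C * r' * real (card I)" by simp
    moreover have "z I = y" using S y(1) xE by (auto simp: z_def fun_eq_iff PiE_def extensional_def)
    moreover have "C * r' * real (card I) < e"
    proof -
      have "C * r' * real (card I) < C * r' * (real (card I) + 1)" using C r' by simp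
      also have "\<dots> \<le> C * (e / (C * (real (card I) + 1))) * (real (card I) + 1)"
        using C by (intro mult_right_mono mult_left_mono) (auto simp: r'_def)
      also have "C * (e / (C * N)) * N = e" if "0 < N" for N using C that by simp
      then have "C * (e / (C * (real (card I) + 1))) * (real (card I) + 1) = e" by simp
      finally show ?thesis .
    qed
    ultimately show "dist (\<phi> y) (\<phi> x) < e" by (simp add: dist_norm)
  qed
qed

section \<open>Compactness and measurability on extensional functions\<close>

lemma continuous_on_fun_upd [continuous_intros]:
  fixes f :: "'a::topological_space \<Rightarrow> 'i \<Rightarrow> 'b::topological_space"
  assumes "continuous_on S f" "continuous_on S g"
  shows "continuous_on S (\<lambda>x. (f x)(k := g x))"
proof (rule continuous_on_coordinatewise_then_product)
  fix i show "continuous_on S (\<lambda>x. ((f x)(k := g x)) i)"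
    by (cases "i = k") (use assms continuous_on_product_then_coordinatewise[OF assms(1), of i] in auto)
qed

lemma continuous_on_component: "continuous_on S (\<lambda>x. x i :: 'b::topological_space)"
  by (rule continuous_on_subset[OF continuous_on_product_coordinates]) simp

lemma compact_PiE_UNIV:
  fixes K :: "'i \<Rightarrow> 'b::topological_space set"
  assumes "\<And>i. compact (K i)" shows "compact (PiE UNIV K)"
  using assms compactin_PiE[of "\<lambda>_. euclidean" UNIV K] by (simp add: euclidean_product_topology)

lemma continuous_bounded_on_box:
  fixes \<phi> :: "(nat \<Rightarrow> real) \<Rightarrow> complex"
  assumes cont: "continuous_on S \<phi>"
    and S: "{x \<in> PiE I (\<lambda>_. UNIV). \<forall>i\<in>I. l i \<le> x i \<and> x i \<le> u i} \<subseteq> S"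
  shows "\<exists>C. \<forall>x\<in>PiE I (\<lambda>_. UNIV). (\<forall>i\<in>I. l i \<le> x i \<and> x i \<le> u i) \<longrightarrow> cmod (\<phi> x) \<le> C"
proof -
  \<comment> \<open>Frozen coordinates become singletons, so the box is a product of compact sets
    over all indices and Tychonoff applies.\<close>
  define K where "K i = (if i \<in> I then {l i..u i} else {undefined})" for i
  have eq: "{x \<in> PiE I (\<lambda>_. UNIV). \<forall>i\<in>I. l i \<le> x i \<and> x i \<le> u i} = PiE UNIV K"
    by (auto simp: K_def PiE_def extensional_def Pi_def split: if_splits)
  have "compact (PiE UNIV K)" by (rule compact_PiE_UNIV) (simp add: K_def)
  moreover have "continuous_on (PiE UNIV K) \<phi>" using cont S unfolding eq by (rule continuous_on_subset)
  ultimately have "bounded (\<phi> ` PiE UNIV K)" by (intro compact_imp_bounded compact_continuous_image)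
  then obtain C where "\<forall>y\<in>\<phi> ` PiE UNIV K. cmod y \<le> C" unfolding bounded_iff by blast
  then show ?thesis unfolding eq[symmetric] by (intro exI[of _ C]) auto
qed

lemma measurable_PiM_borel:
  "(\<lambda>x. x) \<in> measurable (PiM I (\<lambda>_. lborel :: real measure)) (borel :: (nat \<Rightarrow> real) measure)"
proof (rule measurable_coordinatewise_then_product)
  fix i show "(\<lambda>x. x i) \<in> borel_measurable (PiM I (\<lambda>_. lborel :: real measure))"
  proof (cases "i \<in> I")
    case True
    then show ?thesis using measurable_component_singleton[of i I "\<lambda>_. lborel"] by simp
  next
    case False
    have "(\<lambda>x. undefined) \<in> borel_measurable (PiM I (\<lambda>_. lborel :: real measure))" by simp
    then show ?thesis
      by (rule measurable_cong[THEN iffD1, rotated]) (use False in \<open>auto simp: space_PiM PiE_def extensional_def\<close>)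
  qed
qed

text \<open>Continuity is known only at extensional points. Precomposition with
  \<open>restrict\<close> extends the function continuously to the open set \<open>V\<close>, where
  Borel measurability of continuous functions is available.\<close>

lemma borel_measurable_continuous_on_PiM:
  fixes \<phi> :: "(nat \<Rightarrow> real) \<Rightarrow> complex"
  assumes cont: "continuous_on {x \<in> PiE I (\<lambda>_. UNIV). x \<in> V} \<phi>" and V: "open V"
    and VI: "\<And>x. restrict x I \<in> V \<longleftrightarrow> x \<in> V"
  shows "(\<lambda>x. indicator V x *\<^sub>R \<phi> x) \<in> borel_measurable (PiM I (\<lambda>_. lborel :: real measure))"
proof -
  have rc: "continuous_on V (\<lambda>x. restrict x I :: nat \<Rightarrow> real)"
  proof (rule continuous_on_coordinatewise_then_product)
    fix i show "continuous_on V (\<lambda>x. restrict x I i :: real)"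
      by (cases "i \<in> I") (auto intro: continuous_on_component)
  qed
  have "continuous_on V (\<lambda>x. \<phi> (restrict x I))"
    by (rule continuous_on_compose2[OF cont rc]) (auto simp: VI)
  then have "(\<lambda>x. indicator V x *\<^sub>R \<phi> (restrict x I)) \<in> borel_measurable borel"
    using V by (intro borel_measurable_continuous_on_indicator) auto
  from measurable_compose[OF measurable_PiM_borel this, of I]
  show ?thesis
    by (rule measurable_cong[THEN iffD1, rotated])
       (auto simp: space_PiM PiE_restrict)
qed


text \<open>One continuous derivative of the cutoff suffices, so an explicit piecewise polynomial is used.\<close>

definition bump :: "real \<Rightarrow> real" where "bump s = (max 0 (1 - s\<^sup>2))\<^sup>2"

definition bump' :: "real \<Rightarrow> real" where "bump' s = - 4 * s * max 0 (1 - s\<^sup>2)"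

text \<open>Squaring removes the corner of the positive part: at 0 the difference quotient is at
  most \<open>\<bar>h\<bar>\<close>.\<close>

lemma DERIV_max_0_squared: "((\<lambda>z::real. (max 0 z)\<^sup>2) has_real_derivative 2 * max 0 z) (at z)"
proof (cases z "0::real" rule: linorder_cases)
  case less
  have "((\<lambda>z. 0) has_real_derivative 2 * max 0 z) (at z)" using less by simp
  then show ?thesis
    by (rule has_field_derivative_transform_within_open[where S="{..<0}"]) (use less in auto)
next
  case greater
  have "((\<lambda>z. z\<^sup>2) has_real_derivative 2 * max 0 z) (at z)"
    using greater by (auto intro!: derivative_eq_intros)
  then show ?thesis
    by (rule has_field_derivative_transform_within_open[where S="{0<..}"]) (use greater in auto)
next
  case equal
  have "((\<lambda>h::real. (max 0 h)\<^sup>2 / h) \<longlongrightarrow> 0) (at 0)"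
  proof (rule Lim_null_comparison)
    show "eventually (\<lambda>h::real. norm ((max 0 h)\<^sup>2 / h) \<le> \<bar>h\<bar>) (at 0)"
      by (intro always_eventually allI) (auto simp: max_def power2_eq_square)
    show "((\<lambda>h::real. \<bar>h\<bar>) \<longlongrightarrow> 0) (at 0)" by (rule tendsto_eq_intros | simp)+
  qed
  then show ?thesis using equal by (simp add: has_field_derivative_iff)
qed

lemma DERIV_bump: "(bump has_real_derivative bump' s) (at s)"
proof -
  have "((\<lambda>s. (max 0 (1 - s\<^sup>2))\<^sup>2) has_real_derivative 2 * max 0 (1 - s\<^sup>2) * (- (2 * s))) (at s)"
    by (rule DERIV_chain2[OF DERIV_max_0_squared]) (auto intro!: derivative_eq_intros)
  then show ?thesis by (simp add: bump_def[abs_def] bump'_def mult_ac)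
qed

lemma bump_bounds: "0 \<le> bump s" "bump s \<le> 1" "\<bar>bump' s\<bar> \<le> 4"
proof -
  have m: "0 \<le> max 0 (1 - s\<^sup>2)" "max 0 (1 - s\<^sup>2) \<le> 1" by auto
  show "0 \<le> bump s" "bump s \<le> 1" using m by (auto simp: bump_def intro: power_le_one)
  show "\<bar>bump' s\<bar> \<le> 4"
  proof (cases "\<bar>s\<bar> \<le> 1")
    case True
    then have "\<bar>s\<bar> * max 0 (1 - s\<^sup>2) \<le> 1 * 1" using m by (intro mult_mono) auto
    then show ?thesis using m by (simp add: bump'_def abs_mult)
  next
    case False
    then have "1 \<le> s\<^sup>2" by (metis abs_square_le_1 linear power2_abs abs_ge_self le_less_trans not_le)
    then show ?thesis by (simp add: bump'_def)
  qed
qed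

lemma bump_outside: "1 \<le> \<bar>s\<bar> \<Longrightarrow> bump s = 0" "1 \<le> \<bar>s\<bar> \<Longrightarrow> bump' s = 0"
proof -
  assume "1 \<le> \<bar>s\<bar>"
  then have "1 \<le> \<bar>s\<bar>\<^sup>2" by (rule one_le_power)
  then show "bump s = 0" "bump' s = 0" by (simp_all add: bump_def bump'_def)
qed

lemma continuous_bump: "continuous_on UNIV bump" "continuous_on UNIV bump'"
  unfolding bump_def[abs_def] bump'_def[abs_def] by (auto intro!: continuous_intros)

lemma borel_measurable_bump [measurable]: "bump \<in> borel_measurable borel" "bump' \<in> borel_measurable borel"
  unfolding bump_def[abs_def] bump'_def[abs_def] by measurable

text \<open>A product over the coordinates instead of a radial function: its partial derivatives are
  explicit and its support is a box.\<close>

definition cutoff :: "nat \<Rightarrow> real \<Rightarrow> (nat \<Rightarrow> real) \<Rightarrow> real" where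
  "cutoff m R x = (\<Prod>j\<in>{1..m}. bump (x j / R))"

text \<open>The \<open>k\<close>-th partial derivative of \<open>cutoff m R\<close>. The factor
  \<open>1 / R\<close> is the origin of all decay of the error.\<close>

definition dcutoff :: "nat \<Rightarrow> real \<Rightarrow> nat \<Rightarrow> (nat \<Rightarrow> real) \<Rightarrow> real" where
  "dcutoff m R k x = bump' (x k / R) / R * (\<Prod>j\<in>{1..m} - {k}. bump (x j / R))"

section \<open>Bounds for the cutoffs and integration by parts\<close>

lemma measurable_cutoff [measurable]: "cutoff m R \<in> borel_measurable (Mxi m)"
  unfolding cutoff_def[abs_def] by measurable

lemma measurable_dcutoff [measurable]: "k \<in> {1..m} \<Longrightarrow> dcutoff m R k \<in> borel_measurable (Mxi m)"
  unfolding dcutoff_def[abs_def] by measurable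

lemma cutoff_nonneg: "0 \<le> cutoff m R x"
  unfolding cutoff_def by (simp add: prod_nonneg bump_bounds)

lemma cutoff_le_1: "cutoff m R x \<le> 1"
  unfolding cutoff_def by (intro prod_le_1) (simp add: bump_bounds)

lemma abs_dcutoff_le: assumes "0 < R" shows "\<bar>dcutoff m R k x\<bar> \<le> 4 / R"
proof -
  have p: "0 \<le> (\<Prod>j\<in>{1..m} - {k}. bump (x j / R))" "(\<Prod>j\<in>{1..m} - {k}. bump (x j / R)) \<le> 1"
    by (auto intro!: prod_nonneg prod_le_1 simp: bump_bounds)
  have "\<bar>bump' (x k / R)\<bar> / R * (\<Prod>j\<in>{1..m} - {k}. bump (x j / R)) \<le> 4 / R * 1"
    using p assms bump_bounds(3)[of "x k / R"] by (intro mult_mono divide_right_mono) auto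
  then show ?thesis using p assms by (simp add: dcutoff_def abs_mult)
qed

lemma cutoff_tendsto_1: "(\<lambda>n. cutoff m (real (Suc n)) x) \<longlonglongrightarrow> 1"
proof -
  have "(\<lambda>n. bump (x j / real (Suc n))) \<longlonglongrightarrow> bump 0" for j
  proof (rule isCont_tendsto_compose[where g=bump])
    show "isCont bump 0" using continuous_bump(1) by (simp add: continuous_on_eq_continuous_at)
    show "(\<lambda>n. x j / real (Suc n)) \<longlonglongrightarrow> 0"
      using tendsto_mult[OF tendsto_const LIMSEQ_inverse_real_of_nat, of "x j"] by (simp add: divide_inverse)
  qed
  then have "(\<lambda>n. \<Prod>j\<in>{1..m}. bump (x j / real (Suc n))) \<longlonglongrightarrow> (\<Prod>j\<in>{1..m}. bump 0)"
    by (intro tendsto_prod)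
  then show ?thesis by (simp add: cutoff_def bump_def)
qed

lemma cutoff_outside:
  assumes "0 < R" "j \<in> {1..m}" "R \<le> \<bar>x j\<bar>"
  shows "cutoff m R x = 0" "dcutoff m R k x = 0"
proof -
  have b: "bump (x j / R) = 0" "bump' (x j / R) = 0" using assms by (auto intro!: bump_outside simp: abs_divide)
  then show "cutoff m R x = 0" using assms unfolding cutoff_def by (intro prod_zero) auto
  show "dcutoff m R k x = 0"
  proof (cases "k = j")
    case False
    then have "(\<Prod>j\<in>{1..m} - {k}. bump (x j / R)) = 0" using assms b by (intro prod_zero) auto
    then show ?thesis by (simp add: dcutoff_def)
  qed (simp add: dcutoff_def b)
qed

lemma continuous_cutoff: "continuous_on S (cutoff m R)" "continuous_on S (dcutoff m R k)"
proof -
  have "continuous_on S (\<lambda>x. bump (x j * inverse R))" "continuous_on S (\<lambda>x. bump' (x j * inverse R))" for j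
    by (rule continuous_on_compose2[OF continuous_bump(1)] continuous_on_compose2[OF continuous_bump(2)];
        auto intro!: continuous_intros continuous_on_component)+
  then show "continuous_on S (cutoff m R)" "continuous_on S (dcutoff m R k)"
    unfolding cutoff_def[abs_def] dcutoff_def[abs_def] divide_inverse
    by (intro continuous_intros; simp)+
qed

lemma DERIV_cutoff:
  assumes k: "k \<in> {1..m}" and R: "0 < R"
  shows "((\<lambda>t. cutoff m R (x(k := t))) has_real_derivative dcutoff m R k x) (at (x k))"
proof -
  have eq: "cutoff m R (x(k := t)) = bump (t / R) * (\<Prod>j\<in>{1..m} - {k}. bump (x j / R))" for t
    unfolding cutoff_def using k
    by (subst prod.remove[of _ k]) (auto intro!: prod.cong)
  have "((\<lambda>t. bump (t / R)) has_real_derivative bump' (x k / R) * (1 / R)) (at (x k))"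
    by (rule DERIV_chain2[OF DERIV_bump]) (use R in \<open>auto intro!: derivative_eq_intros\<close>)
  then have "((\<lambda>t. bump (t / R) * (\<Prod>j\<in>{1..m} - {k}. bump (x j / R))) has_real_derivative
     bump' (x k / R) * (1 / R) * (\<Prod>j\<in>{1..m} - {k}. bump (x j / R))) (at (x k))"
    by (rule DERIV_cmult_right)
  then show ?thesis by (simp add: eq dcutoff_def)
qed

text \<open>Integrating first in coordinate \<open>k\<close> leaves, by the fundamental theorem on
  \<open>{-R..R}\<close>, boundary values of \<open>p\<close>, and these are 0.\<close>

lemma integral_partial_derivative_eq_0:
  fixes p q :: "(nat \<Rightarrow> real) \<Rightarrow> complex"
  assumes k: "k \<in> {1..m}" and R: "0 < R"
    and int: "integrable (Mxi m) q"
    and deriv: "\<And>x. x \<in> space (Mxi m) \<Longrightarrow> ((\<lambda>t. p (x(k := t))) has_vector_derivative q x) (at (x k))"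
    and cont: "continuous_on (space (Mxi m)) q"
    and out: "\<And>x. R \<le> \<bar>x k\<bar> \<Longrightarrow> p x = 0 \<and> q x = 0"
  shows "(\<integral>x. q x \<partial>Mxi m) = 0"
proof -
  interpret product_sigma_finite "\<lambda>_::nat. lborel :: real measure" ..
  let ?J = "{1..m} - {k}"
  have J: "insert k ?J = {1..m}" using k by auto
  have "(\<integral>x. q x \<partial>Mxi m) = integral\<^sup>L (PiM (insert k ?J) (\<lambda>_. lborel)) q"
    by (simp only: Mxi_def J)
  also have "\<dots> = (\<integral>x. (\<integral>y. q (x(k := y)) \<partial>lborel) \<partial>PiM ?J (\<lambda>_. lborel))"
    by (rule product_integral_insert) (use int in \<open>simp_all only: J Mxi_def, auto\<close>)
  also have "\<dots> = (\<integral>x. 0 \<partial>PiM ?J (\<lambda>_. lborel :: real measure))"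
  proof (rule Bochner_Integration.integral_cong[OF refl])
    fix x :: "nat \<Rightarrow> real" assume x: "x \<in> space (PiM ?J (\<lambda>_. lborel))"
    have xk: "x(k := y) \<in> space (Mxi m)" for y
      using x k by (auto simp: space_PiM space_Mxi PiE_def extensional_def)
    have "(\<integral>y. q (x(k := y)) \<partial>lborel) = (\<integral>y. indicator {-R..R} y *\<^sub>R q (x(k := y)) \<partial>lborel)"
      by (rule Bochner_Integration.integral_cong[OF refl]) (use out in \<open>auto simp: indicator_def abs_le_iff not_le\<close>)
    also have "\<dots> = p (x(k := R)) - p (x(k := - R))"
    proof (rule integral_FTC_atLeastAtMost)
      show "- R \<le> R" using R by simp
      show "((\<lambda>y. p (x(k := y))) has_vector_derivative q (x(k := y))) (at y within {-R..R})" for y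
        using deriv[OF xk[of y]] by (simp add: has_vector_derivative_at_within)
      show "continuous_on {-R..R} (\<lambda>y. q (x(k := y)))"
        by (rule continuous_on_compose2[OF cont continuous_on_fun_upd[OF continuous_on_const continuous_on_id]])
           (auto intro!: xk)
    qed
    also have "\<dots> = 0" using out[of "x(k := R)"] out[of "x(k := - R)"] R by simp
    finally show "(\<integral>y. q (x(k := y)) \<partial>lborel) = 0" .
  qed
  finally show ?thesis by simp
qed

lemma integrable_compact_support:
  fixes \<phi> :: "(nat \<Rightarrow> real) \<Rightarrow> complex"
  assumes cont: "continuous_on (space (Mxi m)) \<phi>"
    and out: "\<And>x j. x \<in> space (Mxi m) \<Longrightarrow> j \<in> {1..m} \<Longrightarrow> R \<le> \<bar>x j\<bar> \<Longrightarrow> \<phi> x = 0"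
  shows "integrable (Mxi m) \<phi>"
proof -
  interpret product_sigma_finite "\<lambda>_::nat. lborel :: real measure" ..
  have m: "\<phi> \<in> borel_measurable (Mxi m)"
    using borel_measurable_continuous_on_PiM[of "{1..m}" UNIV \<phi>] cont unfolding space_Mxi by (simp add: Mxi_def)
  obtain C where C: "\<And>x. x \<in> space (Mxi m) \<Longrightarrow> (\<forall>j\<in>{1..m}. - R \<le> x j \<and> x j \<le> R) \<Longrightarrow> cmod (\<phi> x) \<le> C"
    using continuous_bounded_on_box[OF cont, of "{1..m}" "\<lambda>_. - R" "\<lambda>_. R"] by (auto simp: space_Mxi)
  have "integrable (Mxi m) (\<lambda>x. \<Prod>j\<in>{1..m}. indicator {-R..R} (x j) :: real)"
    unfolding Mxi_def
    by (rule product_integrable_prod) (auto intro!: integrable_real_indicator simp: emeasure_lborel_Icc_eq)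
  then have "integrable (Mxi m) (\<lambda>x. C * (\<Prod>j\<in>{1..m}. indicator {-R..R} (x j)))" by auto
  then show ?thesis
  proof (rule Bochner_Integration.integrable_bound[OF _ m])
    show "AE x in Mxi m. norm (\<phi> x) \<le> norm (C * (\<Prod>j\<in>{1..m}. indicator {-R..R} (x j)))"
    proof (intro AE_I2)
      fix x assume x: "x \<in> space (Mxi m)"
      show "norm (\<phi> x) \<le> norm (C * (\<Prod>j\<in>{1..m}. indicator {-R..R} (x j)))"
      proof (cases "\<forall>j\<in>{1..m}. - R \<le> x j \<and> x j \<le> R")
        case True
        then have "(\<Prod>j\<in>{1..m}. indicator {-R..R} (x j)) = (1::real)" by (intro prod.neutral) auto
        then show ?thesis using C[OF x True] by simp
      next
        case False
        then obtain j where "j \<in> {1..m}" "R \<le> \<bar>x j\<bar>" by force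
        then show ?thesis using out[OF x] by simp
      qed
    qed
  qed
qed

section \<open>From the spectral representation to the half space\<close>

text \<open>Frequency 0 lies on the hyperplane where the first coordinate vanishes, a null set as
  \<open>1 \<le> m\<close>. The eigenvalue relations divide by \<open>vnorm\<close> and are used off
  this set.\<close>

lemma AE_vnorm_nonzero: assumes "1 \<le> m" shows "AE \<xi> in Mxi m. vnorm m \<xi> \<noteq> 0"
proof -
  interpret product_sigma_finite "\<lambda>_::nat. lborel :: real measure" ..
  let ?A = "\<lambda>i::nat. if i = 1 then {0::real} else UNIV"
  have "emeasure (Mxi m) (PiE {1..m} ?A) = (\<Prod>i\<in>{1..m}. emeasure lborel (?A i))"
    unfolding Mxi_def by (rule emeasure_PiM) auto
  also have "\<dots> = 0" using assms by (intro prod_zero) (auto intro!: bexI[of _ 1])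
  finally have "emeasure (Mxi m) (PiE {1..m} ?A) = 0" .
  moreover have "PiE {1..m} ?A \<in> sets (Mxi m)" unfolding Mxi_def by (rule sets_PiM_I_finite) auto
  ultimately have null: "PiE {1..m} ?A \<in> null_sets (Mxi m)" by auto
  show ?thesis
  proof (rule AE_I'[OF null], rule subsetI)
    fix \<xi> assume "\<xi> \<in> {\<xi> \<in> space (Mxi m). \<not> vnorm m \<xi> \<noteq> 0}"
    then have x: "\<xi> \<in> space (Mxi m)" "vnorm m \<xi> = 0" by auto
    have "\<bar>\<xi> 1\<bar> \<le> 0" using abs_component_le_vnorm[of 1 m \<xi>] assms x by simp
    then show "\<xi> \<in> PiE {1..m} ?A" using x by (auto simp: space_Mxi PiE_def Pi_def)
  qed
qed

text \<open>The source of the weight in the theorem: the square of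
  \<open>exp (- \<epsilon> * t * n)\<close> integrated over all heights of the half space. The
  substitution of \<open>\<epsilon> * t\<close> for \<open>t\<close> reduces both signs to
  one.\<close>

lemma nn_integral_exp_halfline:
  fixes a n \<epsilon> :: real
  assumes n: "0 < n" and eps: "\<epsilon> = 1 \<or> \<epsilon> = - 1"
  shows "(\<integral>\<^sup>+t. indicator {t. - a < \<epsilon> * t} t * ennreal (exp (- 2 * \<epsilon> * t * n)) \<partial>lborel) = ennreal (exp (2 * a * n) / (2 * n))"
proof -
  have "(\<integral>\<^sup>+t. indicator {t. - a < \<epsilon> * t} t * ennreal (exp (- 2 * \<epsilon> * t * n)) \<partial>lborel)
     = \<bar>\<epsilon>\<bar> * (\<integral>\<^sup>+t. indicator {t. - a < \<epsilon> * t} (0 + \<epsilon> * t) * ennreal (exp (- 2 * \<epsilon> * (0 + \<epsilon> * t) * n)) \<partial>lborel)"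
    by (rule nn_integral_real_affine) (use eps in auto)
  also have "\<dots> = (\<integral>\<^sup>+t. indicator {t. - a < t} t * ennreal (exp (- 2 * t * n)) \<partial>lborel)"
    using eps by (auto intro!: nn_integral_cong simp: indicator_def)
  also have "\<dots> = (\<integral>\<^sup>+t. ennreal (exp (- 2 * t * n)) * indicator {-a..} t \<partial>lborel)"
    by (rule nn_integral_cong_AE)
       (use AE_lborel_singleton[of "-a"] in eventually_elim, auto simp: indicator_def)
  also have "\<dots> = ennreal (0 - (- exp (- 2 * (- a) * n) / (2 * n)))"
  proof (rule nn_integral_FTC_atLeast)
    show "((\<lambda>t. - exp (- 2 * t * n) / (2 * n)) has_real_derivative exp (- 2 * t * n)) (at t)" for t
      using n by (auto intro!: derivative_eq_intros)
    have "filterlim (\<lambda>t. - 2 * n * t) at_bot at_top"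
      using n by (intro filterlim_tendsto_neg_mult_at_bot[OF tendsto_const]) (auto simp: filterlim_ident)
    then have "((\<lambda>t. exp (- 2 * n * t)) \<longlongrightarrow> 0) at_top" by (rule filterlim_compose[OF exp_at_bot])
    then have "((\<lambda>t. - exp (- 2 * n * t) / (2 * n)) \<longlongrightarrow> - 0 / (2 * n)) at_top"
      using n by (intro tendsto_intros) auto
    then show "((\<lambda>t. - exp (- 2 * t * n) / (2 * n)) \<longlongrightarrow> 0) at_top" by (simp add: mult_ac)
  qed auto
  finally show ?thesis by simp
qed

lemma integrable_exp_neg_abs: fixes b :: real assumes "0 < b" shows "integrable lborel (\<lambda>t::real. exp (- b * \<bar>t\<bar>))"
proof (rule integrableI_nonneg)
  have "(\<integral>\<^sup>+t. ennreal (exp (- b * \<bar>t\<bar>)) \<partial>lborel) \<le>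
     (\<integral>\<^sup>+t. indicator {t. - 1 < 1 * t} t * ennreal (exp (- 2 * 1 * t * (b/2))) + indicator {t. - 1 < (-1) * t} t * ennreal (exp (- 2 * (-1) * t * (b/2))) \<partial>lborel)"
    by (intro nn_integral_mono) (auto simp: indicator_def abs_real_def mult.commute)
  also have "\<dots> = (\<integral>\<^sup>+t. indicator {t. - 1 < 1 * t} t * ennreal (exp (- 2 * 1 * t * (b/2))) \<partial>lborel)
      + (\<integral>\<^sup>+t. indicator {t. - 1 < (-1) * t} t * ennreal (exp (- 2 * (-1) * t * (b/2))) \<partial>lborel)"
    by (rule nn_integral_add) auto
  also have "\<dots> < \<infinity>"
    using assms nn_integral_exp_halfline[of "b/2" 1 1] nn_integral_exp_halfline[of "b/2" "-1" 1] by simp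
  finally show "(\<integral>\<^sup>+t. ennreal (exp (- b * \<bar>t\<bar>)) \<partial>lborel) < \<infinity>" .
qed auto

lemma integrable_exp_vnorm:
  assumes c: "0 < c" shows "integrable (Mxi m) (\<lambda>\<xi>. exp (- c * vnorm m \<xi>))"
proof -
  interpret product_sigma_finite "\<lambda>_::nat. lborel :: real measure" ..
  \<comment> \<open>The sum of the \<open>\<bar>\<xi> j\<bar>\<close> is at most
    \<open>m * vnorm m \<xi>\<close>, so this rate in every coordinate is slow enough; the added 1
    keeps the denominator positive.\<close>
  let ?b = "c / (real m + 1)"
  have b: "0 < ?b" using c by simp
  have "integrable (Mxi m) (\<lambda>\<xi>. \<Prod>j\<in>{1..m}. exp (- ?b * \<bar>\<xi> j\<bar>))"
    unfolding Mxi_def by (rule product_integrable_prod) (use integrable_exp_neg_abs[OF b] in auto)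
  then show ?thesis
  proof (rule Bochner_Integration.integrable_bound)
    show "AE \<xi> in Mxi m. norm (exp (- c * vnorm m \<xi>)) \<le> norm (\<Prod>j\<in>{1..m}. exp (- ?b * \<bar>\<xi> j\<bar>))"
    proof (intro AE_I2)
      fix \<xi>
      have "(\<Sum>j\<in>{1..m}. \<bar>\<xi> j\<bar>) \<le> (\<Sum>j\<in>{1..m}. vnorm m \<xi>)"
        by (intro sum_mono abs_component_le_vnorm)
      also have "\<dots> \<le> (real m + 1) * vnorm m \<xi>" by (simp add: algebra_simps)
      finally have "?b * (\<Sum>j\<in>{1..m}. \<bar>\<xi> j\<bar>) \<le> ?b * ((real m + 1) * vnorm m \<xi>)"
        using b by (intro mult_left_mono) auto
      then have "?b * (\<Sum>j\<in>{1..m}. \<bar>\<xi> j\<bar>) \<le> c * vnorm m \<xi>" by simp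
      moreover have "(\<Prod>j\<in>{1..m}. exp (- ?b * \<bar>\<xi> j\<bar>)) = exp (- (?b * (\<Sum>j\<in>{1..m}. \<bar>\<xi> j\<bar>)))"
        by (simp add: exp_sum[symmetric] sum_distrib_left sum_negf)
      ultimately show "norm (exp (- c * vnorm m \<xi>)) \<le> norm (\<Prod>j\<in>{1..m}. exp (- ?b * \<bar>\<xi> j\<bar>))" by simp
    qed
  qed measurable
qed

section \<open>Symbols of exponential decay\<close>

lemma mult_exp_neg_le: fixes c n :: real assumes "0 < c" "0 \<le> n" shows "n \<le> exp (c * n) / c"
proof -
  have "c * n \<le> exp (c * n)" using exp_ge_add_one_self[of "c * n"] by linarith
  then show ?thesis using assms by (simp add: le_divide_eq mult.commute)
qed

text \<open>Differentiating the representing integral multiplies the symbol by factors of size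
  \<open>vnorm m \<xi>\<close>. Allowing an arbitrarily small loss \<open>\<delta>\<close> in the
  rate makes the class stable under such factors.\<close>

definition exp_integrable :: "nat \<Rightarrow> real \<Rightarrow> ((nat \<Rightarrow> real) \<Rightarrow> complex) \<Rightarrow> bool" where
  "exp_integrable m a w \<longleftrightarrow> w \<in> borel_measurable (Mxi m) \<and>
     (\<forall>\<delta>>0. integrable (Mxi m) (\<lambda>\<xi>. exp ((a - \<delta>) * vnorm m \<xi>) * cmod (w \<xi>)))"

text \<open>Half of the loss \<open>\<delta>\<close> pays for the factor, since \<open>vnorm m \<xi>
  \<le> exp (\<delta>/2 * vnorm m \<xi>) / (\<delta>/2)\<close>.\<close>

lemma exp_integrable_vnorm_mult:
  assumes w: "exp_integrable m a w" and [measurable]: "b \<in> borel_measurable (Mxi m)"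
    and b: "\<And>\<xi>. cmod (b \<xi>) \<le> vnorm m \<xi>"
  shows "exp_integrable m a (\<lambda>\<xi>. b \<xi> * w \<xi>)"
  unfolding exp_integrable_def
proof (intro conjI allI impI)
  have [measurable]: "w \<in> borel_measurable (Mxi m)" using w by (simp add: exp_integrable_def)
  show "(\<lambda>\<xi>. b \<xi> * w \<xi>) \<in> borel_measurable (Mxi m)" by measurable
  fix \<delta> :: real assume d: "0 < \<delta>"
  have "integrable (Mxi m) (\<lambda>\<xi>. 2 / \<delta> * (exp ((a - \<delta>/2) * vnorm m \<xi>) * cmod (w \<xi>)))"
    using w d by (simp add: exp_integrable_def)
  then show "integrable (Mxi m) (\<lambda>\<xi>. exp ((a - \<delta>) * vnorm m \<xi>) * cmod (b \<xi> * w \<xi>))"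
  proof (rule Bochner_Integration.integrable_bound)
    show "AE \<xi> in Mxi m. norm (exp ((a - \<delta>) * vnorm m \<xi>) * cmod (b \<xi> * w \<xi>))
       \<le> norm (2 / \<delta> * (exp ((a - \<delta>/2) * vnorm m \<xi>) * cmod (w \<xi>)))"
    proof (intro AE_I2)
      fix \<xi>
      let ?n = "vnorm m \<xi>"
      have "cmod (b \<xi>) \<le> exp (\<delta>/2 * ?n) / (\<delta>/2)"
        using mult_exp_neg_le[of "\<delta>/2" ?n] d b[of \<xi>] by simp
      then have "exp ((a - \<delta>) * ?n) * (cmod (b \<xi>) * cmod (w \<xi>)) \<le> exp ((a - \<delta>) * ?n) * (exp (\<delta>/2 * ?n) / (\<delta>/2) * cmod (w \<xi>))"
        by (intro mult_left_mono mult_right_mono) auto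
      also have "\<dots> = 2 / \<delta> * ((exp ((a - \<delta>) * ?n) * exp (\<delta>/2 * ?n)) * cmod (w \<xi>))" by simp
      also have "exp ((a - \<delta>) * ?n) * exp (\<delta>/2 * ?n) = exp ((a - \<delta>/2) * ?n)"
        by (simp add: exp_add[symmetric] algebra_simps)
      finally show "norm (exp ((a - \<delta>) * ?n) * cmod (b \<xi> * w \<xi>)) \<le> norm (2 / \<delta> * (exp ((a - \<delta>/2) * ?n) * cmod (w \<xi>)))"
        using d by (simp add: norm_mult)
    qed
  qed measurable
qed

text \<open>Cauchy-Schwarz in pointwise form: the integrand is \<open>p * q\<close>, where
  \<open>p\<^sup>2\<close> is the given weighted square and \<open>q\<^sup>2\<close> decays
  exponentially, and \<open>p\<^sup>2 + q\<^sup>2\<close> is an integrable majorant.\<close>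

lemma exp_integrable_of_weight:
  assumes m: "1 \<le> m" and [measurable]: "w \<in> borel_measurable (Mxi m)"
    and fin: "(\<integral>\<^sup>+\<xi>. ennreal (exp (2 * a * vnorm m \<xi>) * (cmod (w \<xi>))\<^sup>2 / (2 * vnorm m \<xi>)) \<partial>Mxi m) < \<infinity>"
  shows "exp_integrable m a w"
  unfolding exp_integrable_def
proof (intro conjI allI impI)
  fix \<delta> :: real assume d: "0 < \<delta>"
  have 1: "integrable (Mxi m) (\<lambda>\<xi>. exp (2 * a * vnorm m \<xi>) * (cmod (w \<xi>))\<^sup>2 / (2 * vnorm m \<xi>))"
    using fin by (intro integrableI_nonneg) auto
  have "integrable (Mxi m) (\<lambda>\<xi>. exp (2 * a * vnorm m \<xi>) * (cmod (w \<xi>))\<^sup>2 / (2 * vnorm m \<xi>) + 2 / \<delta> * exp (- \<delta> * vnorm m \<xi>))"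
    by (intro Bochner_Integration.integrable_add 1 integrable_mult_right integrable_exp_vnorm d)
  then show "integrable (Mxi m) (\<lambda>\<xi>. exp ((a - \<delta>) * vnorm m \<xi>) * cmod (w \<xi>))"
  proof (rule Bochner_Integration.integrable_bound)
    show "AE \<xi> in Mxi m. norm (exp ((a - \<delta>) * vnorm m \<xi>) * cmod (w \<xi>)) \<le>
      norm (exp (2 * a * vnorm m \<xi>) * (cmod (w \<xi>))\<^sup>2 / (2 * vnorm m \<xi>) + 2 / \<delta> * exp (- \<delta> * vnorm m \<xi>))"
      using AE_vnorm_nonzero[OF m]
    proof eventually_elim
      case (elim \<xi>)
      let ?n = "vnorm m \<xi>" and ?z = "cmod (w \<xi>)"
      have n: "0 < ?n" using elim vnorm_nonneg[of m \<xi>] by linarith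
      define p where "p = exp (a * ?n) * ?z / sqrt (2 * ?n)"
      define q where "q = sqrt (2 * ?n) * exp (- \<delta> * ?n)"
      have "exp ((a - \<delta>) * ?n) * ?z = p * q"
        using n by (simp add: p_def q_def left_diff_distrib exp_diff exp_minus field_simps)
      also have "\<dots> \<le> p\<^sup>2 + q\<^sup>2" using sum_squares_bound[of p q] zero_le_power2[of p] zero_le_power2[of q]
        by linarith
      also have "p\<^sup>2 = exp (2 * a * ?n) * ?z\<^sup>2 / (2 * ?n)"
        using n by (simp add: p_def power_mult_distrib power_divide exp_double[symmetric] mult.assoc)
      also have "q\<^sup>2 = 2 * ?n * exp (- 2 * \<delta> * ?n)"
        using n by (simp add: q_def power_mult_distrib exp_double[symmetric] mult.assoc)
      also have "\<dots> \<le> 2 * (exp (\<delta> * ?n) / \<delta>) * exp (- 2 * \<delta> * ?n)"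
        using mult_exp_neg_le[of \<delta> ?n] d n by (intro mult_right_mono) auto
      also have "\<dots> = 2 / \<delta> * (exp (\<delta> * ?n) * exp (- 2 * \<delta> * ?n))" by simp
      also have "exp (\<delta> * ?n) * exp (- 2 * \<delta> * ?n) = exp (- \<delta> * ?n)"
        by (simp add: exp_add[symmetric] algebra_simps)
      finally show ?case using d n by (simp add: abs_mult)
    qed
  qed measurable
qed fact

text \<open>By \<open>cl_mult_ekernel\<close> each coefficient of the integral in the theorem has
  this form, with \<open>w\<close> a coefficient of
  \<open>chi_mult m \<epsilon> \<xi> (g \<xi>)\<close>.\<close>

definition wave :: "nat \<Rightarrow> real \<Rightarrow> ((nat \<Rightarrow> real) \<Rightarrow> complex) \<Rightarrow> (nat \<Rightarrow> real) \<Rightarrow> complex" where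
  "wave m \<epsilon> w x = (\<integral>\<xi>. cis (vinner m x \<xi>) * (complex_of_real (exp (- \<epsilon> * x 0 * vnorm m \<xi>)) * w \<xi>) \<partial>Mxi m)"

section \<open>Continuity and derivatives of the representing integral\<close>

lemma measurable_vinner_right [measurable]: "vinner m x \<in> borel_measurable (Mxi m)"
  unfolding vinner_def[abs_def] by measurable

lemma wave_integrand_bound:
  assumes "- a + \<delta> \<le> \<epsilon> * x 0"
  shows "cmod (cis (vinner m x \<xi>) * (complex_of_real (exp (- \<epsilon> * x 0 * vnorm m \<xi>)) * w \<xi>))
     \<le> exp ((a - \<delta>) * vnorm m \<xi>) * cmod (w \<xi>)"
proof -
  have "- \<epsilon> * x 0 * vnorm m \<xi> \<le> (a - \<delta>) * vnorm m \<xi>" using assms by (intro mult_right_mono) auto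
  then show ?thesis by (simp add: norm_mult mult_right_mono)
qed

lemma wave_integrable:
  assumes w: "exp_integrable m a w" and x: "- a < \<epsilon> * x 0"
  shows "integrable (Mxi m) (\<lambda>\<xi>. cis (vinner m x \<xi>) * (complex_of_real (exp (- \<epsilon> * x 0 * vnorm m \<xi>)) * w \<xi>))"
proof (rule Bochner_Integration.integrable_bound)
  have [measurable]: "w \<in> borel_measurable (Mxi m)" using w by (simp add: exp_integrable_def)
  show "integrable (Mxi m) (\<lambda>\<xi>. exp ((a - (\<epsilon> * x 0 + a)) * vnorm m \<xi>) * cmod (w \<xi>))"
    using w x unfolding exp_integrable_def by (elim conjE allE[of _ "\<epsilon> * x 0 + a"]) auto
  show "AE \<xi> in Mxi m. norm (cis (vinner m x \<xi>) * (complex_of_real (exp (- \<epsilon> * x 0 * vnorm m \<xi>)) * w \<xi>))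
     \<le> norm (exp ((a - (\<epsilon> * x 0 + a)) * vnorm m \<xi>) * cmod (w \<xi>))"
    using wave_integrand_bound[of a "\<epsilon> * x 0 + a" \<epsilon> x m _ w] by (intro AE_I2) simp
  show "(\<lambda>\<xi>. cis (vinner m x \<xi>) * (complex_of_real (exp (- \<epsilon> * x 0 * vnorm m \<xi>)) * w \<xi>)) \<in> borel_measurable (Mxi m)"
    by measurable
qed

lemma wave_continuous:
  assumes w: "exp_integrable m a w"
  shows "continuous_on {x. - a < \<epsilon> * x 0} (wave m \<epsilon> w)"
  unfolding continuous_on_sequentially
proof (intro allI ballI impI)
  have [measurable]: "w \<in> borel_measurable (Mxi m)" using w by (simp add: exp_integrable_def)
  fix y :: "nat \<Rightarrow> nat \<Rightarrow> real" and x :: "nat \<Rightarrow> real"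
  assume x: "x \<in> {x. - a < \<epsilon> * x 0}" and y: "(\<forall>n. y n \<in> {x. - a < \<epsilon> * x 0}) \<and> y \<longlonglongrightarrow> x"
  have yc: "(\<lambda>n. y n j) \<longlonglongrightarrow> x j" for j
    using y continuous_on_tendsto_compose[OF continuous_on_product_coordinates[of j], of y x sequentially] by auto
  \<comment> \<open>Half the distance of \<open>x\<close> from the boundary: one majorant then
    serves all points near \<open>x\<close>.\<close>
  define \<delta> where "\<delta> = (\<epsilon> * x 0 + a) / 2"
  have d: "0 < \<delta>" using x by (simp add: \<delta>_def)
  have "(\<lambda>n. \<epsilon> * y n 0) \<longlonglongrightarrow> \<epsilon> * x 0" by (intro tendsto_intros yc)
  then have "eventually (\<lambda>n. - a + \<delta> < \<epsilon> * y n 0) sequentially"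
    by (rule order_tendstoD) (use x in \<open>simp add: \<delta>_def field_simps\<close>)
  then obtain K where K: "\<And>n. n \<ge> K \<Longrightarrow> - a + \<delta> < \<epsilon> * y n 0" by (auto simp: eventually_sequentially)
  have "(\<lambda>n. wave m \<epsilon> w (y (n + K))) \<longlonglongrightarrow> wave m \<epsilon> w x"
    unfolding wave_def
  proof (rule integral_dominated_convergence[where w="\<lambda>\<xi>. exp ((a - \<delta>) * vnorm m \<xi>) * cmod (w \<xi>)"])
    show "integrable (Mxi m) (\<lambda>\<xi>. exp ((a - \<delta>) * vnorm m \<xi>) * cmod (w \<xi>))"
      using w d by (simp add: exp_integrable_def)
    show "AE \<xi> in Mxi m. norm (cis (vinner m (y (n + K)) \<xi>) * (complex_of_real (exp (- \<epsilon> * y (n + K) 0 * vnorm m \<xi>)) * w \<xi>))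
       \<le> exp ((a - \<delta>) * vnorm m \<xi>) * cmod (w \<xi>)" for n
      using K[of "n + K"] by (intro AE_I2 wave_integrand_bound) simp
    show "AE \<xi> in Mxi m. (\<lambda>n. cis (vinner m (y (n + K)) \<xi>) * (complex_of_real (exp (- \<epsilon> * y (n + K) 0 * vnorm m \<xi>)) * w \<xi>))
       \<longlonglongrightarrow> cis (vinner m x \<xi>) * (complex_of_real (exp (- \<epsilon> * x 0 * vnorm m \<xi>)) * w \<xi>)"
    proof (intro AE_I2)
      fix \<xi>
      have "(\<lambda>n. cis (vinner m (y n) \<xi>) * (complex_of_real (exp (- \<epsilon> * y n 0 * vnorm m \<xi>)) * w \<xi>))
       \<longlonglongrightarrow> cis (vinner m x \<xi>) * (complex_of_real (exp (- \<epsilon> * x 0 * vnorm m \<xi>)) * w \<xi>)"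
        unfolding vinner_def
        by (intro tendsto_intros yc continuous_on_tendsto_compose[OF continuous_on_cis[OF continuous_on_id[of UNIV]]]) auto
      then show "(\<lambda>n. cis (vinner m (y (n + K)) \<xi>) * (complex_of_real (exp (- \<epsilon> * y (n + K) 0 * vnorm m \<xi>)) * w \<xi>))
       \<longlonglongrightarrow> cis (vinner m x \<xi>) * (complex_of_real (exp (- \<epsilon> * x 0 * vnorm m \<xi>)) * w \<xi>)"
        by (rule LIMSEQ_ignore_initial_segment)
    qed
  qed measurable
  then show "(wave m \<epsilon> w \<circ> y) \<longlonglongrightarrow> wave m \<epsilon> w x"
    unfolding comp_def by (rule LIMSEQ_offset)
qed

lemma has_vector_derivative_cis_linear:
  "((\<lambda>t. cis (c + t * b)) has_vector_derivative \<i> * complex_of_real b * cis (c + t * b)) (at t)"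
proof -
  have "((\<lambda>t. c + t * b) has_derivative (\<lambda>h. h * b)) (at t)" by (auto intro!: derivative_eq_intros)
  from has_derivative_cis[OF this] show ?thesis
    by (simp add: has_vector_derivative_def scaleR_conv_of_real mult_ac)
qed

lemma has_vector_derivative_exp_linear:
  "((\<lambda>t. complex_of_real (exp (b * t))) has_vector_derivative complex_of_real (b * exp (b * t))) (at t)"
  by (intro has_vector_derivative_of_real) (auto intro!: derivative_eq_intros)

lemma wave_derivative_0:
  assumes w: "exp_integrable m a w" and eps: "\<bar>\<epsilon>\<bar> = 1" and x: "- a < \<epsilon> * x 0"
  shows "((\<lambda>t. wave m \<epsilon> w (x(0 := t))) has_vector_derivative wave m \<epsilon> (\<lambda>\<xi>. complex_of_real (- \<epsilon> * vnorm m \<xi>) * w \<xi>) x) (at (x 0))"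
proof -
  have [measurable]: "w \<in> borel_measurable (Mxi m)" using w by (simp add: exp_integrable_def)
  let ?w' = "\<lambda>\<xi>. complex_of_real (- \<epsilon> * vnorm m \<xi>) * w \<xi>"
  have w': "exp_integrable m a ?w'"
    by (rule exp_integrable_vnorm_mult[OF w]) (use eps in \<open>auto simp: norm_mult\<close>)
  define \<delta> where "\<delta> = (\<epsilon> * x 0 + a) / 2"
  have d: "0 < \<delta>" using x by (simp add: \<delta>_def)
  have close: "- a + \<delta> \<le> \<epsilon> * t" if "\<bar>t - x 0\<bar> < \<delta>" for t
  proof -
    have "\<bar>\<epsilon> * (t - x 0)\<bar> < \<delta>" using that eps by (simp add: abs_mult)
    then have "\<epsilon> * x 0 - \<delta> < \<epsilon> * t" by (simp add: right_diff_distrib)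
    then show ?thesis by (simp add: \<delta>_def field_simps)
  qed
  have vi: "vinner m (x(0 := t)) \<xi> = vinner m x \<xi>" for t \<xi> by (auto simp: vinner_def intro!: sum.cong)
  have "((\<lambda>t. wave m \<epsilon> w (x(0 := t))) has_vector_derivative
     (\<integral>\<xi>. cis (vinner m (x(0 := x 0)) \<xi>) * (complex_of_real (exp (- \<epsilon> * (x(0 := x 0)) 0 * vnorm m \<xi>)) * ?w' \<xi>) \<partial>Mxi m)) (at (x 0))"
    unfolding wave_def
  proof (rule has_vector_derivative_integral[OF d])
    fix t assume t: "\<bar>t - x 0\<bar> < \<delta>"
    show "integrable (Mxi m) (\<lambda>\<xi>. cis (vinner m (x(0 := t)) \<xi>) * (complex_of_real (exp (- \<epsilon> * (x(0 := t)) 0 * vnorm m \<xi>)) * w \<xi>))"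
      by (rule wave_integrable[OF w]) (use close[OF t] d in auto)
    fix \<xi>
    show "((\<lambda>t. cis (vinner m (x(0 := t)) \<xi>) * (complex_of_real (exp (- \<epsilon> * (x(0 := t)) 0 * vnorm m \<xi>)) * w \<xi>)) has_vector_derivative
       cis (vinner m (x(0 := t)) \<xi>) * (complex_of_real (exp (- \<epsilon> * (x(0 := t)) 0 * vnorm m \<xi>)) * ?w' \<xi>)) (at t)"
      unfolding vi
      using has_vector_derivative_mult_right[OF has_vector_derivative_mult_left[OF has_vector_derivative_exp_linear[of "- \<epsilon> * vnorm m \<xi>" t]], of "cis (vinner m x \<xi>)" "w \<xi>"]
      by (simp add: mult_ac)
    show "cmod (cis (vinner m (x(0 := t)) \<xi>) * (complex_of_real (exp (- \<epsilon> * (x(0 := t)) 0 * vnorm m \<xi>)) * ?w' \<xi>))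
       \<le> exp ((a - \<delta>) * vnorm m \<xi>) * cmod (?w' \<xi>)"
      by (rule wave_integrand_bound) (use close[OF t] in simp)
  next
    show "integrable (Mxi m) (\<lambda>\<xi>. exp ((a - \<delta>) * vnorm m \<xi>) * cmod (?w' \<xi>))"
      using w' d by (simp add: exp_integrable_def)
  qed measurable
  then show ?thesis by (simp add: wave_def)
qed

lemma wave_derivative_k:
  assumes w: "exp_integrable m a w" and k: "k \<in> {1..m}" and x: "- a < \<epsilon> * x 0"
  shows "((\<lambda>t. wave m \<epsilon> w (x(k := t))) has_vector_derivative wave m \<epsilon> (\<lambda>\<xi>. \<i> * complex_of_real (\<xi> k) * w \<xi>) x) (at (x k))"
proof -
  have [measurable]: "w \<in> borel_measurable (Mxi m)" using w by (simp add: exp_integrable_def)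
  have [measurable]: "(\<lambda>\<xi>. \<xi> k) \<in> borel_measurable (Mxi m)" using k by measurable
  let ?w' = "\<lambda>\<xi>. \<i> * complex_of_real (\<xi> k) * w \<xi>"
  have w': "exp_integrable m a ?w'"
    by (rule exp_integrable_vnorm_mult[OF w]) (use abs_component_le_vnorm[OF k] in \<open>auto simp: norm_mult\<close>)
  define \<delta> where "\<delta> = \<epsilon> * x 0 + a"
  have d: "0 < \<delta>" using x by (simp add: \<delta>_def)
  have x0: "(x(k := t)) 0 = x 0" for t using k by simp
  have vi: "vinner m (x(k := t)) \<xi> = (vinner m x \<xi> - x k * \<xi> k) + t * \<xi> k" for t \<xi>
    using k unfolding vinner_def by (subst (1 2) sum.remove[of _ k]) auto
  have "((\<lambda>t. wave m \<epsilon> w (x(k := t))) has_vector_derivative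
     (\<integral>\<xi>. cis (vinner m (x(k := x k)) \<xi>) * (complex_of_real (exp (- \<epsilon> * (x(k := x k)) 0 * vnorm m \<xi>)) * ?w' \<xi>) \<partial>Mxi m)) (at (x k))"
    unfolding wave_def
  proof (rule has_vector_derivative_integral[OF d])
    fix t
    show "integrable (Mxi m) (\<lambda>\<xi>. cis (vinner m (x(k := t)) \<xi>) * (complex_of_real (exp (- \<epsilon> * (x(k := t)) 0 * vnorm m \<xi>)) * w \<xi>))"
      by (rule wave_integrable[OF w]) (use x x0 in auto)
    fix \<xi>
    show "((\<lambda>t. cis (vinner m (x(k := t)) \<xi>) * (complex_of_real (exp (- \<epsilon> * (x(k := t)) 0 * vnorm m \<xi>)) * w \<xi>)) has_vector_derivative
       cis (vinner m (x(k := t)) \<xi>) * (complex_of_real (exp (- \<epsilon> * (x(k := t)) 0 * vnorm m \<xi>)) * ?w' \<xi>)) (at t)"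
      unfolding vi x0
      using has_vector_derivative_mult_left[OF has_vector_derivative_cis_linear[of "vinner m x \<xi> - x k * \<xi> k" "\<xi> k" t], of "complex_of_real (exp (- \<epsilon> * x 0 * vnorm m \<xi>)) * w \<xi>"]
      by (simp add: mult_ac)
    show "cmod (cis (vinner m (x(k := t)) \<xi>) * (complex_of_real (exp (- \<epsilon> * (x(k := t)) 0 * vnorm m \<xi>)) * ?w' \<xi>))
       \<le> exp ((a - \<delta>) * vnorm m \<xi>) * cmod (?w' \<xi>)"
      by (rule wave_integrand_bound) (use k in \<open>simp add: \<delta>_def\<close>)
  next
    show "integrable (Mxi m) (\<lambda>\<xi>. exp ((a - \<delta>) * vnorm m \<xi>) * cmod (?w' \<xi>))"
      using w' d by (simp add: exp_integrable_def)
  qed measurable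
  then show ?thesis by (simp add: wave_def)
qed

section \<open>Integration over the half space by slices\<close>

lemma nn_integral_Mx:
  assumes "F \<in> borel_measurable (Mx m)"
  shows "(\<integral>\<^sup>+x. F x \<partial>Mx m) = (\<integral>\<^sup>+t. (\<integral>\<^sup>+y. F (y(0 := t)) \<partial>Mxi m) \<partial>lborel)"
proof -
  interpret product_sigma_finite "\<lambda>_::nat. lborel :: real measure" ..
  have eq: "{0..m} = insert 0 {1..m}" by auto
  have F: "F \<in> borel_measurable (Pi\<^sub>M (insert 0 {1..m}) (\<lambda>_. lborel))" using assms by (simp only: Mx_def eq)
  show ?thesis
    unfolding Mx_def eq Mxi_def by (rule product_nn_integral_insert_rev[OF _ _ F]) auto
qed

lemma measurable_Mx_update [measurable]: "(\<lambda>(t, y). y(0 := t)) \<in> measurable (lborel \<Otimes>\<^sub>M Mxi m) (Mx m)"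
proof -
  have eq: "{0..m} = insert 0 {1..m}" by auto
  have "(\<lambda>p. (snd p, fst p)) \<in> measurable (lborel \<Otimes>\<^sub>M Mxi m) (Mxi m \<Otimes>\<^sub>M lborel)" by measurable
  from measurable_compose[OF this[unfolded Mxi_def] measurable_add_dim[of 0 "{1..m}" "\<lambda>_. lborel :: real measure"]]
  show ?thesis by (simp add: Mx_def eq Mxi_def case_prod_beta' del: atLeastAtMost_insertL)
qed

lemma halfspace_eq: "halfspace m \<epsilon> a = {x \<in> PiE {0..m} (\<lambda>_. UNIV). x \<in> {x. - a < \<epsilon> * x 0}}"
  by (auto simp: halfspace_def Rm1_def)

lemma open_half: "open {x :: nat \<Rightarrow> real. - a < \<epsilon> * x 0}"
  by (intro open_Collect_less continuous_intros continuous_on_component)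

lemma measurable_halfspace_function:
  fixes \<phi> :: "(nat \<Rightarrow> real) \<Rightarrow> complex"
  assumes "continuous_on (halfspace m \<epsilon> a) \<phi>"
  shows "(\<lambda>x. indicator (halfspace m \<epsilon> a) x *\<^sub>R \<phi> x) \<in> borel_measurable (Mx m)"
proof -
  have "(\<lambda>x. indicator {x. - a < \<epsilon> * x 0} x *\<^sub>R \<phi> x) \<in> borel_measurable (Mx m)"
    unfolding Mx_def
    by (rule borel_measurable_continuous_on_PiM) (use assms open_half in \<open>auto simp: halfspace_eq\<close>)
  then show ?thesis
    by (rule measurable_cong[THEN iffD1, rotated])
       (auto simp: halfspace_eq Mx_def space_PiM indicator_def)
qed

lemma update_in_halfspace:
  "y \<in> space (Mxi m) \<Longrightarrow> y(0 := t) \<in> halfspace m \<epsilon> a \<longleftrightarrow> - a < \<epsilon> * t"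
  by (auto simp: halfspace_def Rm1_def space_Mxi PiE_def extensional_def)

lemma nn_integral_halfspace:
  fixes \<phi> :: "(nat \<Rightarrow> real) \<Rightarrow> complex"
  assumes cont: "continuous_on (halfspace m \<epsilon> a) \<phi>"
  shows "(\<integral>\<^sup>+x. ennreal ((cmod (\<phi> x))\<^sup>2) * indicator (halfspace m \<epsilon> a) x \<partial>Mx m)
    = (\<integral>\<^sup>+t. indicator {t. - a < \<epsilon> * t} t * l2 m (\<lambda>y. \<phi> (y(0 := t))) \<partial>lborel)"
proof -
  have [measurable]: "(\<lambda>x. indicator (halfspace m \<epsilon> a) x *\<^sub>R \<phi> x) \<in> borel_measurable (Mx m)"
    by (rule measurable_halfspace_function[OF cont])
  have eq: "ennreal ((cmod (\<phi> x))\<^sup>2) * indicator (halfspace m \<epsilon> a) x = ennreal ((cmod (indicator (halfspace m \<epsilon> a) x *\<^sub>R \<phi> x))\<^sup>2)" for x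
    by (simp add: indicator_def)
  have "(\<integral>\<^sup>+x. ennreal ((cmod (\<phi> x))\<^sup>2) * indicator (halfspace m \<epsilon> a) x \<partial>Mx m)
     = (\<integral>\<^sup>+t. (\<integral>\<^sup>+y. ennreal ((cmod (\<phi> (y(0 := t))))\<^sup>2) * indicator (halfspace m \<epsilon> a) (y(0 := t)) \<partial>Mxi m) \<partial>lborel)"
    by (rule nn_integral_Mx) (unfold eq, measurable)
  also have "\<dots> = (\<integral>\<^sup>+t. indicator {t. - a < \<epsilon> * t} t * l2 m (\<lambda>y. \<phi> (y(0 := t))) \<partial>lborel)"
  proof (rule nn_integral_cong)
    fix t
    have "(\<integral>\<^sup>+y. ennreal ((cmod (\<phi> (y(0 := t))))\<^sup>2) * indicator (halfspace m \<epsilon> a) (y(0 := t)) \<partial>Mxi m)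
       = (\<integral>\<^sup>+y. (if - a < \<epsilon> * t then ennreal ((cmod (\<phi> (y(0 := t))))\<^sup>2) else 0) \<partial>Mxi m)"
      by (intro nn_integral_cong) (simp add: indicator_def update_in_halfspace)
    then show "(\<integral>\<^sup>+y. ennreal ((cmod (\<phi> (y(0 := t))))\<^sup>2) * indicator (halfspace m \<epsilon> a) (y(0 := t)) \<partial>Mxi m)
       = indicator {t. - a < \<epsilon> * t} t * l2 m (\<lambda>y. \<phi> (y(0 := t)))"
      by (simp add: l2_def indicator_def)
  qed
  finally show ?thesis .
qed

text \<open>The whole computation takes place on the frequency side, so it is an exact identity.
  Read in one direction it bounds the norm of the synthesised function, in the other it yields the
  weight condition.\<close>

lemma weight_Tonelli:
  assumes m: "1 \<le> m" and eps: "\<epsilon> = 1 \<or> \<epsilon> = - 1" and [measurable]: "w \<in> borel_measurable (Mxi m)"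
  shows "(\<integral>\<^sup>+t. indicator {t. - a < \<epsilon> * t} t * l2 m (\<lambda>\<xi>. complex_of_real (exp (- \<epsilon> * t * vnorm m \<xi>)) * w \<xi>) \<partial>lborel)
     = (\<integral>\<^sup>+\<xi>. ennreal (exp (2 * a * vnorm m \<xi>) * (cmod (w \<xi>))\<^sup>2 / (2 * vnorm m \<xi>)) \<partial>Mxi m)"
proof -
  interpret M: sigma_finite_measure "Mxi m" by (rule sigma_finite_Mxi)
  interpret pair_sigma_finite lborel "Mxi m" ..
  let ?I = "\<lambda>t. indicator {t. - a < \<epsilon> * t} t :: ennreal"
  have [measurable]: "?I \<in> borel_measurable borel" by measurable
  have "?I t * l2 m (\<lambda>\<xi>. complex_of_real (exp (- \<epsilon> * t * vnorm m \<xi>)) * w \<xi>)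
     = (\<integral>\<^sup>+\<xi>. ?I t * ennreal (exp (- 2 * \<epsilon> * t * vnorm m \<xi>)) * ennreal ((cmod (w \<xi>))\<^sup>2) \<partial>Mxi m)" for t
  proof -
    have "ennreal ((cmod (complex_of_real (exp (- \<epsilon> * t * vnorm m \<xi>)) * w \<xi>))\<^sup>2)
       = ennreal (exp (- 2 * \<epsilon> * t * vnorm m \<xi>)) * ennreal ((cmod (w \<xi>))\<^sup>2)" for \<xi>
      by (simp add: norm_mult power_mult_distrib exp_double[symmetric] mult.assoc flip: ennreal_mult')
    then show ?thesis unfolding l2_def by (simp add: nn_integral_cmult mult.assoc)
  qed
  then have "(\<integral>\<^sup>+t. ?I t * l2 m (\<lambda>\<xi>. complex_of_real (exp (- \<epsilon> * t * vnorm m \<xi>)) * w \<xi>) \<partial>lborel)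
     = (\<integral>\<^sup>+t. (\<integral>\<^sup>+\<xi>. ?I t * ennreal (exp (- 2 * \<epsilon> * t * vnorm m \<xi>)) * ennreal ((cmod (w \<xi>))\<^sup>2) \<partial>Mxi m) \<partial>lborel)"
    by simp
  also have "\<dots> = (\<integral>\<^sup>+\<xi>. (\<integral>\<^sup>+t. ?I t * ennreal (exp (- 2 * \<epsilon> * t * vnorm m \<xi>)) * ennreal ((cmod (w \<xi>))\<^sup>2) \<partial>lborel) \<partial>Mxi m)"
    by (rule Fubini'[symmetric]) measurable
  also have "\<dots> = (\<integral>\<^sup>+\<xi>. ennreal (exp (2 * a * vnorm m \<xi>) * (cmod (w \<xi>))\<^sup>2 / (2 * vnorm m \<xi>)) \<partial>Mxi m)"
  proof (rule nn_integral_cong_AE)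
    show "AE \<xi> in Mxi m. (\<integral>\<^sup>+t. ?I t * ennreal (exp (- 2 * \<epsilon> * t * vnorm m \<xi>)) * ennreal ((cmod (w \<xi>))\<^sup>2) \<partial>lborel)
       = ennreal (exp (2 * a * vnorm m \<xi>) * (cmod (w \<xi>))\<^sup>2 / (2 * vnorm m \<xi>))"
      using AE_vnorm_nonzero[OF m]
    proof eventually_elim
      case (elim \<xi>)
      then have n: "0 < vnorm m \<xi>" using vnorm_nonneg[of m \<xi>] by linarith
      have "(\<integral>\<^sup>+t. ?I t * ennreal (exp (- 2 * \<epsilon> * t * vnorm m \<xi>)) * ennreal ((cmod (w \<xi>))\<^sup>2) \<partial>lborel)
        = (\<integral>\<^sup>+t. ?I t * ennreal (exp (- 2 * \<epsilon> * t * vnorm m \<xi>)) \<partial>lborel) * ennreal ((cmod (w \<xi>))\<^sup>2)"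
        by (rule nn_integral_multc)
           (intro borel_measurable_times_ennreal measurable_compose[OF _ measurable_ennreal] borel_measurable_exp borel_measurable_times, auto)
      also have "\<dots> = ennreal (exp (2 * a * vnorm m \<xi>) / (2 * vnorm m \<xi>)) * ennreal ((cmod (w \<xi>))\<^sup>2)"
        by (simp only: nn_integral_exp_halfline[OF n eps])
      finally show ?case using n by (simp flip: ennreal_mult')
    qed
  qed
  finally show ?thesis .
qed


section \<open>Sufficiency of the representation\<close>

lemma wave_cong_AE:
  assumes "AE \<xi> in Mxi m. u \<xi> = v \<xi>" "u \<in> borel_measurable (Mxi m)" "v \<in> borel_measurable (Mxi m)"
  shows "wave m \<epsilon> u x = wave m \<epsilon> v x"
  unfolding wave_def
proof (rule integral_cong_AE)
  show "AE \<xi> in Mxi m. cis (vinner m x \<xi>) * (complex_of_real (exp (- \<epsilon> * x 0 * vnorm m \<xi>)) * u \<xi>)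
     = cis (vinner m x \<xi>) * (complex_of_real (exp (- \<epsilon> * x 0 * vnorm m \<xi>)) * v \<xi>)"
    using assms(1) by eventually_elim simp
qed (use assms in measurable)

lemma wave_add:
  assumes "exp_integrable m a u" "exp_integrable m a v" "- a < \<epsilon> * x 0"
  shows "wave m \<epsilon> (\<lambda>\<xi>. u \<xi> + v \<xi>) x = wave m \<epsilon> u x + wave m \<epsilon> v x"
  unfolding wave_def distrib_left
  by (rule Bochner_Integration.integral_add) (rule wave_integrable[where x=x, OF assms(1,3)], rule wave_integrable[where x=x, OF assms(2,3)])

lemma wave_sum:
  assumes "finite K" "\<And>k. k \<in> K \<Longrightarrow> exp_integrable m a (u k)" "- a < \<epsilon> * x 0"
  shows "wave m \<epsilon> (\<lambda>\<xi>. \<Sum>k\<in>K. u k \<xi>) x = (\<Sum>k\<in>K. wave m \<epsilon> (u k) x)"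
  unfolding wave_def sum_distrib_left
  by (rule Bochner_Integration.integral_sum) (rule wave_integrable[where x=x, OF assms(2,3)])

lemma wave_cmult: "wave m \<epsilon> (\<lambda>\<xi>. c * w \<xi>) x = c * wave m \<epsilon> w x"
  unfolding wave_def by (simp flip: integral_mult_right_zero add: mult_ac)

lemma exp_integrable_cmult: "exp_integrable m a w \<Longrightarrow> exp_integrable m a (\<lambda>\<xi>. c * w \<xi>)"
  unfolding exp_integrable_def by (auto simp: norm_mult mult.left_commute)

lemma exp_integrable_sum:
  assumes "finite K" "\<And>k. k \<in> K \<Longrightarrow> exp_integrable m a (u k)"
  shows "exp_integrable m a (\<lambda>\<xi>. \<Sum>k\<in>K. u k \<xi>)"
  unfolding exp_integrable_def
proof (intro conjI allI impI)
  have [measurable]: "k \<in> K \<Longrightarrow> u k \<in> borel_measurable (Mxi m)" for k using assms by (simp add: exp_integrable_def)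
  show "(\<lambda>\<xi>. \<Sum>k\<in>K. u k \<xi>) \<in> borel_measurable (Mxi m)" by measurable
  fix \<delta> :: real assume d: "0 < \<delta>"
  have "integrable (Mxi m) (\<lambda>\<xi>. \<Sum>k\<in>K. exp ((a - \<delta>) * vnorm m \<xi>) * cmod (u k \<xi>))"
    using assms d by (intro Bochner_Integration.integrable_sum) (simp add: exp_integrable_def)
  then show "integrable (Mxi m) (\<lambda>\<xi>. exp ((a - \<delta>) * vnorm m \<xi>) * cmod (\<Sum>k\<in>K. u k \<xi>))"
    by (rule Bochner_Integration.integrable_bound)
       (measurable, auto simp: sum_distrib_left[symmetric] abs_mult intro!: AE_I2 mult_left_mono order_trans[OF norm_sum abs_ge_self])
qed

lemma box_in_halfspace:
  assumes eps: "\<bar>\<epsilon>\<bar> = 1" and x: "x \<in> halfspace m \<epsilon> a"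
  shows "\<exists>r>0. \<forall>y\<in>PiE {0..m} (\<lambda>_. UNIV). (\<forall>j\<in>{0..m}. \<bar>y j - x j\<bar> < r) \<longrightarrow> y \<in> halfspace m \<epsilon> a"
proof (intro exI[of _ "\<epsilon> * x 0 + a"] conjI ballI impI)
  show "0 < \<epsilon> * x 0 + a" using x by (simp add: halfspace_def)
  fix y assume y: "y \<in> PiE {0..m} (\<lambda>_. UNIV)" "\<forall>j\<in>{0..m}. \<bar>y j - x j\<bar> < \<epsilon> * x 0 + a"
  have "\<bar>\<epsilon> * (y 0 - x 0)\<bar> < \<epsilon> * x 0 + a" using y(2) eps by (simp add: abs_mult)
  then have "- a < \<epsilon> * y 0" by (simp add: right_diff_distrib)
  then show "y \<in> halfspace m \<epsilon> a" using y by (simp add: halfspace_def Rm1_def)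
qed

text \<open>Each partial derivative multiplies the symbol by \<open>b k\<close>. On the range of
  \<open>chi_mult\<close> the vector derivatives together act as
  \<open>\<epsilon> * vnorm m \<xi>\<close> by \<open>vec_mult_chi_mult\<close>, which cancels
  \<open>b 0\<close>. The norm is estimated slice by slice with the Bessel inequality and then
  integrated over heights.\<close>

lemma A2_of_representation:
  assumes m: "1 \<le> m" and eps: "\<epsilon> = 1 \<or> \<epsilon> = - 1"
    and g [measurable]: "\<And>T. T \<in> Pow {1..m} \<Longrightarrow> (\<lambda>\<xi>. g \<xi> T) \<in> borel_measurable (Mxi m)"
    and fin: "\<And>T. T \<in> Pow {1..m} \<Longrightarrow>
       (\<integral>\<^sup>+\<xi>. ennreal (exp (2 * a * vnorm m \<xi>) * (cmod (chi_mult m \<epsilon> \<xi> (g \<xi>) T))\<^sup>2 / (2 * vnorm m \<xi>)) \<partial>Mxi m) < \<infinity>"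
    and rep: "\<And>x T. x \<in> halfspace m \<epsilon> a \<Longrightarrow> T \<in> Pow {1..m} \<Longrightarrow>
       f x T = complex_of_real (1 / (2 * pi) ^ m) * wave m \<epsilon> (\<lambda>\<xi>. chi_mult m \<epsilon> \<xi> (g \<xi>) T) x"
  shows "A2 m (halfspace m \<epsilon> a) f"
proof -
  let ?U = "halfspace m \<epsilon> a"
  define w where "w T \<xi> = chi_mult m \<epsilon> \<xi> (g \<xi>) T" for T \<xi>
  define c where "c = complex_of_real (1 / (2 * pi) ^ m)"
  have eps': "\<bar>\<epsilon>\<bar> = 1" "\<epsilon>\<^sup>2 = 1" using eps by auto
  have wm [measurable]: "w T \<in> borel_measurable (Mxi m)" if "T \<in> Pow {1..m}" for T
    unfolding w_def[abs_def] by (rule measurable_chi_mult[OF that]) (use g in measurable)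
  have rep: "f x T = c * wave m \<epsilon> (w T) x" if "x \<in> ?U" "T \<in> Pow {1..m}" for x T
    using rep[OF that] by (simp add: c_def w_def[abs_def])
  have wi: "exp_integrable m a (w T)" if "T \<in> Pow {1..m}" for T
    unfolding w_def[abs_def] by (rule exp_integrable_of_weight[OF m wm[OF that, unfolded w_def[abs_def]] fin[OF that]])
  define b where "b k \<xi> = (if k = 0 then complex_of_real (- \<epsilon> * vnorm m \<xi>) else \<i> * complex_of_real (\<xi> k))" for k :: nat and \<xi>
  have bw: "exp_integrable m a (\<lambda>\<xi>. b k \<xi> * w T \<xi>)" if "T \<in> Pow {1..m}" "k \<in> {0..m}" for T k
  proof (cases "k = 0")
    case True
    then show ?thesis using eps' unfolding b_def by (intro exp_integrable_vnorm_mult[OF wi[OF that(1)]]) (auto simp: norm_mult)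
  next
    case False
    then have k: "k \<in> {1..m}" using that by auto
    then have [measurable]: "(\<lambda>\<xi>. \<xi> k) \<in> borel_measurable (Mxi m)" by measurable
    show ?thesis using False abs_component_le_vnorm[OF k] unfolding b_def
      by (intro exp_integrable_vnorm_mult[OF wi[OF that(1)]]) (auto simp: norm_mult)
  qed
  have xU: "- a < \<epsilon> * x 0" if "x \<in> ?U" for x using that by (simp add: halfspace_def)
  have upd: "x(k := t) \<in> Rm1 m" if "x \<in> ?U" "k \<in> {0..m}" for x k t
    using that by (auto simp: halfspace_def Rm1_def PiE_def extensional_def)
  have deriv: "((\<lambda>t. f (x(k := t)) T) has_vector_derivative c * wave m \<epsilon> (\<lambda>\<xi>. b k \<xi> * w T \<xi>) x) (at (x k))"
    if x: "x \<in> ?U" and T: "T \<in> Pow {1..m}" and k: "k \<in> {0..m}" for x T k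
  proof -
    \<comment> \<open>The parameters for which the displaced point stays in the half space: only
      coordinate 0 is constrained.\<close>
    define S where "S = (if k = 0 then {t. - a < \<epsilon> * t} else UNIV)"
    have S: "open S" "x k \<in> S" using xU[OF x] by (auto simp: S_def intro!: open_Collect_less continuous_intros)
    have inU: "x(k := t) \<in> ?U" if "t \<in> S" for t
      using upd[OF x k, of t] that xU[OF x] by (auto simp: S_def halfspace_def split: if_splits)
    have "((\<lambda>t. wave m \<epsilon> (w T) (x(k := t))) has_vector_derivative wave m \<epsilon> (\<lambda>\<xi>. b k \<xi> * w T \<xi>) x) (at (x k))"
    proof (cases "k = 0")
      case True then show ?thesis unfolding b_def using wave_derivative_0[where x=x, OF wi[OF T] eps'(1) xU[OF x]] by simp
    next
      case False
      then have k1: "k \<in> {1..m}" using k by auto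
      show ?thesis unfolding b_def using wave_derivative_k[where w="w T" and x=x and m=m and k=k, OF wi[OF T] k1 xU[OF x]] False by simp
    qed
    from has_vector_derivative_mult_right[OF this, of c]
    show ?thesis
      by (rule has_vector_derivative_transform_within_open[OF _ S]) (simp add: rep[OF inU T])
  qed
  have pd: "pd f k x T = c * wave m \<epsilon> (\<lambda>\<xi>. b k \<xi> * w T \<xi>) x" if "x \<in> ?U" "T \<in> Pow {1..m}" "k \<in> {0..m}" for x T k
    unfolding pd_def by (rule vector_derivative_at[OF deriv[OF that]])
  have contw: "continuous_on ?U (\<lambda>x. c * wave m \<epsilon> v x)" if "exp_integrable m a v" for v
    by (intro continuous_on_mult_left continuous_on_subset[OF wave_continuous[OF that]]) (auto simp: halfspace_def)
  have "left_monogenic m ?U f"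
    unfolding left_monogenic_def
  proof (intro conjI ballI)
    show "?U \<subseteq> Rm1 m" by (auto simp: halfspace_def)
    have "?U = Rm1 m \<inter> {x. - a < \<epsilon> * x 0}" by (auto simp: halfspace_def)
    then show "openin (top_of_set (Rm1 m)) ?U" using open_half by (simp add: openin_open_Int)
    fix T k assume Tk: "T \<in> Pow {1..m}" "k \<in> {0..m}"
    show "(\<lambda>t. f (x(k := t)) T) differentiable at (x k)" if "x \<in> ?U" for x
      using deriv[OF that Tk] by (rule differentiableI_vector)
    show "continuous_on ?U (\<lambda>x. pd f k x T)"
      using contw[OF bw[OF Tk]] by (rule continuous_on_eq) (rule pd[OF _ Tk, symmetric])
  next
    fix x T assume x: "x \<in> ?U" and T: "T \<in> Pow {1..m}"
    have fin: "finite T" using T by (auto intro: finite_subset)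
    have tg: "toggle k T \<in> Pow {1..m}" if "k \<in> {1..m}" for k using that T by (simp only: toggle_in_Pow)
    let ?s = "\<lambda>k. (-1 :: complex) ^ card (toggle k T \<inter> {..k})"
    have "pd f 0 x T + (\<Sum>k\<in>{1..m}. cl_mult m (cl_basis k) (pd f k x) T)
       = c * wave m \<epsilon> (\<lambda>\<xi>. b 0 \<xi> * w T \<xi>) x + (\<Sum>k\<in>{1..m}. ?s k * (c * wave m \<epsilon> (\<lambda>\<xi>. b k \<xi> * w (toggle k T) \<xi>) x))"
    proof -
      have "cl_mult m (cl_basis k) (pd f k x) T = ?s k * (c * wave m \<epsilon> (\<lambda>\<xi>. b k \<xi> * w (toggle k T) \<xi>) x)" if "k \<in> {1..m}" for k
        using that pd[OF x tg[OF that], of k] by (simp add: cl_mult_basis[OF that T] e_mult_def)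
      then show ?thesis by (simp add: pd[OF x T])
    qed
    also have "\<dots> = c * (wave m \<epsilon> (\<lambda>\<xi>. b 0 \<xi> * w T \<xi>) x + (\<Sum>k\<in>{1..m}. wave m \<epsilon> (\<lambda>\<xi>. ?s k * (b k \<xi> * w (toggle k T) \<xi>)) x))"
      by (simp only: wave_cmult distrib_left sum_distrib_left) (simp add: mult.left_commute)
    also have "(\<Sum>k\<in>{1..m}. wave m \<epsilon> (\<lambda>\<xi>. ?s k * (b k \<xi> * w (toggle k T) \<xi>)) x)
        = wave m \<epsilon> (\<lambda>\<xi>. \<Sum>k\<in>{1..m}. ?s k * (b k \<xi> * w (toggle k T) \<xi>)) x"
      by (rule wave_sum[symmetric]) (auto intro!: exp_integrable_cmult bw tg xU[OF x] simp del: Pow_iff)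
    also have "wave m \<epsilon> (\<lambda>\<xi>. b 0 \<xi> * w T \<xi>) x + \<dots> = wave m \<epsilon> (\<lambda>\<xi>. b 0 \<xi> * w T \<xi> + (\<Sum>k\<in>{1..m}. ?s k * (b k \<xi> * w (toggle k T) \<xi>))) x"
      by (rule wave_add[symmetric]) (auto intro!: exp_integrable_sum exp_integrable_cmult bw tg T xU[OF x] simp del: Pow_iff)
    also have "\<dots> = wave m \<epsilon> (\<lambda>\<xi>. 0) x"
    proof (rule wave_cong_AE)
      show "AE \<xi> in Mxi m. b 0 \<xi> * w T \<xi> + (\<Sum>k\<in>{1..m}. ?s k * (b k \<xi> * w (toggle k T) \<xi>)) = 0"
        using AE_vnorm_nonzero[OF m]
      proof eventually_elim
        case (elim \<xi>)
        have "(\<Sum>k\<in>{1..m}. ?s k * (b k \<xi> * w (toggle k T) \<xi>)) = \<i> * vec_mult m \<xi> (chi_mult m \<epsilon> \<xi> (g \<xi>)) T"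
          unfolding vec_mult_def e_mult_def sum_distrib_left by (intro sum.cong) (auto simp: b_def w_def mult_ac)
        then show ?case by (simp add: vec_mult_chi_mult[OF fin eps'(2) elim] b_def w_def)
      qed
      have "exp_integrable m a (\<lambda>\<xi>. \<Sum>k\<in>{1..m}. ?s k * (b k \<xi> * w (toggle k T) \<xi>))"
        by (auto intro!: exp_integrable_sum exp_integrable_cmult bw tg simp del: Pow_iff)
      moreover have "exp_integrable m a (\<lambda>\<xi>. b 0 \<xi> * w T \<xi>)" by (rule bw[OF T]) simp
      ultimately show "(\<lambda>\<xi>. b 0 \<xi> * w T \<xi> + (\<Sum>k\<in>{1..m}. ?s k * (b k \<xi> * w (toggle k T) \<xi>))) \<in> borel_measurable (Mxi m)"
        unfolding exp_integrable_def by (intro borel_measurable_add) auto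
    qed simp
    finally show "pd f 0 x T + (\<Sum>k\<in>{1..m}. cl_mult m (cl_basis k) (pd f k x) T) = 0" by (simp add: wave_def)
  qed
  moreover have "(\<integral>\<^sup>+x\<in>?U. ennreal (cl_norm2 m (f x)) \<partial>Mx m) < \<infinity>"
  proof -
    have cf: "continuous_on ?U (\<lambda>x. f x T)" if T: "T \<in> Pow {1..m}" for T
      using contw[OF wi[OF T]] by (rule continuous_on_eq) (rule rep[OF _ T, symmetric])
    have meas [measurable]: "(\<lambda>x. ennreal ((cmod (f x T))\<^sup>2) * indicator ?U x) \<in> borel_measurable (Mx m)" if T: "T \<in> Pow {1..m}" for T
    proof -
      have [measurable]: "(\<lambda>x. indicator ?U x *\<^sub>R f x T) \<in> borel_measurable (Mx m)"
        by (rule measurable_halfspace_function[OF cf[OF T]])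
      have "(\<lambda>x. ennreal ((cmod (indicator ?U x *\<^sub>R f x T))\<^sup>2)) \<in> borel_measurable (Mx m)" by measurable
      moreover have "(\<lambda>x. ennreal ((cmod (indicator ?U x *\<^sub>R f x T))\<^sup>2)) = (\<lambda>x. ennreal ((cmod (f x T))\<^sup>2) * indicator ?U x)"
        by (auto simp: indicator_def fun_eq_iff)
      ultimately show ?thesis by (simp only:)
    qed
    have "(\<integral>\<^sup>+x\<in>?U. ennreal (cl_norm2 m (f x)) \<partial>Mx m) = (\<integral>\<^sup>+x. (\<Sum>T\<in>Pow {1..m}. ennreal ((cmod (f x T))\<^sup>2) * indicator ?U x) \<partial>Mx m)"
      by (simp add: cl_norm2_def sum_distrib_right[symmetric])
    also have "\<dots> = (\<Sum>T\<in>Pow {1..m}. \<integral>\<^sup>+x. ennreal ((cmod (f x T))\<^sup>2) * indicator ?U x \<partial>Mx m)"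
      by (rule nn_integral_sum[OF meas])
    also have "\<dots> < \<infinity>"
    proof -
      have "(\<integral>\<^sup>+x. ennreal ((cmod (f x T))\<^sup>2) * indicator ?U x \<partial>Mx m) < \<infinity>" if T: "T \<in> Pow {1..m}" for T
      proof -
        have [measurable]: "w T \<in> borel_measurable (Mxi m)" by (rule wm[OF T])
        let ?C = "ennreal ((cmod c)\<^sup>2) * ennreal ((2 * pi) ^ m)"
        let ?h = "\<lambda>t \<xi>. complex_of_real (exp (- \<epsilon> * t * vnorm m \<xi>)) * w T \<xi>"
        have "(\<integral>\<^sup>+x. ennreal ((cmod (f x T))\<^sup>2) * indicator ?U x \<partial>Mx m)
           = (\<integral>\<^sup>+t. indicator {t. - a < \<epsilon> * t} t * l2 m (\<lambda>y. f (y(0 := t)) T) \<partial>lborel)"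
          by (rule nn_integral_halfspace[OF cf[OF T]])
        also have "\<dots> \<le> (\<integral>\<^sup>+t. ?C * (indicator {t. - a < \<epsilon> * t} t * l2 m (?h t)) \<partial>lborel)"
        proof (rule nn_integral_mono)
          fix t
          show "indicator {t. - a < \<epsilon> * t} t * l2 m (\<lambda>y. f (y(0 := t)) T) \<le> ?C * (indicator {t. - a < \<epsilon> * t} t * l2 m (?h t))"
          proof (cases "- a < \<epsilon> * t")
            case True
            \<comment> \<open>At the point of height \<open>t\<close> whose other coordinates are 0
              the oscillating factor is 1, so integrability of the \<open>wave\<close> integrand is
              the claim.\<close>
            have hint: "integrable (Mxi m) (?h t)"
              using wave_integrable[OF wi[OF T], of \<epsilon> "\<lambda>i. if i = 0 then t else 0"] True
              by (simp add: vinner_def)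
            have "l2 m (\<lambda>y. f (y(0 := t)) T) = l2 m (\<lambda>y. c * ft m 1 (?h t) y)"
            proof (rule l2_cong)
              fix y assume y: "y \<in> space (Mxi m)"
              have "vinner m (y(0 := t)) \<xi> = vinner m \<xi> y" for \<xi> by (auto simp: vinner_def mult.commute intro!: sum.cong)
              then show "cmod (f (y(0 := t)) T) = cmod (c * ft m 1 (?h t) y)"
                using True by (simp add: rep[OF _ T] update_in_halfspace[OF y] wave_def ft_def)
            qed
            also have "\<dots> = ennreal ((cmod c)\<^sup>2) * l2 m (ft m 1 (?h t))" by (rule l2_cmult) measurable
            also have "\<dots> \<le> ennreal ((cmod c)\<^sup>2) * (ennreal ((2 * pi) ^ m) * l2 m (?h t))"
              by (intro mult_left_mono l2_ft_le hint) auto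
            finally show ?thesis using True by (simp add: mult.assoc)
          qed simp
        qed
        also have "\<dots> = ?C * (\<integral>\<^sup>+t. indicator {t. - a < \<epsilon> * t} t * l2 m (?h t) \<partial>lborel)"
        proof (rule nn_integral_cmult)
          interpret M: sigma_finite_measure "Mxi m" by (rule sigma_finite_Mxi)
          show "(\<lambda>t. indicator {t. - a < \<epsilon> * t} t * l2 m (?h t)) \<in> borel_measurable lborel"
            unfolding l2_def by measurable
        qed
        also have "\<dots> < \<infinity>"
          unfolding weight_Tonelli[OF m eps wm[OF T]] using fin[OF T]
          by (auto simp: ennreal_mult_less_top w_def)
        finally show ?thesis .
      qed
      then show ?thesis by (simp add: less_top)
    qed
    finally show ?thesis .
  qed
  ultimately show ?thesis by (simp add: A2_def)
qed

section \<open>Evolution of the truncated transform\<close>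

lemma chi_mult_has_vector_derivative:
  assumes T: "T \<in> Pow {1..m}"
    and v: "\<And>S. S \<in> Pow {1..m} \<Longrightarrow> ((\<lambda>t. v t S) has_vector_derivative v' S) (at t0)"
  shows "((\<lambda>t. chi_mult m \<sigma> \<xi> (v t) T) has_vector_derivative chi_mult m \<sigma> \<xi> v' T) (at t0)"
proof -
  have e: "((\<lambda>t. complex_of_real (\<xi> k) * e_mult k (v t) T) has_vector_derivative complex_of_real (\<xi> k) * e_mult k v' T) (at t0)"
    if "k \<in> {1..m}" for k
    unfolding e_mult_def
    by (intro has_vector_derivative_mult_right v) (use that T in \<open>simp only: toggle_in_Pow\<close>)
  show ?thesis
    unfolding chi_mult_def vec_mult_def
    by (intro has_vector_derivative_add has_vector_derivative_divide has_vector_derivative_mult_right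
        has_vector_derivative_sum v[OF T] e)
qed

lemma norm2_sum_le:
  fixes z :: "'k \<Rightarrow> complex"
  assumes "finite K" shows "(cmod (\<Sum>k\<in>K. z k))\<^sup>2 \<le> real (card K) * (\<Sum>k\<in>K. (cmod (z k))\<^sup>2)"
proof -
  have "(cmod (\<Sum>k\<in>K. z k))\<^sup>2 \<le> (\<Sum>k\<in>K. 1 * cmod (z k))\<^sup>2" by (intro power_mono) (auto intro: norm_sum)
  also have "\<dots> \<le> (\<Sum>k\<in>K. 1\<^sup>2) * (\<Sum>k\<in>K. (cmod (z k))\<^sup>2)" by (rule Cauchy_Schwarz_ineq_sum)
  finally show ?thesis by simp
qed

lemma l2_sum_le:
  assumes "finite K" and [measurable]: "\<And>k. k \<in> K \<Longrightarrow> z k \<in> borel_measurable (Mxi m)"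
  shows "l2 m (\<lambda>\<xi>. \<Sum>k\<in>K. z k \<xi>) \<le> ennreal (real (card K)) * (\<Sum>k\<in>K. l2 m (z k))"
proof -
  have "l2 m (\<lambda>\<xi>. \<Sum>k\<in>K. z k \<xi>) \<le> (\<integral>\<^sup>+\<xi>. ennreal (real (card K)) * (\<Sum>k\<in>K. ennreal ((cmod (z k \<xi>))\<^sup>2)) \<partial>Mxi m)"
    unfolding l2_def
    by (intro nn_integral_mono) (auto simp: sum_nonneg simp flip: ennreal_mult intro!: ennreal_leI norm2_sum_le assms)
  also have "\<dots> = ennreal (real (card K)) * (\<Sum>k\<in>K. l2 m (z k))"
    unfolding l2_def by (subst nn_integral_cmult, measurable, subst nn_integral_sum) auto
  finally show ?thesis .
qed

lemma l2_chi_mult_le: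
  assumes T: "T \<in> Pow {1..m}" and s: "\<bar>\<sigma>\<bar> = 1"
    and [measurable]: "\<And>S. S \<in> Pow {1..m} \<Longrightarrow> v S \<in> borel_measurable (Mxi m)"
  shows "l2 m (\<lambda>\<xi>. chi_mult m \<sigma> \<xi> (\<lambda>S. v S \<xi>) T) \<le> ennreal ((real m + 1)\<^sup>2) * (\<Sum>S\<in>Pow {1..m}. l2 m (v S))"
proof -
  have "l2 m (\<lambda>\<xi>. chi_mult m \<sigma> \<xi> (\<lambda>S. v S \<xi>) T) \<le> (\<integral>\<^sup>+\<xi>. ennreal ((real m + 1)\<^sup>2) * (\<Sum>S\<in>Pow {1..m}. ennreal ((cmod (v S \<xi>))\<^sup>2)) \<partial>Mxi m)"
    unfolding l2_def
  proof (rule nn_integral_mono)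
    fix \<xi>
    have "ennreal ((cmod (chi_mult m \<sigma> \<xi> (\<lambda>S. v S \<xi>) T))\<^sup>2) \<le> ennreal ((real m + 1)\<^sup>2 * cl_norm2 m (\<lambda>S. v S \<xi>))"
      by (intro ennreal_leI norm_chi_mult_le T s)
    then show "ennreal ((cmod (chi_mult m \<sigma> \<xi> (\<lambda>S. v S \<xi>) T))\<^sup>2) \<le> ennreal ((real m + 1)\<^sup>2) * (\<Sum>S\<in>Pow {1..m}. ennreal ((cmod (v S \<xi>))\<^sup>2))"
      by (simp add: cl_norm2_def ennreal_mult' sum_nonneg)
  qed
  also have "\<dots> = ennreal ((real m + 1)\<^sup>2) * (\<Sum>S\<in>Pow {1..m}. l2 m (v S))"
    unfolding l2_def by (subst nn_integral_cmult, measurable, subst nn_integral_sum) auto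
  finally show ?thesis .
qed

locale monogenic_halfspace =
  fixes m :: nat and \<epsilon> a :: real and f :: "(nat \<Rightarrow> real) \<Rightarrow> nat set \<Rightarrow> complex"
  assumes m: "1 \<le> m" and eps: "\<epsilon> = 1 \<or> \<epsilon> = - 1" and A2: "A2 m (halfspace m \<epsilon> a) f"
begin

abbreviation "U \<equiv> halfspace m \<epsilon> a"

abbreviation "I \<equiv> {t :: real. - a < \<epsilon> * t}"

text \<open>All coefficients are taken together because \<open>chi_mult\<close> mixes them.\<close>

definition slice_norm :: "real \<Rightarrow> ennreal" where
  "slice_norm t = (\<Sum>S\<in>Pow {1..m}. l2 m (\<lambda>y. f (y(0 := t)) S))"

text \<open>
  \<open>F R t\<close> is the transform of the slice at height \<open>t\<close>, cut off at width \<open>R\<close>; it solves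
  \<open>\<partial>\<^sub>t F + i \<xi> F = E\<close>, where the error \<open>E\<close> collects the derivatives of the cutoff.
\<close>

definition F :: "real \<Rightarrow> real \<Rightarrow> nat set \<Rightarrow> (nat \<Rightarrow> real) \<Rightarrow> complex" where
  "F R t T \<xi> = ft m (-1) (\<lambda>x. cutoff m R x *\<^sub>R f (x(0 := t)) T) \<xi>"

definition E :: "real \<Rightarrow> real \<Rightarrow> nat set \<Rightarrow> (nat \<Rightarrow> real) \<Rightarrow> complex" where
  "E R t T \<xi> = (\<Sum>k\<in>{1..m}. e_mult k (\<lambda>S. ft m (-1) (\<lambda>x. dcutoff m R k x *\<^sub>R f (x(0 := t)) S) \<xi>) T)"

section \<open>Regularity of the slices and the equation for their transforms\<close>

lemma open_I: "open I"
  by (intro open_Collect_less continuous_intros)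

lemma pd_deriv:
  assumes "x \<in> U" "T \<in> Pow {1..m}" "k \<in> {0..m}"
  shows "((\<lambda>t. f (x(k := t)) T) has_vector_derivative pd f k x T) (at (x k))"
  using A2 assms unfolding A2_def left_monogenic_def pd_def
  by (simp add: vector_derivative_works)

lemma pd_continuous: "T \<in> Pow {1..m} \<Longrightarrow> k \<in> {0..m} \<Longrightarrow> continuous_on U (\<lambda>x. pd f k x T)"
  using A2 unfolding A2_def left_monogenic_def by blast

lemma monogenic:
  assumes "x \<in> U" "T \<in> Pow {1..m}"
  shows "pd f 0 x T = - (\<Sum>k\<in>{1..m}. e_mult k (pd f k x) T)"
proof -
  have "pd f 0 x T + (\<Sum>k\<in>{1..m}. cl_mult m (cl_basis k) (pd f k x) T) = 0"
    using A2 assms unfolding A2_def left_monogenic_def by blast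
  then show ?thesis using cl_mult_basis[OF _ assms(2)] by (simp add: eq_neg_iff_add_eq_0)
qed

lemma f_continuous: assumes T: "T \<in> Pow {1..m}" shows "continuous_on U (\<lambda>x. f x T)"
proof (rule continuous_on_of_partial_derivatives[where I="{0..m}" and D="\<lambda>k x. pd f k x T"])
  show "U \<subseteq> PiE {0..m} (\<lambda>_. UNIV)" by (auto simp: halfspace_def Rm1_def)
  show "\<exists>r>0. \<forall>y\<in>PiE {0..m} (\<lambda>_. UNIV). (\<forall>j\<in>{0..m}. \<bar>y j - x j\<bar> < r) \<longrightarrow> y \<in> U" if "x \<in> U" for x
    by (rule box_in_halfspace[OF _ that]) (use eps in auto)
qed (use T pd_deriv pd_continuous in auto)

lemma continuous_slice:
  assumes t: "t \<in> I" and c: "continuous_on U \<phi>"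
  shows "continuous_on (space (Mxi m)) (\<lambda>y. \<phi> (y(0 := t)))"
  by (rule continuous_on_compose2[OF c continuous_on_fun_upd[OF continuous_on_id continuous_on_const]])
     (use t update_in_halfspace in auto)

lemma measurable_slice [measurable]:
  assumes t: "t \<in> I" and c: "continuous_on U \<phi>"
  shows "(\<lambda>y. \<phi> (y(0 := t)) :: complex) \<in> borel_measurable (Mxi m)"
  using borel_measurable_continuous_on_PiM[of "{1..m}" UNIV "\<lambda>y. \<phi> (y(0 := t))"] continuous_slice[OF t c]
  unfolding space_Mxi by (simp add: Mxi_def)

lemma measurable_f_slice [measurable]:
  "t \<in> I \<Longrightarrow> T \<in> Pow {1..m} \<Longrightarrow> (\<lambda>y. f (y(0 := t)) T) \<in> borel_measurable (Mxi m)"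
  by (rule measurable_slice[OF _ f_continuous])

lemma integrable_weighted_slice:
  assumes t: "t \<in> I" and c: "continuous_on U \<phi>" and \<eta>: "continuous_on (space (Mxi m)) \<eta>"
    and out: "\<And>x j. j \<in> {1..m} \<Longrightarrow> R \<le> \<bar>x j\<bar> \<Longrightarrow> \<eta> x = (0::real)"
  shows "integrable (Mxi m) (\<lambda>x. \<eta> x *\<^sub>R (\<phi> (x(0 := t)) :: complex))"
  by (rule integrable_compact_support[where R=R]) (use out in \<open>auto intro!: continuous_on_scaleR \<eta> continuous_slice[OF t c]\<close>)

text \<open>The weight confines the integral to a compact box, where the continuous derivative is
  bounded by some \<open>C\<close>, so \<open>C * \<bar>\<eta> x\<bar>\<close> is a majorant. The
  weight is general because the statement serves both \<open>cutoff\<close> and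
  \<open>dcutoff\<close>.\<close>

lemma ft_slice_deriv:
  assumes t0: "t0 \<in> I" and T: "T \<in> Pow {1..m}" and \<xi>: "\<xi> \<in> space (Mxi m)"
    and \<eta>: "continuous_on (space (Mxi m)) \<eta>" and out: "\<And>x j. j \<in> {1..m} \<Longrightarrow> R \<le> \<bar>x j\<bar> \<Longrightarrow> \<eta> x = (0::real)"
  shows "((\<lambda>t. ft m (-1) (\<lambda>x. \<eta> x *\<^sub>R f (x(0 := t)) T) \<xi>) has_vector_derivative
      ft m (-1) (\<lambda>x. \<eta> x *\<^sub>R pd f 0 (x(0 := t0)) T) \<xi>) (at t0)"
proof -
  note [measurable] = \<xi>
  obtain d where d: "0 < d" "\<And>t. \<bar>t - t0\<bar> \<le> d \<Longrightarrow> t \<in> I"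
    using open_contains_cball[THEN iffD1, OF open_I] t0 by (auto simp: cball_def dist_real_def subset_iff abs_minus_commute)
  have Tk: "continuous_on U (\<lambda>x. f x T)" "continuous_on U (\<lambda>x. pd f 0 x T)"
    using f_continuous[OF T] pd_continuous[OF T] by auto
  obtain C where C: "\<And>x. x \<in> PiE {0..m} (\<lambda>_. UNIV) \<Longrightarrow>
      (\<forall>i\<in>{0..m}. (if i = 0 then t0 - d else - R) \<le> x i \<and> x i \<le> (if i = 0 then t0 + d else R)) \<Longrightarrow> cmod (pd f 0 x T) \<le> C"
  proof -
    have "{x \<in> PiE {0..m} (\<lambda>_. UNIV). \<forall>i\<in>{0..m}. (if i = 0 then t0 - d else - R) \<le> x i \<and> x i \<le> (if i = 0 then t0 + d else R)} \<subseteq> U"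
    proof (safe)
      fix x assume x: "x \<in> PiE {0..m} (\<lambda>_. UNIV)" "\<forall>i\<in>{0..m}. (if i = 0 then t0 - d else - R) \<le> x i \<and> x i \<le> (if i = 0 then t0 + d else R)"
      then have "t0 - d \<le> x 0 \<and> x 0 \<le> t0 + d" by force
      then have "x 0 \<in> I" by (intro d(2)) auto
      then show "x \<in> U" using x by (auto simp: halfspace_def Rm1_def)
    qed
    from continuous_bounded_on_box[OF Tk(2) this] that show ?thesis by blast
  qed
  have "((\<lambda>t. \<integral>x. cis (- 1 * vinner m x \<xi>) * (\<eta> x *\<^sub>R f (x(0 := t)) T) \<partial>Mxi m) has_vector_derivative
    (\<integral>x. cis (- 1 * vinner m x \<xi>) * (\<eta> x *\<^sub>R pd f 0 (x(0 := t0)) T) \<partial>Mxi m)) (at t0)"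
  proof (rule has_vector_derivative_integral[OF d(1), where B="\<lambda>x. C * \<bar>\<eta> x\<bar>"])
    fix t assume t: "\<bar>t - t0\<bar> < d"
    then have tI: "t \<in> I" by (intro d(2)) simp
    show "integrable (Mxi m) (\<lambda>x. cis (- 1 * vinner m x \<xi>) * (\<eta> x *\<^sub>R f (x(0 := t)) T))"
      by (intro integrable_cis_mult integrable_weighted_slice[OF tI Tk(1) \<eta> out]) measurable
    fix x assume x: "x \<in> space (Mxi m)"
    have xU: "x(0 := t) \<in> U" using update_in_halfspace[OF x] tI by simp
    show "((\<lambda>t. cis (- 1 * vinner m x \<xi>) * (\<eta> x *\<^sub>R f (x(0 := t)) T)) has_vector_derivative
      cis (- 1 * vinner m x \<xi>) * (\<eta> x *\<^sub>R pd f 0 (x(0 := t)) T)) (at t)"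
      using pd_deriv[OF xU T, of 0]
      by (intro has_vector_derivative_mult_right bounded_linear.has_vector_derivative[OF bounded_linear_scaleR_right]) simp
    show "cmod (cis (- 1 * vinner m x \<xi>) * (\<eta> x *\<^sub>R pd f 0 (x(0 := t)) T)) \<le> C * \<bar>\<eta> x\<bar>"
    proof (cases "\<exists>j\<in>{1..m}. R \<le> \<bar>x j\<bar>")
      case True
      then show ?thesis using out by auto
    next
      case False
      have "cmod (pd f 0 (x(0 := t)) T) \<le> C"
      proof (rule C)
        show "x(0 := t) \<in> PiE {0..m} (\<lambda>_. UNIV)" using xU by (simp add: halfspace_def Rm1_def)
        show "\<forall>i\<in>{0..m}. (if i = 0 then t0 - d else - R) \<le> (x(0 := t)) i \<and> (x(0 := t)) i \<le> (if i = 0 then t0 + d else R)"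
        proof
          fix i assume i: "i \<in> {0..m}"
          show "(if i = 0 then t0 - d else - R) \<le> (x(0 := t)) i \<and> (x(0 := t)) i \<le> (if i = 0 then t0 + d else R)"
          proof (cases "i = 0")
            case True
            then show ?thesis using t by auto
          next
            case i0: False
            then have "\<bar>x i\<bar> < R" using False i by (auto simp: not_le)
            then show ?thesis using i0 by auto
          qed
        qed
      qed
      then show ?thesis by (simp add: norm_mult mult.commute[of C] mult_left_mono)
    qed
  next
    have "integrable (Mxi m) (\<lambda>x. complex_of_real (\<eta> x))"
      by (rule integrable_compact_support[where R=R]) (use out in \<open>auto intro!: continuous_on_of_real \<eta>\<close>)
    from integrable_norm[OF this] show "integrable (Mxi m) (\<lambda>x. C * \<bar>\<eta> x\<bar>)" by simp
    have "integrable (Mxi m) (\<lambda>x. \<eta> x *\<^sub>R pd f 0 (x(0 := t0)) T)"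
      by (rule integrable_weighted_slice[OF t0 Tk(2) \<eta> out])
    then have [measurable]: "(\<lambda>x. \<eta> x *\<^sub>R pd f 0 (x(0 := t0)) T) \<in> borel_measurable (Mxi m)" by simp
    show "(\<lambda>x. cis (- 1 * vinner m x \<xi>) * (\<eta> x *\<^sub>R pd f 0 (x(0 := t0)) T)) \<in> borel_measurable (Mxi m)"
      by measurable
  qed
  then show ?thesis by (simp add: ft_def)
qed

lemma cutoff_weights:
  assumes "0 < R"
  shows "continuous_on (space (Mxi m)) (cutoff m R)" "\<And>x j. j \<in> {1..m} \<Longrightarrow> R \<le> \<bar>x j\<bar> \<Longrightarrow> cutoff m R x = 0"
    "continuous_on (space (Mxi m)) (dcutoff m R k)" "\<And>x j. j \<in> {1..m} \<Longrightarrow> R \<le> \<bar>x j\<bar> \<Longrightarrow> dcutoff m R k x = 0"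
  using continuous_cutoff cutoff_outside[OF assms] by auto

lemma ft_slice_integration_by_parts:
  assumes R: "0 < R" and t: "t \<in> I" and S: "S \<in> Pow {1..m}" and k: "k \<in> {1..m}" and \<xi>: "\<xi> \<in> space (Mxi m)"
  shows "ft m (-1) (\<lambda>x. cutoff m R x *\<^sub>R pd f k (x(0 := t)) S) \<xi>
     = \<i> * complex_of_real (\<xi> k) * F R t S \<xi> - ft m (-1) (\<lambda>x. dcutoff m R k x *\<^sub>R f (x(0 := t)) S) \<xi>"
proof -
  note [measurable] = \<xi>
  let ?c = "\<lambda>x. cis (- 1 * vinner m x \<xi>)"
  \<comment> \<open>The three terms of the product rule: the derivative falls on the exponential, on
    the cutoff, and on \<open>f\<close>.\<close>
  let ?q1 = "\<lambda>x. - \<i> * complex_of_real (\<xi> k) * (?c x * (cutoff m R x *\<^sub>R f (x(0 := t)) S))"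
  let ?q2 = "\<lambda>x. ?c x * (dcutoff m R k x *\<^sub>R f (x(0 := t)) S)"
  let ?q3 = "\<lambda>x. ?c x * (cutoff m R x *\<^sub>R pd f k (x(0 := t)) S)"
  have k0: "k \<in> {0..m}" using k by auto
  have fc: "continuous_on U (\<lambda>x. f x S)" "continuous_on U (\<lambda>x. pd f k x S)"
    using f_continuous[OF S] pd_continuous[OF S k0] by auto
  have cc: "continuous_on (space (Mxi m)) ?c"
    unfolding vinner_def by (intro continuous_intros continuous_on_component)
  have i1: "integrable (Mxi m) ?q1"
    by (intro integrable_mult_right integrable_cis_mult integrable_weighted_slice[OF t fc(1) cutoff_weights(1,2)[OF R]]) auto
  have i2: "integrable (Mxi m) ?q2"
    by (intro integrable_cis_mult integrable_weighted_slice[OF t fc(1) cutoff_weights(3,4)[OF R]]) auto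
  have i3: "integrable (Mxi m) ?q3"
    by (intro integrable_cis_mult integrable_weighted_slice[OF t fc(2) cutoff_weights(1,2)[OF R]]) auto
  have "(\<integral>x. ?q1 x + ?q2 x + ?q3 x \<partial>Mxi m) = 0"
  proof (rule integral_partial_derivative_eq_0[OF k R, where p="\<lambda>x. ?c x * (cutoff m R x *\<^sub>R f (x(0 := t)) S)"])
    show "integrable (Mxi m) (\<lambda>x. ?q1 x + ?q2 x + ?q3 x)" by (intro Bochner_Integration.integrable_add i1 i2 i3)
    show "continuous_on (space (Mxi m)) (\<lambda>x. ?q1 x + ?q2 x + ?q3 x)"
      by (intro continuous_on_add continuous_on_mult continuous_on_const continuous_on_scaleR cc
          continuous_slice[OF t] fc cutoff_weights[OF R])
    show "?c x * (cutoff m R x *\<^sub>R f (x(0 := t)) S) = 0 \<and> ?q1 x + ?q2 x + ?q3 x = 0" if "R \<le> \<bar>x k\<bar>" for x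
      using cutoff_outside[where x=x, OF R k that] by simp
    fix x assume x: "x \<in> space (Mxi m)"
    have xU: "x(0 := t) \<in> U" using update_in_halfspace[OF x] t by simp
    have tw: "(x(k := s))(0 := t) = (x(0 := t))(k := s)" for s using k by (intro fun_upd_twist) auto
    have "((\<lambda>s. f ((x(0 := t))(k := s)) S) has_vector_derivative pd f k (x(0 := t)) S) (at (x k))"
      using pd_deriv[OF xU S k0] k by simp
    then have df: "((\<lambda>s. f ((x(k := s))(0 := t)) S) has_vector_derivative pd f k (x(0 := t)) S) (at (x k))"
      by (simp only: tw)
    have vi: "- 1 * vinner m (x(k := s)) \<xi> = (- vinner m x \<xi> + x k * \<xi> k) + s * (- \<xi> k)" for s
      using k unfolding vinner_def by (subst (1 2) sum.remove[of _ k]) auto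
    have dc: "((\<lambda>s. ?c (x(k := s))) has_vector_derivative - \<i> * complex_of_real (\<xi> k) * ?c x) (at (x k))"
      unfolding vi using has_vector_derivative_cis_linear[of "- vinner m x \<xi> + x k * \<xi> k" "- \<xi> k" "x k"] by simp
    have dcut: "((\<lambda>s. cutoff m R (x(k := s))) has_real_derivative dcutoff m R k x) (at (x k))"
      by (rule DERIV_cutoff[OF k R])
    have "((\<lambda>s. ?c (x(k := s)) * (cutoff m R (x(k := s)) *\<^sub>R f ((x(k := s))(0 := t)) S)) has_vector_derivative
       ?c (x(k := x k)) * (cutoff m R (x(k := x k)) *\<^sub>R pd f k (x(0 := t)) S + dcutoff m R k x *\<^sub>R f ((x(k := x k))(0 := t)) S)
        + (- \<i> * complex_of_real (\<xi> k) * ?c x) * (cutoff m R (x(k := x k)) *\<^sub>R f ((x(k := x k))(0 := t)) S)) (at (x k))"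
      by (rule has_vector_derivative_mult[OF dc has_vector_derivative_scaleR[OF dcut df]])
    then show "((\<lambda>s. ?c (x(k := s)) * (cutoff m R (x(k := s)) *\<^sub>R f ((x(k := s))(0 := t)) S)) has_vector_derivative ?q1 x + ?q2 x + ?q3 x) (at (x k))"
      by (rule has_vector_derivative_eq_rhs) (simp add: distrib_left mult.assoc)
  qed
  moreover have "(\<integral>x. ?q1 x + ?q2 x + ?q3 x \<partial>Mxi m) = (\<integral>x. ?q1 x \<partial>Mxi m) + (\<integral>x. ?q2 x \<partial>Mxi m) + (\<integral>x. ?q3 x \<partial>Mxi m)"
    by (subst Bochner_Integration.integral_add[OF Bochner_Integration.integrable_add[OF i1 i2] i3])
       (subst Bochner_Integration.integral_add[OF i1 i2], rule refl)
  moreover have "(\<integral>x. ?q1 x \<partial>Mxi m) = - \<i> * complex_of_real (\<xi> k) * F R t S \<xi>"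
    unfolding F_def ft_def by (rule integral_mult_right_zero)
  ultimately show ?thesis unfolding ft_def by (simp add: add_eq_0_iff2 algebra_simps)
qed

text \<open>The monogenic equation trades the height derivative for tangential ones, and each of
  these is integrated by parts. The coefficients \<open>- 1\<close> and \<open>1\<close> are
  displayed so that the right side matches \<open>chi_mult_linear\<close>.\<close>

lemma F_deriv:
  assumes R: "0 < R" and t: "t \<in> I" and T: "T \<in> Pow {1..m}" and \<xi>: "\<xi> \<in> space (Mxi m)"
  shows "((\<lambda>t. F R t T \<xi>) has_vector_derivative (- 1) * (\<i> * vec_mult m \<xi> (\<lambda>S. F R t S \<xi>) T) + 1 * E R t T \<xi>) (at t)"
proof -
  note [measurable] = \<xi>
  have tg: "toggle k T \<in> Pow {1..m}" if "k \<in> {1..m}" for k using that T by (simp only: toggle_in_Pow)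
  let ?s = "\<lambda>k. (-1 :: complex) ^ card (toggle k T \<inter> {..k})"
  have "ft m (-1) (\<lambda>x. cutoff m R x *\<^sub>R pd f 0 (x(0 := t)) T) \<xi>
    = (\<integral>x. (\<Sum>k\<in>{1..m}. - ?s k * (cis (- 1 * vinner m x \<xi>) * (cutoff m R x *\<^sub>R pd f k (x(0 := t)) (toggle k T)))) \<partial>Mxi m)"
    unfolding ft_def
  proof (rule Bochner_Integration.integral_cong[OF refl])
    fix x assume x: "x \<in> space (Mxi m)"
    have xU: "x(0 := t) \<in> U" using update_in_halfspace[OF x] t by simp
    show "cis (- 1 * vinner m x \<xi>) * (cutoff m R x *\<^sub>R pd f 0 (x(0 := t)) T)
      = (\<Sum>k\<in>{1..m}. - ?s k * (cis (- 1 * vinner m x \<xi>) * (cutoff m R x *\<^sub>R pd f k (x(0 := t)) (toggle k T))))"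
      unfolding monogenic[OF xU T] e_mult_def
      by (simp add: scaleR_conv_of_real sum_distrib_left sum_negf mult_ac)
  qed
  also have "\<dots> = (\<Sum>k\<in>{1..m}. \<integral>x. - ?s k * (cis (- 1 * vinner m x \<xi>) * (cutoff m R x *\<^sub>R pd f k (x(0 := t)) (toggle k T))) \<partial>Mxi m)"
  proof (rule Bochner_Integration.integral_sum)
    fix k assume k: "k \<in> {1..m}"
    then have k0: "k \<in> {0..m}" by auto
    show "integrable (Mxi m) (\<lambda>x. - ?s k * (cis (- 1 * vinner m x \<xi>) * (cutoff m R x *\<^sub>R pd f k (x(0 := t)) (toggle k T))))"
      by (intro integrable_mult_right integrable_cis_mult
          integrable_weighted_slice[OF t pd_continuous[OF tg[OF k] k0] cutoff_weights(1,2)[OF R]]) auto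
  qed
  also have "\<dots> = (\<Sum>k\<in>{1..m}. - ?s k * ft m (-1) (\<lambda>x. cutoff m R x *\<^sub>R pd f k (x(0 := t)) (toggle k T)) \<xi>)"
    unfolding ft_def by (intro sum.cong refl integral_mult_right_zero)
  also have "\<dots> = (\<Sum>k\<in>{1..m}. - ?s k * (\<i> * complex_of_real (\<xi> k) * F R t (toggle k T) \<xi> - ft m (-1) (\<lambda>x. dcutoff m R k x *\<^sub>R f (x(0 := t)) (toggle k T)) \<xi>))"
    by (intro sum.cong refl) (simp only: ft_slice_integration_by_parts[OF R t tg _ \<xi>])
  also have "\<dots> = (- 1) * (\<i> * vec_mult m \<xi> (\<lambda>S. F R t S \<xi>) T) + 1 * E R t T \<xi>"
    unfolding E_def vec_mult_def e_mult_def
    by (simp add: right_diff_distrib sum_subtractf sum_distrib_left sum_negf mult_ac)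
  finally have eq: "ft m (-1) (\<lambda>x. cutoff m R x *\<^sub>R pd f 0 (x(0 := t)) T) \<xi> = (- 1) * (\<i> * vec_mult m \<xi> (\<lambda>S. F R t S \<xi>) T) + 1 * E R t T \<xi>" .
  show ?thesis
    using ft_slice_deriv[OF t T \<xi> cutoff_weights(1,2)[OF R], unfolded eq] unfolding F_def .
qed

text \<open>Under \<open>chi_mult\<close> the multiplication by \<open>\<i> * \<xi>\<close> becomes
  the scalar \<open>\<sigma> * vnorm m \<xi>\<close>, so the exponential is an integrating factor
  and only the error term remains.\<close>

lemma chi_F_deriv:
  assumes R: "0 < R" and t: "t \<in> I" and T: "T \<in> Pow {1..m}" and \<xi>: "\<xi> \<in> space (Mxi m)"
    and s: "\<sigma>\<^sup>2 = 1" and n: "vnorm m \<xi> \<noteq> 0"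
  shows "((\<lambda>t. complex_of_real (exp (\<sigma> * vnorm m \<xi> * t)) * chi_mult m \<sigma> \<xi> (\<lambda>S. F R t S \<xi>) T) has_vector_derivative
     complex_of_real (exp (\<sigma> * vnorm m \<xi> * t)) * chi_mult m \<sigma> \<xi> (\<lambda>S. E R t S \<xi>) T) (at t)"
proof -
  have fin: "finite T" using T by (auto intro: finite_subset)
  let ?e = "complex_of_real (exp (\<sigma> * vnorm m \<xi> * t))" and ?X = "chi_mult m \<sigma> \<xi> (\<lambda>S. F R t S \<xi>) T"
  have "((\<lambda>t. chi_mult m \<sigma> \<xi> (\<lambda>S. F R t S \<xi>) T) has_vector_derivative
     chi_mult m \<sigma> \<xi> (\<lambda>S. (- 1) * (\<i> * vec_mult m \<xi> (\<lambda>S. F R t S \<xi>) S) + 1 * E R t S \<xi>) T) (at t)"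
    by (rule chi_mult_has_vector_derivative[OF T]) (rule F_deriv[OF R t _ \<xi>])
  then have X: "((\<lambda>t. chi_mult m \<sigma> \<xi> (\<lambda>S. F R t S \<xi>) T) has_vector_derivative
     - (complex_of_real (\<sigma> * vnorm m \<xi>) * ?X) + chi_mult m \<sigma> \<xi> (\<lambda>S. E R t S \<xi>) T) (at t)"
    unfolding chi_mult_linear chi_mult_vec_mult[OF fin s n] by simp
  have "((\<lambda>t. complex_of_real (exp (\<sigma> * vnorm m \<xi> * t)) * chi_mult m \<sigma> \<xi> (\<lambda>S. F R t S \<xi>) T) has_vector_derivative
     ?e * (- (complex_of_real (\<sigma> * vnorm m \<xi>) * ?X) + chi_mult m \<sigma> \<xi> (\<lambda>S. E R t S \<xi>) T)
      + complex_of_real (\<sigma> * vnorm m \<xi> * exp (\<sigma> * vnorm m \<xi> * t)) * ?X) (at t)"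
    by (rule has_vector_derivative_mult[OF has_vector_derivative_exp_linear X])
  then show ?thesis by (rule has_vector_derivative_eq_rhs) (simp add: algebra_simps)
qed

lemma E_continuous:
  assumes R: "0 < R" and T: "T \<in> Pow {1..m}" and \<xi>: "\<xi> \<in> space (Mxi m)"
  shows "continuous_on I (\<lambda>t. E R t T \<xi>)"
  unfolding E_def e_mult_def
proof (intro continuous_on_sum continuous_on_mult_left)
  fix k assume k: "k \<in> {1..m}"
  have tg: "toggle k T \<in> Pow {1..m}" using k T by (simp only: toggle_in_Pow)
  show "continuous_on I (\<lambda>t. ft m (-1) (\<lambda>x. dcutoff m R k x *\<^sub>R f (x(0 := t)) (toggle k T)) \<xi>)"
  proof (intro continuous_at_imp_continuous_on ballI)
    fix t assume "t \<in> I"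
    from has_vector_derivative_continuous[OF ft_slice_deriv[OF this tg \<xi> cutoff_weights(3,4)[OF R]]]
    show "isCont (\<lambda>t. ft m (-1) (\<lambda>x. dcutoff m R k x *\<^sub>R f (x(0 := t)) (toggle k T)) \<xi>) t" .
  qed
qed

lemma interval_in_I: "t0 \<in> I \<Longrightarrow> t1 \<in> I \<Longrightarrow> r \<in> {t0..t1} \<Longrightarrow> r \<in> I"
  using eps by auto

lemma chi_E_continuous:
  assumes R: "0 < R" and T: "T \<in> Pow {1..m}" and \<xi>: "\<xi> \<in> space (Mxi m)"
  shows "continuous_on I (\<lambda>t. chi_mult m \<sigma> \<xi> (\<lambda>S. E R t S \<xi>) T)"
proof -
  have "continuous_on I (\<lambda>t. e_mult k (\<lambda>S. E R t S \<xi>) T)" if "k \<in> {1..m}" for k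
    unfolding e_mult_def
    by (intro continuous_on_mult_left E_continuous[OF R _ \<xi>]) (use that T in \<open>simp only: toggle_in_Pow\<close>)
  then show ?thesis
    unfolding chi_mult_def vec_mult_def divide_inverse
    by (intro continuous_on_add continuous_on_mult_left continuous_on_mult_right continuous_on_sum E_continuous[OF R T \<xi>])
qed

text \<open>
  Normalising at a height \<open>\<tau>\<close> with \<open>\<sigma> \<tau>\<close> maximal keeps all exponential factors at most 1,
  so the estimate is uniform in \<open>\<xi>\<close>.
\<close>

lemma chi_F_increment:
  assumes R: "0 < R" and t: "t0 \<in> I" "t1 \<in> I" "t0 \<le> t1" and T: "T \<in> Pow {1..m}" and \<xi>: "\<xi> \<in> space (Mxi m)"
    and s: "\<sigma>\<^sup>2 = 1" and n: "vnorm m \<xi> \<noteq> 0" and \<tau>: "\<sigma> * t0 \<le> \<sigma> * \<tau>" "\<sigma> * t1 \<le> \<sigma> * \<tau>"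
  shows "ennreal ((cmod (complex_of_real (exp (\<sigma> * vnorm m \<xi> * (t1 - \<tau>))) * chi_mult m \<sigma> \<xi> (\<lambda>S. F R t1 S \<xi>) T
       - complex_of_real (exp (\<sigma> * vnorm m \<xi> * (t0 - \<tau>))) * chi_mult m \<sigma> \<xi> (\<lambda>S. F R t0 S \<xi>) T))\<^sup>2)
     \<le> ennreal (t1 - t0) * (\<integral>\<^sup>+r. indicator {t0..t1} r * ennreal ((cmod (chi_mult m \<sigma> \<xi> (\<lambda>S. E R r S \<xi>) T))\<^sup>2) \<partial>lborel)"
proof -
  let ?n = "vnorm m \<xi>"
  let ?e = "\<lambda>r. complex_of_real (exp (\<sigma> * ?n * r))"
  let ?X = "\<lambda>r. chi_mult m \<sigma> \<xi> (\<lambda>S. F R r S \<xi>) T" and ?Y = "\<lambda>r. chi_mult m \<sigma> \<xi> (\<lambda>S. E R r S \<xi>) T"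
  have inI: "r \<in> I" if "r \<in> {t0..t1}" for r using interval_in_I[OF t(1,2) that] .
  have Yc: "continuous_on {t0..t1} ?Y"
    by (rule continuous_on_subset[OF chi_E_continuous[OF R T \<xi>]]) (use inI in blast)
  have Ym [measurable]: "(\<lambda>r. indicator {t0..t1} r *\<^sub>R ?Y r) \<in> borel_measurable borel"
    by (rule borel_measurable_continuous_on_indicator[OF _ Yc]) simp
  have ec: "continuous_on {t0..t1} (\<lambda>r. ?e r * ?Y r)" by (intro continuous_intros Yc)
  have "(\<integral>r. indicator {t0..t1} r *\<^sub>R (?e r * ?Y r) \<partial>lborel) = ?e t1 * ?X t1 - ?e t0 * ?X t0"
    by (rule integral_FTC_atLeastAtMost[OF t(3) _ ec])
       (rule has_vector_derivative_at_within, rule chi_F_deriv[OF R inI T \<xi> s n], simp)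
  then have "cmod (?e t1 * ?X t1 - ?e t0 * ?X t0) = cmod (\<integral>r. indicator {t0..t1} r *\<^sub>R (?e r * ?Y r) \<partial>lborel)" by simp
  moreover have "integrable lborel (\<lambda>r. indicator {t0..t1} r *\<^sub>R (?e r * ?Y r))"
    by (rule borel_integrable_compact) (use ec in auto)
  ultimately have le: "ennreal (cmod (?e t1 * ?X t1 - ?e t0 * ?X t0)) \<le> (\<integral>\<^sup>+r. ennreal (cmod (indicator {t0..t1} r *\<^sub>R (?e r * ?Y r))) \<partial>lborel)"
    by (simp only: integral_norm_bound_ennreal)
  have split: "complex_of_real (exp (\<sigma> * ?n * (r - \<tau>))) = complex_of_real (exp (- \<sigma> * ?n * \<tau>)) * ?e r" for r
    by (simp add: exp_add[symmetric] algebra_simps flip: of_real_mult)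
  have "ennreal (cmod (complex_of_real (exp (\<sigma> * ?n * (t1 - \<tau>))) * ?X t1 - complex_of_real (exp (\<sigma> * ?n * (t0 - \<tau>))) * ?X t0))
     = ennreal (exp (- \<sigma> * ?n * \<tau>)) * ennreal (cmod (?e t1 * ?X t1 - ?e t0 * ?X t0))"
  proof -
    have "complex_of_real (exp (\<sigma> * ?n * (t1 - \<tau>))) * ?X t1 - complex_of_real (exp (\<sigma> * ?n * (t0 - \<tau>))) * ?X t0
      = complex_of_real (exp (- \<sigma> * ?n * \<tau>)) * (?e t1 * ?X t1 - ?e t0 * ?X t0)"
      by (simp only: split) (simp only: mult.assoc right_diff_distrib)
    then show ?thesis by (simp only: norm_mult norm_of_real) (simp add: ennreal_mult')
  qed
  also have "\<dots> \<le> ennreal (exp (- \<sigma> * ?n * \<tau>)) * (\<integral>\<^sup>+r. ennreal (cmod (indicator {t0..t1} r *\<^sub>R (?e r * ?Y r))) \<partial>lborel)"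
    by (rule mult_left_mono[OF le]) simp
  also have "\<dots> = (\<integral>\<^sup>+r. ennreal (exp (- \<sigma> * ?n * \<tau>)) * ennreal (cmod (indicator {t0..t1} r *\<^sub>R (?e r * ?Y r))) \<partial>lborel)"
  proof (rule nn_integral_cmult[symmetric])
    have "(\<lambda>r. indicator {t0..t1} r *\<^sub>R (?e r * ?Y r)) \<in> borel_measurable borel"
      by (rule borel_measurable_continuous_on_indicator[OF _ ec]) simp
    from measurable_compose[OF this, of "\<lambda>z. ennreal (cmod z)" borel]
    show "(\<lambda>r. ennreal (cmod (indicator {t0..t1} r *\<^sub>R (?e r * ?Y r)))) \<in> borel_measurable lborel" by simp
  qed
  also have "\<dots> \<le> (\<integral>\<^sup>+r. indicator {t0..t1} r * ennreal (cmod (indicator {t0..t1} r *\<^sub>R ?Y r)) \<partial>lborel)"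
  proof (rule nn_integral_mono)
    fix r
    show "ennreal (exp (- \<sigma> * ?n * \<tau>)) * ennreal (cmod (indicator {t0..t1} r *\<^sub>R (?e r * ?Y r)))
       \<le> indicator {t0..t1} r * ennreal (cmod (indicator {t0..t1} r *\<^sub>R ?Y r))"
    proof (cases "r \<in> {t0..t1}")
      case True
      have "\<sigma> = 1 \<or> \<sigma> = - 1" using s by (simp add: power2_eq_1_iff)
      then have "\<sigma> * r \<le> \<sigma> * \<tau>" using True \<tau> by auto
      then have "(\<sigma> * r - \<sigma> * \<tau>) * ?n \<le> 0" by (intro mult_nonpos_nonneg) auto
      then have "exp (- \<sigma> * ?n * \<tau>) * exp (\<sigma> * ?n * r) \<le> 1" by (simp add: exp_add[symmetric] algebra_simps)
      then have "exp (- \<sigma> * ?n * \<tau>) * exp (\<sigma> * ?n * r) * cmod (?Y r) \<le> 1 * cmod (?Y r)"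
        by (rule mult_right_mono) simp
      then show ?thesis using True by (simp add: norm_mult mult.assoc flip: ennreal_mult')
    qed simp
  qed
  finally have "(ennreal (cmod (complex_of_real (exp (\<sigma> * ?n * (t1 - \<tau>))) * ?X t1 - complex_of_real (exp (\<sigma> * ?n * (t0 - \<tau>))) * ?X t0)))\<^sup>2
     \<le> (\<integral>\<^sup>+r. indicator {t0..t1} r * ennreal (cmod (indicator {t0..t1} r *\<^sub>R ?Y r)) \<partial>lborel)\<^sup>2" by (rule power_mono) simp
  \<comment> \<open>Cauchy-Schwarz in the height variable; the indicator paired with itself
    contributes the length \<open>t1 - t0\<close>.\<close>
  also have "\<dots> \<le> (\<integral>\<^sup>+r. (indicator {t0..t1} r)\<^sup>2 \<partial>lborel) * (\<integral>\<^sup>+r. (ennreal (cmod (indicator {t0..t1} r *\<^sub>R ?Y r)))\<^sup>2 \<partial>lborel)"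
  proof (rule Cauchy_Schwarz_nn_integral)
    show "(\<lambda>r. ennreal (cmod (indicator {t0..t1} r *\<^sub>R ?Y r))) \<in> borel_measurable lborel"
      using measurable_compose[OF Ym, of "\<lambda>z. ennreal (cmod z)" borel] by simp
  qed simp
  also have "(\<integral>\<^sup>+r. (indicator {t0..t1} r)\<^sup>2 \<partial>lborel) = (\<integral>\<^sup>+r. indicator {t0..t1} r \<partial>lborel)"
    by (intro nn_integral_cong) (simp add: indicator_def)
  also have "\<dots> = ennreal (t1 - t0)" using t(3) by simp
  also have "(\<integral>\<^sup>+r. (ennreal (cmod (indicator {t0..t1} r *\<^sub>R ?Y r)))\<^sup>2 \<partial>lborel) = (\<integral>\<^sup>+r. indicator {t0..t1} r * ennreal ((cmod (?Y r))\<^sup>2) \<partial>lborel)"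
    by (intro nn_integral_cong) (simp add: indicator_def ennreal_power)
  finally show ?thesis by (simp add: ennreal_power)
qed

text \<open>Joint measurability in height and frequency, required for exchanging the two integrals.
  The indicator confines \<open>f\<close> to the half space, where its continuity is known.\<close>

lemma measurable_ft_slice:
  assumes S: "S \<in> Pow {1..m}" and [measurable]: "\<eta> \<in> borel_measurable (Mxi m)"
  shows "(\<lambda>(r, \<xi>). indicator I r *\<^sub>R ft m (-1) (\<lambda>x. \<eta> x *\<^sub>R f (x(0 := r)) S) \<xi>) \<in> borel_measurable (lborel \<Otimes>\<^sub>M Mxi m)"
proof -
  interpret M: sigma_finite_measure "Mxi m" by (rule sigma_finite_Mxi)
  let ?f = "\<lambda>x. indicator U x *\<^sub>R f x S"
  have fm: "?f \<in> borel_measurable (Mx m)" by (rule measurable_halfspace_function[OF f_continuous[OF S]])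
  have "(\<lambda>p :: (real \<times> (nat \<Rightarrow> real)) \<times> (nat \<Rightarrow> real). (fst (fst p), snd p)) \<in> measurable ((lborel \<Otimes>\<^sub>M Mxi m) \<Otimes>\<^sub>M Mxi m) (lborel \<Otimes>\<^sub>M Mxi m)"
    by measurable
  from measurable_compose[OF measurable_compose[OF this measurable_Mx_update] fm]
  have [measurable]: "(\<lambda>p :: (real \<times> (nat \<Rightarrow> real)) \<times> (nat \<Rightarrow> real). ?f ((snd p)(0 := fst (fst p)))) \<in> borel_measurable ((lborel \<Otimes>\<^sub>M Mxi m) \<Otimes>\<^sub>M Mxi m)"
    by simp
  have "(\<lambda>q :: real \<times> (nat \<Rightarrow> real). \<integral>x. cis (- 1 * vinner m x (snd q)) * (\<eta> x *\<^sub>R ?f (x(0 := fst q))) \<partial>Mxi m) \<in> borel_measurable (lborel \<Otimes>\<^sub>M Mxi m)"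
    by (rule M.borel_measurable_lebesgue_integral) (simp only: case_prod_beta', measurable)
  moreover have "(\<integral>x. cis (- 1 * vinner m x \<xi>) * (\<eta> x *\<^sub>R ?f (x(0 := r))) \<partial>Mxi m)
     = indicator I r *\<^sub>R ft m (-1) (\<lambda>x. \<eta> x *\<^sub>R f (x(0 := r)) S) \<xi>" for r \<xi>
  proof -
    have "(\<integral>x. cis (- 1 * vinner m x \<xi>) * (\<eta> x *\<^sub>R ?f (x(0 := r))) \<partial>Mxi m)
      = (\<integral>x. indicator I r *\<^sub>R (cis (- 1 * vinner m x \<xi>) * (\<eta> x *\<^sub>R f (x(0 := r)) S)) \<partial>Mxi m)"
      by (intro Bochner_Integration.integral_cong refl) (simp add: indicator_def update_in_halfspace)
    then show ?thesis by (simp only: integral_scaleR_right ft_def)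
  qed
  ultimately show ?thesis by (simp add: case_prod_beta')
qed

section \<open>Norms of slices and of cut-off transforms\<close>

lemma measurable_slice_l2:
  assumes S: "S \<in> Pow {1..m}"
  shows "(\<lambda>t. indicator I t * l2 m (\<lambda>y. f (y(0 := t)) S)) \<in> borel_measurable lborel"
proof -
  interpret M: sigma_finite_measure "Mxi m" by (rule sigma_finite_Mxi)
  let ?f = "\<lambda>x. indicator U x *\<^sub>R f x S"
  have fm: "?f \<in> borel_measurable (Mx m)" by (rule measurable_halfspace_function[OF f_continuous[OF S]])
  have sq: "(\<lambda>z::complex. ennreal ((cmod z)\<^sup>2)) \<in> borel_measurable borel" by measurable
  have g: "(\<lambda>(t, y). ennreal ((cmod (?f (y(0 := t))))\<^sup>2)) \<in> borel_measurable (lborel \<Otimes>\<^sub>M Mxi m)"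
    using measurable_compose[OF measurable_Mx_update measurable_compose[OF fm sq]] by (simp only: case_prod_beta')
  have "(\<integral>\<^sup>+y. ennreal ((cmod (?f (y(0 := t))))\<^sup>2) \<partial>Mxi m) = indicator I t * l2 m (\<lambda>y. f (y(0 := t)) S)" for t
  proof -
    have "(\<integral>\<^sup>+y. ennreal ((cmod (?f (y(0 := t))))\<^sup>2) \<partial>Mxi m)
       = (\<integral>\<^sup>+y. (if t \<in> I then ennreal ((cmod (f (y(0 := t)) S))\<^sup>2) else 0) \<partial>Mxi m)"
      by (intro nn_integral_cong) (simp add: indicator_def update_in_halfspace)
    then show ?thesis by (simp add: l2_def indicator_def)
  qed
  then show ?thesis using M.borel_measurable_nn_integral[OF g] by (simp only:)
qed

lemma slice_norm_sum: "indicator I t * slice_norm t = (\<Sum>S\<in>Pow {1..m}. indicator I t * l2 m (\<lambda>y. f (y(0 := t)) S))"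
  by (simp add: slice_norm_def sum_distrib_left)

lemma measurable_slice_norm [measurable]: "(\<lambda>t. indicator I t * slice_norm t) \<in> borel_measurable lborel"
  unfolding slice_norm_sum by (rule borel_measurable_sum) (rule measurable_slice_l2)

text \<open>By Tonelli this is the squared A^2 norm of \<open>f\<close>.\<close>

definition total :: ennreal where "total = (\<integral>\<^sup>+t. indicator I t * slice_norm t \<partial>lborel)"

lemma total_finite: "total < \<infinity>"
proof -
  have "total = (\<Sum>S\<in>Pow {1..m}. \<integral>\<^sup>+t. indicator I t * l2 m (\<lambda>y. f (y(0 := t)) S) \<partial>lborel)"
    unfolding total_def slice_norm_sum by (rule nn_integral_sum[OF measurable_slice_l2])
  also have "\<dots> < \<infinity>"
  proof -
    have "(\<integral>\<^sup>+t. indicator I t * l2 m (\<lambda>y. f (y(0 := t)) S) \<partial>lborel) < top" if S: "S \<in> Pow {1..m}" for S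
    proof -
      have "(\<integral>\<^sup>+t. indicator I t * l2 m (\<lambda>y. f (y(0 := t)) S) \<partial>lborel)
        = (\<integral>\<^sup>+x. ennreal ((cmod (f x S))\<^sup>2) * indicator U x \<partial>Mx m)"
        by (rule nn_integral_halfspace[OF f_continuous[OF S], symmetric])
      also have "\<dots> \<le> (\<integral>\<^sup>+x\<in>U. ennreal (cl_norm2 m (f x)) \<partial>Mx m)"
        by (intro nn_integral_mono mult_right_mono ennreal_leI cmod2_le_cl_norm2 S) auto
      also have "\<dots> < top" using A2 by (simp add: A2_def)
      finally show ?thesis .
    qed
    then show ?thesis by (simp add: less_top)
  qed
  finally show ?thesis .
qed

lemma l2_slice_le: "S \<in> Pow {1..m} \<Longrightarrow> l2 m (\<lambda>y. f (y(0 := t)) S) \<le> slice_norm t"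
  unfolding slice_norm_def by (rule member_le_sum) auto

lemma integrable_cutoff_slice:
  assumes "0 < R" "t \<in> I" "T \<in> Pow {1..m}"
  shows "integrable (Mxi m) (\<lambda>x. cutoff m R x *\<^sub>R f (x(0 := t)) T)"
    "integrable (Mxi m) (\<lambda>x. dcutoff m R k x *\<^sub>R f (x(0 := t)) T)"
  using integrable_weighted_slice[OF assms(2) f_continuous[OF assms(3)] cutoff_weights(1,2)[OF assms(1)]]
    integrable_weighted_slice[OF assms(2) f_continuous[OF assms(3)] cutoff_weights(3,4)[OF assms(1)]] by auto

lemma measurable_F [measurable]: "0 < R \<Longrightarrow> t \<in> I \<Longrightarrow> T \<in> Pow {1..m} \<Longrightarrow> F R t T \<in> borel_measurable (Mxi m)"
  unfolding F_def[abs_def] by (rule measurable_ft[OF borel_measurable_integrable[OF integrable_cutoff_slice(1)]])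

lemma measurable_E_summand:
  assumes "0 < R" "t \<in> I" "T \<in> Pow {1..m}" "k \<in> {1..m}"
  shows "(\<lambda>\<xi>. e_mult k (\<lambda>S. ft m (-1) (\<lambda>x. dcutoff m R k x *\<^sub>R f (x(0 := t)) S) \<xi>) T) \<in> borel_measurable (Mxi m)"
  unfolding e_mult_def
  by (intro borel_measurable_times borel_measurable_const measurable_ft[OF borel_measurable_integrable[OF integrable_cutoff_slice(2)]] assms(1,2))
     (use assms(3,4) in \<open>simp only: toggle_in_Pow\<close>)

lemma measurable_E [measurable]: "0 < R \<Longrightarrow> t \<in> I \<Longrightarrow> T \<in> Pow {1..m} \<Longrightarrow> E R t T \<in> borel_measurable (Mxi m)"
  unfolding E_def[abs_def] by (rule borel_measurable_sum) (rule measurable_E_summand)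

lemma l2_F_le:
  assumes R: "0 < R" and t: "t \<in> I" and T: "T \<in> Pow {1..m}"
  shows "l2 m (F R t T) \<le> ennreal ((2 * pi) ^ m) * slice_norm t"
proof -
  have "l2 m (F R t T) \<le> ennreal ((2 * pi) ^ m) * l2 m (\<lambda>x. cutoff m R x *\<^sub>R f (x(0 := t)) T)"
    unfolding F_def[abs_def] by (rule l2_ft_le[OF _ integrable_cutoff_slice(1)[OF assms]]) simp
  also have "\<dots> \<le> ennreal ((2 * pi) ^ m) * l2 m (\<lambda>x. f (x(0 := t)) T)"
    by (intro mult_left_mono l2_mono) (auto simp: cutoff_nonneg intro!: mult_right_le_one_le mult_left_le_one_le cutoff_le_1)
  also have "\<dots> \<le> ennreal ((2 * pi) ^ m) * slice_norm t" by (intro mult_left_mono l2_slice_le T) auto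
  finally show ?thesis .
qed

text \<open>One factor \<open>m\<close> is Cauchy-Schwarz over the summands of \<open>E\<close> and
  the other their number; \<open>(2 * pi) ^ m\<close> is the Bessel constant and
  \<open>(4 / R)\<^sup>2\<close> the squared bound for \<open>dcutoff\<close>.\<close>

lemma l2_E_le:
  assumes R: "0 < R" and t: "t \<in> I" and T: "T \<in> Pow {1..m}"
  shows "l2 m (E R t T) \<le> ennreal ((real m)\<^sup>2 * (2 * pi) ^ m * (4 / R)\<^sup>2) * slice_norm t"
proof -
  have each: "l2 m (\<lambda>\<xi>. e_mult k (\<lambda>S. ft m (-1) (\<lambda>x. dcutoff m R k x *\<^sub>R f (x(0 := t)) S) \<xi>) T)
      \<le> ennreal ((2 * pi) ^ m * (4 / R)\<^sup>2) * slice_norm t" if k: "k \<in> {1..m}" for k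
  proof -
    have tg: "toggle k T \<in> Pow {1..m}" using k T by (simp only: toggle_in_Pow)
    let ?h = "\<lambda>x. f (x(0 := t)) (toggle k T)"
    have [measurable]: "?h \<in> borel_measurable (Mxi m)" by (rule measurable_f_slice[OF t tg])
    have "l2 m (\<lambda>\<xi>. e_mult k (\<lambda>S. ft m (-1) (\<lambda>x. dcutoff m R k x *\<^sub>R f (x(0 := t)) S) \<xi>) T)
       = l2 m (ft m (-1) (\<lambda>x. dcutoff m R k x *\<^sub>R ?h x))"
      by (rule l2_cong) (simp add: norm_e_mult)
    also have "\<dots> \<le> ennreal ((2 * pi) ^ m) * l2 m (\<lambda>x. dcutoff m R k x *\<^sub>R ?h x)"
      by (rule l2_ft_le[OF _ integrable_cutoff_slice(2)[OF R t tg]]) simp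
    also have "\<dots> \<le> ennreal ((2 * pi) ^ m) * (ennreal ((4 / R)\<^sup>2) * slice_norm t)"
    proof (rule mult_left_mono)
      have "l2 m (\<lambda>x. dcutoff m R k x *\<^sub>R ?h x) \<le> l2 m (\<lambda>x. complex_of_real (4 / R) * ?h x)"
      proof (rule l2_mono)
        fix x
        show "cmod (dcutoff m R k x *\<^sub>R ?h x) \<le> cmod (complex_of_real (4 / R) * ?h x)"
          using mult_right_mono[OF abs_dcutoff_le[OF R, of m k x], of "cmod (?h x)"] R by (simp add: norm_mult norm_divide)
      qed
      also have "\<dots> = ennreal ((4 / R)\<^sup>2) * l2 m ?h"
        using R by (subst l2_cmult) (auto simp: norm_divide)
      also have "\<dots> \<le> ennreal ((4 / R)\<^sup>2) * slice_norm t" by (intro mult_left_mono l2_slice_le[OF tg]) simp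
      finally show "l2 m (\<lambda>x. dcutoff m R k x *\<^sub>R ?h x) \<le> ennreal ((4 / R)\<^sup>2) * slice_norm t" .
    qed simp
    also have "\<dots> = ennreal ((2 * pi) ^ m * (4 / R)\<^sup>2) * slice_norm t"
      by (subst ennreal_mult) (auto simp: mult.assoc)
    finally show ?thesis .
  qed
  have "l2 m (E R t T) \<le> ennreal (real (card {1..m})) * (\<Sum>k\<in>{1..m}. l2 m (\<lambda>\<xi>. e_mult k (\<lambda>S. ft m (-1) (\<lambda>x. dcutoff m R k x *\<^sub>R f (x(0 := t)) S) \<xi>) T))"
    unfolding E_def[abs_def] by (rule l2_sum_le) (auto intro: measurable_E_summand[OF R t T])
  also have "\<dots> \<le> ennreal (real m) * (\<Sum>k\<in>{1..m}. ennreal ((2 * pi) ^ m * (4 / R)\<^sup>2) * slice_norm t)"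
    by (intro mult_mono sum_mono each) auto
  also have "\<dots> = ennreal (real m) * (ennreal (real m) * (ennreal ((2 * pi) ^ m * (4 / R)\<^sup>2) * slice_norm t))"
    by (simp add: ennreal_of_nat_eq_real_of_nat)
  also have "\<dots> = ennreal (real m * (real m * ((2 * pi) ^ m * (4 / R)\<^sup>2))) * slice_norm t"
    by (simp only: mult.assoc[symmetric] ennreal_mult' of_nat_0_le_iff) (simp add: ennreal_mult' mult.assoc)
  also have "real m * (real m * ((2 * pi) ^ m * (4 / R)\<^sup>2)) = (real m)\<^sup>2 * (2 * pi) ^ m * (4 / R)\<^sup>2"
    by (simp only: power2_eq_square mult.assoc)
  finally show ?thesis .
qed

text \<open>The product of the constant of \<open>norm_chi_mult_le\<close>, the number
  \<open>2 ^ m\<close> of coefficients, and the Bessel constant.\<close>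

definition KF :: real where "KF = (real m + 1)\<^sup>2 * (2 ^ m * (2 * pi) ^ m)"

text \<open>As \<open>KF\<close>, with the constant of \<open>l2_E_le\<close> in which
  \<open>(4 / R)\<^sup>2\<close> is split into \<open>16\<close> and
  \<open>1 / R\<^sup>2\<close>.\<close>

definition KE :: real where "KE = (real m + 1)\<^sup>2 * (2 ^ m * ((real m)\<^sup>2 * (2 * pi) ^ m * 16))"

lemma l2_chi_uniform_le:
  assumes T: "T \<in> Pow {1..m}" and s: "\<bar>\<sigma>\<bar> = 1" and c: "0 \<le> c"
    and v: "\<And>S. S \<in> Pow {1..m} \<Longrightarrow> v S \<in> borel_measurable (Mxi m)"
    and le: "\<And>S. S \<in> Pow {1..m} \<Longrightarrow> l2 m (v S) \<le> ennreal c * N"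
  shows "l2 m (\<lambda>\<xi>. chi_mult m \<sigma> \<xi> (\<lambda>S. v S \<xi>) T) \<le> ennreal ((real m + 1)\<^sup>2 * (2 ^ m * c)) * N"
proof -
  have "l2 m (\<lambda>\<xi>. chi_mult m \<sigma> \<xi> (\<lambda>S. v S \<xi>) T) \<le> ennreal ((real m + 1)\<^sup>2) * (\<Sum>S\<in>Pow {1..m}. l2 m (v S))"
    by (rule l2_chi_mult_le[OF T s v])
  also have "\<dots> \<le> ennreal ((real m + 1)\<^sup>2) * (\<Sum>S\<in>Pow {1..m}. ennreal c * N)"
    by (intro mult_left_mono sum_mono le) auto
  also have "(\<Sum>S\<in>Pow {1..m}. ennreal c * N) = ennreal (2 ^ m) * (ennreal c * N)"
    by (simp add: card_Pow ennreal_power[symmetric])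
  finally show ?thesis using c by (simp add: ennreal_mult' mult.assoc)
qed

lemma l2_chi_F_le:
  assumes "0 < R" "t \<in> I" "T \<in> Pow {1..m}" "\<bar>\<sigma>\<bar> = 1"
  shows "l2 m (\<lambda>\<xi>. chi_mult m \<sigma> \<xi> (\<lambda>S. F R t S \<xi>) T) \<le> ennreal KF * slice_norm t"
  unfolding KF_def
  by (rule l2_chi_uniform_le[OF assms(3,4)])
     (simp, erule measurable_F[OF assms(1,2)], erule l2_F_le[OF assms(1,2)])

lemma l2_chi_E_le:
  assumes "0 < R" "t \<in> I" "T \<in> Pow {1..m}" "\<bar>\<sigma>\<bar> = 1"
  shows "l2 m (\<lambda>\<xi>. chi_mult m \<sigma> \<xi> (\<lambda>S. E R t S \<xi>) T) \<le> ennreal (KE / R\<^sup>2) * slice_norm t"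
proof -
  have "l2 m (\<lambda>\<xi>. chi_mult m \<sigma> \<xi> (\<lambda>S. E R t S \<xi>) T)
     \<le> ennreal ((real m + 1)\<^sup>2 * (2 ^ m * ((real m)\<^sup>2 * (2 * pi) ^ m * (4 / R)\<^sup>2))) * slice_norm t"
    by (rule l2_chi_uniform_le[OF assms(3,4)])
       (simp, erule measurable_E[OF assms(1,2)], erule l2_E_le[OF assms(1,2)])
  also have "(real m + 1)\<^sup>2 * (2 ^ m * ((real m)\<^sup>2 * (2 * pi) ^ m * (4 / R)\<^sup>2)) = KE / R\<^sup>2"
    by (simp add: KE_def power_divide)
  finally show ?thesis .
qed

text \<open>\<open>chi_F_increment\<close> integrated over frequencies, followed by Tonelli. The
  right side contains \<open>total\<close> and no norm of an individual slice, so nothing has to be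
  known about the slices at \<open>t0\<close> and \<open>t1\<close>.\<close>

lemma l2_chi_F_increment:
  assumes R: "0 < R" and t: "t0 \<in> I" "t1 \<in> I" "t0 \<le> t1" and T: "T \<in> Pow {1..m}"
    and s: "\<bar>\<sigma>\<bar> = 1" and \<tau>: "\<sigma> * t0 \<le> \<sigma> * \<tau>" "\<sigma> * t1 \<le> \<sigma> * \<tau>"
  shows "l2 m (\<lambda>\<xi>. complex_of_real (exp (\<sigma> * vnorm m \<xi> * (t1 - \<tau>))) * chi_mult m \<sigma> \<xi> (\<lambda>S. F R t1 S \<xi>) T
       - complex_of_real (exp (\<sigma> * vnorm m \<xi> * (t0 - \<tau>))) * chi_mult m \<sigma> \<xi> (\<lambda>S. F R t0 S \<xi>) T)
     \<le> ennreal ((t1 - t0) * KE / R\<^sup>2) * total"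
proof -
  interpret M: sigma_finite_measure "Mxi m" by (rule sigma_finite_Mxi)
  interpret pair_sigma_finite lborel "Mxi m" ..
  have s2: "\<sigma>\<^sup>2 = 1" using s by (metis power2_abs power_one)
  have KE0: "0 \<le> KE" by (simp add: KE_def)
  have inI: "r \<in> I" if "r \<in> {t0..t1}" for r using interval_in_I[OF t(1,2) that] .
  let ?Y = "\<lambda>r \<xi>. chi_mult m \<sigma> \<xi> (\<lambda>S. E R r S \<xi>) T"
  let ?J = "\<lambda>r. indicator {t0..t1} r :: ennreal"
  have jm: "(\<lambda>(r, \<xi>). ?J r * ennreal ((cmod (?Y r \<xi>))\<^sup>2)) \<in> borel_measurable (lborel \<Otimes>\<^sub>M Mxi m)"
  proof -
    \<comment> \<open>The error term with the indicator of the half space inserted, hence measurable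
      in both variables; it agrees with \<open>E\<close> for heights in
      \<open>{t0..t1}\<close>.\<close>
    define v where "v p S = (\<Sum>k\<in>{1..m}. e_mult k (\<lambda>S. indicator I (fst p) *\<^sub>R ft m (-1) (\<lambda>x. dcutoff m R k x *\<^sub>R f (x(0 := fst p)) S) (snd p)) S)" for p :: "real \<times> (nat \<Rightarrow> real)" and S
    have "(\<lambda>p. v p S) \<in> borel_measurable (lborel \<Otimes>\<^sub>M Mxi m)" if S: "S \<in> Pow {1..m}" for S
      unfolding v_def e_mult_def
    proof (intro borel_measurable_sum borel_measurable_times borel_measurable_const)
      fix k assume k: "k \<in> {1..m}"
      have "toggle k S \<in> Pow {1..m}" using k S by (simp only: toggle_in_Pow)
      from measurable_ft_slice[OF this measurable_dcutoff[OF k]]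
      show "(\<lambda>p. indicator I (fst p) *\<^sub>R ft m (-1) (\<lambda>x. dcutoff m R k x *\<^sub>R f (x(0 := fst p)) (toggle k S)) (snd p)) \<in> borel_measurable (lborel \<Otimes>\<^sub>M Mxi m)"
        by (simp add: case_prod_beta')
    qed
    then have [measurable]: "(\<lambda>p. chi_mult m \<sigma> (snd p) (v p) T) \<in> borel_measurable (lborel \<Otimes>\<^sub>M Mxi m)"
      by (intro measurable_chi_mult[OF T]) auto
    have "(\<lambda>p. ?J (fst p) * ennreal ((cmod (chi_mult m \<sigma> (snd p) (v p) T))\<^sup>2)) \<in> borel_measurable (lborel \<Otimes>\<^sub>M Mxi m)" by measurable
    moreover have "?J (fst p) * ennreal ((cmod (chi_mult m \<sigma> (snd p) (v p) T))\<^sup>2) = ?J (fst p) * ennreal ((cmod (?Y (fst p) (snd p)))\<^sup>2)" for p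
    proof (cases "fst p \<in> {t0..t1}")
      case True
      then have "v p = (\<lambda>S. E R (fst p) S (snd p))"
        using inI[OF True] by (simp add: v_def[abs_def] E_def[abs_def])
      then show ?thesis by simp
    qed simp
    ultimately show ?thesis by (simp add: case_prod_beta')
  qed
  have "l2 m (\<lambda>\<xi>. complex_of_real (exp (\<sigma> * vnorm m \<xi> * (t1 - \<tau>))) * chi_mult m \<sigma> \<xi> (\<lambda>S. F R t1 S \<xi>) T
       - complex_of_real (exp (\<sigma> * vnorm m \<xi> * (t0 - \<tau>))) * chi_mult m \<sigma> \<xi> (\<lambda>S. F R t0 S \<xi>) T)
     \<le> (\<integral>\<^sup>+\<xi>. ennreal (t1 - t0) * (\<integral>\<^sup>+r. ?J r * ennreal ((cmod (?Y r \<xi>))\<^sup>2) \<partial>lborel) \<partial>Mxi m)"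
    unfolding l2_def
  proof (rule nn_integral_mono_AE)
    show "AE \<xi> in Mxi m. ennreal ((cmod (complex_of_real (exp (\<sigma> * vnorm m \<xi> * (t1 - \<tau>))) * chi_mult m \<sigma> \<xi> (\<lambda>S. F R t1 S \<xi>) T
       - complex_of_real (exp (\<sigma> * vnorm m \<xi> * (t0 - \<tau>))) * chi_mult m \<sigma> \<xi> (\<lambda>S. F R t0 S \<xi>) T))\<^sup>2)
       \<le> ennreal (t1 - t0) * (\<integral>\<^sup>+r. ?J r * ennreal ((cmod (?Y r \<xi>))\<^sup>2) \<partial>lborel)"
      using AE_vnorm_nonzero[OF m] AE_space
      by eventually_elim (rule chi_F_increment[OF R t T _ s2 _ \<tau>]; assumption)
  qed
  also have "\<dots> = ennreal (t1 - t0) * (\<integral>\<^sup>+\<xi>. (\<integral>\<^sup>+r. ?J r * ennreal ((cmod (?Y r \<xi>))\<^sup>2) \<partial>lborel) \<partial>Mxi m)"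
    using lborel.borel_measurable_nn_integral[of "\<lambda>\<xi> r. ?J r * ennreal ((cmod (?Y r \<xi>))\<^sup>2)" "Mxi m"] measurable_pair_swap[OF jm]
    by (intro nn_integral_cmult) (simp add: case_prod_beta')
  also have "(\<integral>\<^sup>+\<xi>. (\<integral>\<^sup>+r. ?J r * ennreal ((cmod (?Y r \<xi>))\<^sup>2) \<partial>lborel) \<partial>Mxi m) = (\<integral>\<^sup>+r. (\<integral>\<^sup>+\<xi>. ?J r * ennreal ((cmod (?Y r \<xi>))\<^sup>2) \<partial>Mxi m) \<partial>lborel)"
    by (rule Fubini'[OF jm])
  also have "\<dots> \<le> (\<integral>\<^sup>+r. ennreal (KE / R\<^sup>2) * (indicator I r * slice_norm r) \<partial>lborel)"
  proof (rule nn_integral_mono)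
    fix r
    show "(\<integral>\<^sup>+\<xi>. ?J r * ennreal ((cmod (?Y r \<xi>))\<^sup>2) \<partial>Mxi m) \<le> ennreal (KE / R\<^sup>2) * (indicator I r * slice_norm r)"
    proof (cases "r \<in> {t0..t1}")
      case True
      then show ?thesis using l2_chi_E_le[OF R inI[OF True] T s] inI[OF True] by (simp add: l2_def)
    qed simp
  qed
  also have "\<dots> = ennreal (KE / R\<^sup>2) * total"
    unfolding total_def by (rule nn_integral_cmult) measurable
  finally show ?thesis using t(3) KE0 by (simp add: mult_left_mono mult.assoc[symmetric] flip: ennreal_mult')
qed

end

section \<open>Removing the truncation\<close>

lemma measurable_chi_mult_Mxi [measurable]:
  assumes "T \<in> Pow {1..m}" and "\<And>S. S \<in> Pow {1..m} \<Longrightarrow> v S \<in> borel_measurable (Mxi m)"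
  shows "(\<lambda>\<xi>. chi_mult m \<sigma> \<xi> (\<lambda>S. v S \<xi>) T) \<in> borel_measurable (Mxi m)"
  by (rule measurable_chi_mult[OF assms(1)]) (use assms(2) in auto)

lemma l2_eq_0_iff:
  assumes [measurable]: "u \<in> borel_measurable (Mxi m)"
  shows "l2 m u = 0 \<longleftrightarrow> (AE \<xi> in Mxi m. u \<xi> = 0)"
  unfolding l2_def by (subst nn_integral_0_iff_AE) (auto simp: ennreal_eq_0_iff)

lemma l2_cong_AE:
  assumes "AE \<xi> in Mxi m. u \<xi> = v \<xi>" shows "l2 m u = l2 m v"
  unfolding l2_def by (rule nn_integral_cong_AE) (use assms in eventually_elim, simp)

context monogenic_halfspace
begin

text \<open>An infinite slice norm throughout an interval would make \<open>total\<close> infinite.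
  One finite slice on either side of a given height is all that the propagation argument asks
  for.\<close>

lemma exists_finite_slice:
  assumes "l < u" "{l<..<u} \<subseteq> I" shows "\<exists>s\<in>{l<..<u}. slice_norm s < \<infinity>"
proof (rule ccontr)
  assume "\<not> ?thesis"
  then have inf: "slice_norm s = top" if "s \<in> {l<..<u}" for s
    using that by (auto simp: not_less top_unique)
  have "(\<integral>\<^sup>+t. top * indicator {l<..<u} t \<partial>lborel) \<le> total"
    unfolding total_def using assms(2) inf by (intro nn_integral_mono) (auto simp: indicator_def)
  moreover have "(\<integral>\<^sup>+t. top * indicator {l<..<u} t \<partial>lborel) = (top :: ennreal)"
    using assms(1) by (subst nn_integral_cmult_indicator) (auto simp: ennreal_top_mult)
  ultimately show False using total_finite by (simp add: top_unique)
qed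

lemma measurable_chi_F:
  "0 < R \<Longrightarrow> t \<in> I \<Longrightarrow> T \<in> Pow {1..m} \<Longrightarrow> (\<lambda>\<xi>. chi_mult m \<sigma> \<xi> (\<lambda>S. F R t S \<xi>) T) \<in> borel_measurable (Mxi m)"
  by (rule measurable_chi_mult_Mxi) (auto intro: measurable_F)

lemma exp_le_1_of_sign: "\<sigma> * r \<le> \<sigma> * \<tau> \<Longrightarrow> exp (\<sigma> * vnorm m \<xi> * (r - \<tau>)) \<le> 1"
proof -
  assume "\<sigma> * r \<le> \<sigma> * \<tau>"
  then have "(\<sigma> * r - \<sigma> * \<tau>) * vnorm m \<xi> \<le> 0" by (intro mult_nonpos_nonneg) auto
  then show ?thesis by (simp add: algebra_simps)
qed

lemma l2_exp_mult_le:
  assumes "\<sigma> * r \<le> \<sigma> * \<tau>"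
  shows "l2 m (\<lambda>\<xi>. complex_of_real (exp (\<sigma> * vnorm m \<xi> * (r - \<tau>))) * u \<xi>) \<le> l2 m u"
  by (rule l2_mono) (use exp_le_1_of_sign[OF assms] in \<open>auto simp: norm_mult intro!: mult_left_le_one_le\<close>)

text \<open>The bound travels from \<open>s\<close> to \<open>t\<close> in the direction in which
  the exponential is at most 1. For \<open>1 \<le> R\<close> the error is dominated by its value at
  \<open>R = 1\<close>, so the estimate is uniform in \<open>R\<close>.\<close>

lemma l2_chi_F_bound:
  assumes R: "1 \<le> R" and t: "t \<in> I" "s \<in> I" "\<bar>t - s\<bar> \<le> d" and T: "T \<in> Pow {1..m}"
    and \<sigma>: "\<bar>\<sigma>\<bar> = 1" "\<sigma> * s \<le> \<sigma> * t"
  shows "l2 m (\<lambda>\<xi>. chi_mult m \<sigma> \<xi> (\<lambda>S. F R t S \<xi>) T)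
     \<le> 2 * (ennreal (d * KE) * total) + 2 * (ennreal KF * slice_norm s)"
proof -
  have R0: "0 < R" using R by simp
  have KE0: "0 \<le> KE" by (simp add: KE_def)
  note [measurable] = measurable_chi_F[OF R0 t(1) T] measurable_chi_F[OF R0 t(2) T]
  let ?X = "\<lambda>r \<xi>. chi_mult m \<sigma> \<xi> (\<lambda>S. F R r S \<xi>) T"
  let ?e = "\<lambda>\<xi>. complex_of_real (exp (\<sigma> * vnorm m \<xi> * (s - t)))"
  have c: "\<bar>t - s\<bar> * KE / R\<^sup>2 \<le> d * KE"
  proof -
    have "1 \<le> R\<^sup>2" using R by simp
    then have "\<bar>t - s\<bar> * KE / R\<^sup>2 \<le> \<bar>t - s\<bar> * KE / 1" using KE0 by (intro divide_left_mono) auto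
    also have "\<dots> \<le> d * KE" using t(3) KE0 by (simp add: mult_right_mono)
    finally show ?thesis .
  qed
  have "l2 m (\<lambda>\<xi>. ?X t \<xi> - ?e \<xi> * ?X s \<xi>) \<le> ennreal (\<bar>t - s\<bar> * KE / R\<^sup>2) * total"
  proof (cases "s \<le> t")
    case True
    then show ?thesis using l2_chi_F_increment[OF R0 t(2,1) True T \<sigma>(1) \<sigma>(2) order_refl] by simp
  next
    case False
    then have "l2 m (\<lambda>\<xi>. ?e \<xi> * ?X s \<xi> - ?X t \<xi>) \<le> ennreal (\<bar>t - s\<bar> * KE / R\<^sup>2) * total"
      using l2_chi_F_increment[OF R0 t(1,2) _ T \<sigma>(1) order_refl \<sigma>(2)] by simp
    then show ?thesis by (simp add: l2_def norm_minus_commute)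
  qed
  also have "\<dots> \<le> ennreal (d * KE) * total" by (intro mult_right_mono ennreal_leI c) simp
  finally have 1: "l2 m (\<lambda>\<xi>. ?X t \<xi> - ?e \<xi> * ?X s \<xi>) \<le> ennreal (d * KE) * total" .
  have 2: "l2 m (\<lambda>\<xi>. ?e \<xi> * ?X s \<xi>) \<le> ennreal KF * slice_norm s"
    by (rule order_trans[OF l2_exp_mult_le[OF \<sigma>(2)] l2_chi_F_le[OF R0 t(2) T \<sigma>(1)]])
  have "l2 m (?X t) = l2 m (\<lambda>\<xi>. (?X t \<xi> - ?e \<xi> * ?X s \<xi>) + ?e \<xi> * ?X s \<xi>)" by simp
  also have "\<dots> \<le> 2 * l2 m (\<lambda>\<xi>. ?X t \<xi> - ?e \<xi> * ?X s \<xi>) + 2 * l2 m (\<lambda>\<xi>. ?e \<xi> * ?X s \<xi>)"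
    by (rule l2_add_le) measurable
  also have "\<dots> \<le> 2 * (ennreal (d * KE) * total) + 2 * (ennreal KF * slice_norm s)"
    by (intro add_mono mult_left_mono 1 2) auto
  finally show ?thesis .
qed

text \<open>The bounds \<open>B s1\<close> and \<open>B s2\<close> do not depend on the width of the
  cutoff. The two projections add up to the full transform, \<open>l2_le_l2_ft\<close> returns to
  the cut-off slice, and Fatou removes the cutoff.\<close>

lemma slice_finite:
  assumes t: "t \<in> I" and T: "T \<in> Pow {1..m}"
  shows "l2 m (\<lambda>y. f (y(0 := t)) T) < \<infinity>"
proof -
  obtain d where d: "0 < d" "\<And>r. \<bar>r - t\<bar> \<le> d \<Longrightarrow> r \<in> I"
    using open_contains_cball[THEN iffD1, OF open_I] t by (auto simp: cball_def dist_real_def subset_iff abs_minus_commute)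
  obtain s1 where s1: "t - d < s1" "s1 < t" "slice_norm s1 < \<infinity>"
    using exists_finite_slice[of "t - d" t] d by force
  obtain s2 where s2: "t < s2" "s2 < t + d" "slice_norm s2 < \<infinity>"
    using exists_finite_slice[of t "t + d"] d by force
  have sI: "s1 \<in> I" "s2 \<in> I" using s1 s2 by (auto intro!: d(2)[simplified])
  define B where "B = (\<lambda>s. 2 * (ennreal (d * KE) * total) + 2 * (ennreal KF * slice_norm s))"
  define C where "C = ennreal (1 / (2 * pi) ^ m) * (2 * B s1 + 2 * B s2)"
  have "C < \<infinity>" using s1(3) s2(3) total_finite by (simp add: C_def B_def ennreal_mult_less_top)
  have [measurable]: "(\<lambda>y. f (y(0 := t)) T) \<in> borel_measurable (Mxi m)" by (rule measurable_f_slice[OF t T])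
  have "l2 m (\<lambda>y. f (y(0 := t)) T) \<le> C"
    unfolding l2_def
  proof (rule nn_integral_le_of_pointwise_limit)
    let ?h = "\<lambda>n y. cutoff m (real (Suc n)) y *\<^sub>R f (y(0 := t)) T"
    show "(\<lambda>y. ennreal ((cmod (?h n y))\<^sup>2)) \<in> borel_measurable (Mxi m)" for n by measurable
    have "(\<lambda>n. ennreal ((cmod (?h n y))\<^sup>2)) \<longlonglongrightarrow> ennreal ((cmod (1 *\<^sub>R f (y(0 := t)) T))\<^sup>2)" for y
      by (intro tendsto_ennrealI tendsto_power tendsto_norm tendsto_scaleR cutoff_tendsto_1 tendsto_const)
    then show "AE y in Mxi m. (\<lambda>n. ennreal ((cmod (?h n y))\<^sup>2)) \<longlonglongrightarrow> ennreal ((cmod (f (y(0 := t)) T))\<^sup>2)" by simp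
    show "(\<integral>\<^sup>+y. ennreal ((cmod (?h n y))\<^sup>2) \<partial>Mxi m) \<le> C" for n
    proof -
      let ?R = "real (Suc n)"
      let ?X = "\<lambda>\<sigma> \<xi>. chi_mult m \<sigma> \<xi> (\<lambda>S. F ?R t S \<xi>) T"
      have "l2 m (?h n) \<le> ennreal (1 / (2 * pi) ^ m) * l2 m (ft m (-1) (?h n))"
      proof (rule l2_le_l2_ft)
        show "integrable (Mxi m) (?h n)" by (rule integrable_cutoff_slice(1)[OF _ t T]) simp
        show "continuous_on (space (Mxi m)) (?h n)"
          by (intro continuous_on_scaleR continuous_cutoff continuous_slice[OF t f_continuous[OF T]])
      qed simp
      also have "l2 m (ft m (-1) (?h n)) = l2 m (\<lambda>\<xi>. ?X 1 \<xi> + ?X (-1) \<xi>)"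
        unfolding chi_mult_add_opposite by (simp add: F_def[abs_def])
      also have "ennreal (1 / (2 * pi) ^ m) * l2 m (\<lambda>\<xi>. ?X 1 \<xi> + ?X (-1) \<xi>)
         \<le> ennreal (1 / (2 * pi) ^ m) * (2 * l2 m (?X 1) + 2 * l2 m (?X (-1)))"
        by (intro mult_left_mono l2_add_le measurable_chi_F t T) auto
      also have "\<dots> \<le> C"
      proof -
        have "l2 m (?X 1) \<le> B s1"
          unfolding B_def by (rule l2_chi_F_bound[OF _ t sI(1) _ T]) (use s1(1,2) in auto)
        moreover have "l2 m (?X (-1)) \<le> B s2"
          unfolding B_def by (rule l2_chi_F_bound[OF _ t sI(2) _ T]) (use s2(1,2) in auto)
        ultimately show ?thesis unfolding C_def by (intro mult_left_mono add_mono) auto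
      qed
      finally show ?thesis by (simp add: l2_def fun_upd_def)
    qed
  qed
  then show ?thesis using \<open>C < \<infinity>\<close> by (rule le_less_trans)
qed

text \<open>A fixed representative of the transform for each height and coefficient; later
  identities about it hold almost everywhere in frequency.\<close>

definition G :: "real \<Rightarrow> nat set \<Rightarrow> (nat \<Rightarrow> real) \<Rightarrow> complex" where
  "G t T = (SOME g. is_ft m (\<lambda>y. f (y(0 := t)) T) g)"

section \<open>Propagation of the full transforms between heights\<close>

lemma is_ft_G:
  assumes "t \<in> I" "T \<in> Pow {1..m}" shows "is_ft m (\<lambda>y. f (y(0 := t)) T) (G t T)"
  unfolding G_def by (rule someI_ex[OF is_ft_exists[OF measurable_f_slice[OF assms] slice_finite[OF assms]]])

lemma measurable_G: "t \<in> I \<Longrightarrow> T \<in> Pow {1..m} \<Longrightarrow> G t T \<in> borel_measurable (Mxi m)"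
  using is_ft_G by (simp only: is_ft_def)

lemma measurable_chi_G:
  assumes "t \<in> I" "T \<in> Pow {1..m}"
  shows "(\<lambda>\<xi>. chi_mult m \<sigma> \<xi> (\<lambda>S. G t S \<xi>) T) \<in> borel_measurable (Mxi m)"
  by (rule measurable_chi_mult_Mxi[OF assms(2)]) (rule measurable_G[OF assms(1)])

lemma F_tendsto_G:
  assumes t: "t \<in> I" and T: "T \<in> Pow {1..m}"
  shows "(\<lambda>n. l2 m (\<lambda>\<xi>. F (real (Suc n)) t T \<xi> - G t T \<xi>)) \<longlonglongrightarrow> 0"
  unfolding F_def
  by (rule is_ft_multiplier_tendsto[OF is_ft_G[OF t T]])
     (auto simp: cutoff_nonneg cutoff_le_1 simp del: of_nat_Suc Pow_iff intro!: cutoff_tendsto_1 integrable_cutoff_slice(1)[OF _ t T])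

lemma chi_F_tendsto_chi_G:
  assumes t: "t \<in> I" and T: "T \<in> Pow {1..m}" and \<sigma>: "\<bar>\<sigma>\<bar> = 1"
  shows "(\<lambda>n. l2 m (\<lambda>\<xi>. chi_mult m \<sigma> \<xi> (\<lambda>S. F (real (Suc n)) t S \<xi>) T - chi_mult m \<sigma> \<xi> (\<lambda>S. G t S \<xi>) T)) \<longlonglongrightarrow> 0"
proof (rule tendsto_0_ennreal_le)
  show "l2 m (\<lambda>\<xi>. chi_mult m \<sigma> \<xi> (\<lambda>S. F (real (Suc n)) t S \<xi>) T - chi_mult m \<sigma> \<xi> (\<lambda>S. G t S \<xi>) T)
     \<le> ennreal ((real m + 1)\<^sup>2) * (\<Sum>S\<in>Pow {1..m}. l2 m (\<lambda>\<xi>. F (real (Suc n)) t S \<xi> - G t S \<xi>))" for n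
    unfolding chi_mult_diff[symmetric]
    by (rule l2_chi_mult_le[OF T \<sigma>]) (intro borel_measurable_diff measurable_F measurable_G t, auto)
  have "(\<lambda>n. ennreal ((real m + 1)\<^sup>2) * (\<Sum>S\<in>Pow {1..m}. l2 m (\<lambda>\<xi>. F (real (Suc n)) t S \<xi> - G t S \<xi>)))
     \<longlonglongrightarrow> ennreal ((real m + 1)\<^sup>2) * (\<Sum>S\<in>Pow {1..m}. 0)"
    by (intro tendsto_mult_ennreal tendsto_const tendsto_sum F_tendsto_G t) auto
  then show "(\<lambda>n. ennreal ((real m + 1)\<^sup>2) * (\<Sum>S\<in>Pow {1..m}. l2 m (\<lambda>\<xi>. F (real (Suc n)) t S \<xi> - G t S \<xi>))) \<longlonglongrightarrow> 0"
    by simp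
qed

text \<open>The limit is taken in the damped form, whose multipliers are at most 1 and preserve norm
  convergence; the error vanishes like \<open>1 / R\<^sup>2\<close>. Multiplying by
  \<open>exp (\<sigma> * vnorm m \<xi> * \<tau>)\<close> at each frequency then removes the
  normalisation.\<close>

lemma chi_G_propagation_le:
  assumes t: "t0 \<in> I" "t1 \<in> I" "t0 \<le> t1" and T: "T \<in> Pow {1..m}" and \<sigma>: "\<bar>\<sigma>\<bar> = 1"
  shows "AE \<xi> in Mxi m. complex_of_real (exp (\<sigma> * vnorm m \<xi> * t1)) * chi_mult m \<sigma> \<xi> (\<lambda>S. G t1 S \<xi>) T
     = complex_of_real (exp (\<sigma> * vnorm m \<xi> * t0)) * chi_mult m \<sigma> \<xi> (\<lambda>S. G t0 S \<xi>) T"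
proof -
  \<comment> \<open>The endpoint at which \<open>\<sigma> * r\<close> is largest.\<close>
  define \<tau> where "\<tau> = (if \<sigma> = 1 then t1 else t0)"
  have \<tau>: "\<sigma> * t0 \<le> \<sigma> * \<tau>" "\<sigma> * t1 \<le> \<sigma> * \<tau>" using \<sigma> t(3) by (auto simp: \<tau>_def abs_if split: if_splits)
  let ?e = "\<lambda>r \<xi>. complex_of_real (exp (\<sigma> * vnorm m \<xi> * (r - \<tau>)))"
  let ?X = "\<lambda>n r \<xi>. chi_mult m \<sigma> \<xi> (\<lambda>S. F (real (Suc n)) r S \<xi>) T"
  let ?Y = "\<lambda>r \<xi>. chi_mult m \<sigma> \<xi> (\<lambda>S. G r S \<xi>) T"
  have Xm [measurable]: "?X n t0 \<in> borel_measurable (Mxi m)" "?X n t1 \<in> borel_measurable (Mxi m)" for n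
    using t T by (auto intro!: measurable_chi_F simp del: of_nat_Suc Pow_iff)
  have Ym [measurable]: "?Y t0 \<in> borel_measurable (Mxi m)" "?Y t1 \<in> borel_measurable (Mxi m)"
    using t T by (auto intro!: measurable_chi_G simp del: Pow_iff)
  let ?L = "\<lambda>\<xi>. ?e t1 \<xi> * ?Y t1 \<xi> - ?e t0 \<xi> * ?Y t0 \<xi>"
  let ?b = "\<lambda>n. 2 * (2 * l2 m (\<lambda>\<xi>. ?X n t0 \<xi> - ?Y t0 \<xi>) + 2 * l2 m (\<lambda>\<xi>. ?X n t1 \<xi> - ?Y t1 \<xi>))
      + 2 * (ennreal ((t1 - t0) * KE / (real (Suc n))\<^sup>2) * total)"
  have le: "l2 m ?L \<le> ?b n" for n
  proof -
    let ?p = "\<lambda>\<xi>. ?e t0 \<xi> * (?X n t0 \<xi> - ?Y t0 \<xi>)" and ?q = "\<lambda>\<xi>. ?e t1 \<xi> * (?X n t1 \<xi> - ?Y t1 \<xi>)"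
    let ?d = "\<lambda>\<xi>. ?e t1 \<xi> * ?X n t1 \<xi> - ?e t0 \<xi> * ?X n t0 \<xi>"
    have "l2 m ?L = l2 m (\<lambda>\<xi>. (?p \<xi> - ?q \<xi>) + ?d \<xi>)" by (rule l2_cong) (simp add: algebra_simps)
    also have "\<dots> \<le> 2 * l2 m (\<lambda>\<xi>. ?p \<xi> - ?q \<xi>) + 2 * l2 m ?d" by (rule l2_add_le) measurable
    also have "\<dots> \<le> 2 * (2 * l2 m ?p + 2 * l2 m ?q) + 2 * l2 m ?d"
      by (intro add_mono mult_left_mono order_refl l2_diff_le) measurable
    also have "\<dots> \<le> ?b n"
      by (intro add_mono mult_left_mono l2_exp_mult_le \<tau> l2_chi_F_increment t T \<sigma>) auto
    finally show ?thesis .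
  qed
  have "(\<lambda>n. (t1 - t0) * KE / (real (Suc n))\<^sup>2) \<longlonglongrightarrow> 0"
  proof -
    have "(\<lambda>n. (t1 - t0) * KE * (inverse (real (Suc n)))\<^sup>2) \<longlonglongrightarrow> (t1 - t0) * KE * 0\<^sup>2"
      by (intro tendsto_mult tendsto_const tendsto_power LIMSEQ_inverse_real_of_nat)
    then show ?thesis by (simp add: divide_inverse power_inverse)
  qed
  then have "(\<lambda>n. ennreal ((t1 - t0) * KE / (real (Suc n))\<^sup>2)) \<longlonglongrightarrow> ennreal 0" by (rule tendsto_ennrealI)
  then have "?b \<longlonglongrightarrow> 2 * (2 * 0 + 2 * 0) + 2 * (ennreal 0 * total)"
    using total_finite
    by (intro tendsto_add tendsto_mult_ennreal tendsto_const chi_F_tendsto_chi_G t T \<sigma>) auto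
  then have "?b \<longlonglongrightarrow> 0" by simp
  then have "l2 m ?L \<le> 0" by (rule LIMSEQ_le_const) (use le in auto)
  then have "AE \<xi> in Mxi m. ?L \<xi> = 0" by (subst l2_eq_0_iff[symmetric]) auto
  then show ?thesis
  proof eventually_elim
    case (elim \<xi>)
    have eq: "complex_of_real (exp (\<sigma> * vnorm m \<xi> * r)) = complex_of_real (exp (\<sigma> * vnorm m \<xi> * \<tau>)) * ?e r \<xi>" for r
      by (simp add: exp_add[symmetric] algebra_simps flip: of_real_mult)
    have "?e t1 \<xi> * ?Y t1 \<xi> = ?e t0 \<xi> * ?Y t0 \<xi>" using elim by simp
    then show ?case
      unfolding eq[of t0] eq[of t1] mult.assoc[of "complex_of_real (exp (\<sigma> * vnorm m \<xi> * \<tau>))"] by (rule arg_cong)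
  qed
qed

lemma chi_G_propagation:
  assumes t: "t0 \<in> I" "t1 \<in> I" and T: "T \<in> Pow {1..m}" and \<sigma>: "\<bar>\<sigma>\<bar> = 1"
  shows "AE \<xi> in Mxi m. chi_mult m \<sigma> \<xi> (\<lambda>S. G t1 S \<xi>) T
     = complex_of_real (exp (- \<sigma> * (t1 - t0) * vnorm m \<xi>)) * chi_mult m \<sigma> \<xi> (\<lambda>S. G t0 S \<xi>) T"
proof -
  have "AE \<xi> in Mxi m. complex_of_real (exp (\<sigma> * vnorm m \<xi> * t1)) * chi_mult m \<sigma> \<xi> (\<lambda>S. G t1 S \<xi>) T
     = complex_of_real (exp (\<sigma> * vnorm m \<xi> * t0)) * chi_mult m \<sigma> \<xi> (\<lambda>S. G t0 S \<xi>) T"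
  proof (cases "t0 \<le> t1")
    case True then show ?thesis by (rule chi_G_propagation_le[OF t _ T \<sigma>])
  next
    case False
    then have "t1 \<le> t0" by simp
    from chi_G_propagation_le[OF t(2,1) this T \<sigma>] show ?thesis by eventually_elim simp
  qed
  then show ?thesis
  proof eventually_elim
    case (elim \<xi>)
    have 1: "complex_of_real (exp (- \<sigma> * vnorm m \<xi> * t1)) * complex_of_real (exp (\<sigma> * vnorm m \<xi> * t1)) = 1"
      by (simp add: exp_add[symmetric] flip: of_real_mult)
    have 2: "complex_of_real (exp (- \<sigma> * vnorm m \<xi> * t1)) * complex_of_real (exp (\<sigma> * vnorm m \<xi> * t0)) = complex_of_real (exp (- \<sigma> * (t1 - t0) * vnorm m \<xi>))"
      by (simp add: exp_add[symmetric] algebra_simps flip: of_real_mult)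
    from arg_cong[OF elim, of "\<lambda>z. complex_of_real (exp (- \<sigma> * vnorm m \<xi> * t1)) * z"]
    show ?case unfolding mult.assoc[symmetric] 1 2 by simp
  qed
qed

lemma l2_chi_G_le:
  assumes t: "t \<in> I" and T: "T \<in> Pow {1..m}" and \<sigma>: "\<bar>\<sigma>\<bar> = 1"
  shows "l2 m (\<lambda>\<xi>. chi_mult m \<sigma> \<xi> (\<lambda>S. G t S \<xi>) T) \<le> ennreal (2 * KF) * slice_norm t"
proof -
  have "l2 m (\<lambda>\<xi>. chi_mult m \<sigma> \<xi> (\<lambda>S. G t S \<xi>) T) \<le> ennreal ((real m + 1)\<^sup>2 * (2 ^ m * (2 * (2 * pi) ^ m))) * slice_norm t"
  proof (rule l2_chi_uniform_le[OF T \<sigma>])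
    fix S assume S: "S \<in> Pow {1..m}"
    show "G t S \<in> borel_measurable (Mxi m)" by (rule measurable_G[OF t S])
    show "l2 m (G t S) \<le> ennreal (2 * (2 * pi) ^ m) * slice_norm t"
      by (rule order_trans[OF l2_is_ft_le[OF is_ft_G[OF t S]]]) (intro mult_left_mono l2_slice_le[OF S], simp)
  qed simp
  then show ?thesis by (simp add: KF_def mult.left_commute)
qed

lemma nn_integral_chi_G_finite:
  assumes T: "T \<in> Pow {1..m}" and \<sigma>: "\<bar>\<sigma>\<bar> = 1"
  shows "(\<integral>\<^sup>+t. indicator I t * l2 m (\<lambda>\<xi>. chi_mult m \<sigma> \<xi> (\<lambda>S. G t S \<xi>) T) \<partial>lborel) < \<infinity>"
proof -
  have "(\<integral>\<^sup>+t. indicator I t * l2 m (\<lambda>\<xi>. chi_mult m \<sigma> \<xi> (\<lambda>S. G t S \<xi>) T) \<partial>lborel)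
     \<le> (\<integral>\<^sup>+t. ennreal (2 * KF) * (indicator I t * slice_norm t) \<partial>lborel)"
    using l2_chi_G_le[OF _ T \<sigma>] by (intro nn_integral_mono) (simp add: indicator_def)
  also have "\<dots> = ennreal (2 * KF) * total" unfolding total_def by (rule nn_integral_cmult) measurable
  also have "\<dots> < \<infinity>" using total_finite by (simp add: ennreal_mult_less_top)
  finally show ?thesis .
qed

section \<open>Consequences at height 0\<close>

context
  assumes a: "0 < a"
begin

lemma zero_in_I: "0 \<in> I"
  using a by simp

text \<open>Moving into the half space does not decrease the norm of this component, so a positive
  norm at height 0 would give an infinite integral over a half line of heights.\<close>

lemma chi_opposite_G_eq_0:
  assumes T: "T \<in> Pow {1..m}"
  shows "AE \<xi> in Mxi m. chi_mult m (- \<epsilon>) \<xi> (\<lambda>S. G 0 S \<xi>) T = 0"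
proof -
  let ?Y = "\<lambda>t \<xi>. chi_mult m (- \<epsilon>) \<xi> (\<lambda>S. G t S \<xi>) T"
  have e: "\<bar>- \<epsilon>\<bar> = 1" using eps by auto
  have le: "l2 m (?Y 0) \<le> l2 m (?Y t)" if "0 \<le> \<epsilon> * t" for t
  proof -
    have t: "t \<in> I" using that a by simp
    have "l2 m (?Y 0) = l2 m (\<lambda>\<xi>. complex_of_real (exp (- (- \<epsilon>) * (0 - t) * vnorm m \<xi>)) * ?Y t \<xi>)"
      by (rule l2_cong_AE[OF chi_G_propagation[OF t zero_in_I T e]])
    also have "\<dots> \<le> l2 m (?Y t)"
      by (rule l2_mono) (use that in \<open>auto simp: norm_mult mult_nonneg_nonneg intro!: mult_left_le_one_le\<close>)
    finally show ?thesis .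
  qed
  have "(\<integral>\<^sup>+t. l2 m (?Y 0) * indicator {t. 0 \<le> \<epsilon> * t} t \<partial>lborel) \<le> (\<integral>\<^sup>+t. indicator I t * l2 m (?Y t) \<partial>lborel)"
    using le a by (intro nn_integral_mono) (auto simp: indicator_def)
  also have "\<dots> < \<infinity>" by (rule nn_integral_chi_G_finite[OF T e])
  finally have "l2 m (?Y 0) * emeasure lborel {t. 0 \<le> \<epsilon> * t} < \<infinity>"
    by (subst (asm) nn_integral_cmult_indicator) auto
  moreover have "emeasure lborel {t. 0 \<le> \<epsilon> * t} = \<infinity>"
  proof -
    have ge: "of_nat n \<le> emeasure lborel {t. 0 \<le> \<epsilon> * t}" for n :: nat
    proof -
      have "of_nat n = emeasure lborel (if \<epsilon> = 1 then {0..real n} else {- real n..0})"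
        by (simp add: ennreal_of_nat_eq_real_of_nat)
      also have "\<dots> \<le> emeasure lborel {t. 0 \<le> \<epsilon> * t}" using eps by (intro emeasure_mono) auto
      finally show ?thesis .
    qed
    show ?thesis
    proof (rule ccontr)
      assume "emeasure lborel {t. 0 \<le> \<epsilon> * t} \<noteq> \<infinity>"
      then obtain n where "emeasure lborel {t. 0 \<le> \<epsilon> * t} < of_nat n"
        using ennreal_Ex_less_of_nat[of "emeasure lborel {t. 0 \<le> \<epsilon> * t}"] by (auto simp: less_top)
      then show False using ge[of n] by simp
    qed
  qed
  ultimately have "l2 m (?Y 0) = 0" by (simp add: ennreal_mult_less_top)
  then show ?thesis using l2_eq_0_iff[OF measurable_chi_G[OF zero_in_I T]] by simp
qed

text \<open>Propagation identifies the damped component from height 0 with the component at height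
  \<open>t\<close>, so \<open>weight_Tonelli\<close> equates the weight integral with an integral
  over heights that is already known to be finite.\<close>

lemma weight_finite:
  assumes T: "T \<in> Pow {1..m}"
  shows "(\<integral>\<^sup>+\<xi>. ennreal (exp (2 * a * vnorm m \<xi>) * (cmod (chi_mult m \<epsilon> \<xi> (\<lambda>S. G 0 S \<xi>) T))\<^sup>2 / (2 * vnorm m \<xi>)) \<partial>Mxi m) < \<infinity>"
proof -
  have e: "\<bar>\<epsilon>\<bar> = 1" using eps by auto
  let ?Y = "\<lambda>t \<xi>. chi_mult m \<epsilon> \<xi> (\<lambda>S. G t S \<xi>) T"
  have "(\<integral>\<^sup>+\<xi>. ennreal (exp (2 * a * vnorm m \<xi>) * (cmod (?Y 0 \<xi>))\<^sup>2 / (2 * vnorm m \<xi>)) \<partial>Mxi m)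
     = (\<integral>\<^sup>+t. indicator I t * l2 m (\<lambda>\<xi>. complex_of_real (exp (- \<epsilon> * t * vnorm m \<xi>)) * ?Y 0 \<xi>) \<partial>lborel)"
    by (rule weight_Tonelli[OF m eps measurable_chi_G[OF zero_in_I T], symmetric])
  also have "\<dots> = (\<integral>\<^sup>+t. indicator I t * l2 m (?Y t) \<partial>lborel)"
  proof (rule nn_integral_cong)
    fix t
    show "indicator I t * l2 m (\<lambda>\<xi>. complex_of_real (exp (- \<epsilon> * t * vnorm m \<xi>)) * ?Y 0 \<xi>) = indicator I t * l2 m (?Y t)"
      using l2_cong_AE[OF chi_G_propagation[OF zero_in_I _ T e], of t] by (cases "t \<in> I") auto
  qed
  also have "\<dots> < \<infinity>" by (rule nn_integral_chi_G_finite[OF T e])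
  finally show ?thesis .
qed

text \<open>The damped symbol is absolutely integrable strictly inside the half space and the slice
  is continuous, so inversion at height \<open>x 0\<close> holds at the given point.\<close>

lemma representation:
  assumes x: "x \<in> U" and T: "T \<in> Pow {1..m}"
  shows "f x T = complex_of_real (1 / (2 * pi) ^ m) * wave m \<epsilon> (\<lambda>\<xi>. chi_mult m \<epsilon> \<xi> (\<lambda>S. G 0 S \<xi>) T) x"
proof -
  have e: "\<bar>\<epsilon>\<bar> = 1" "\<bar>- \<epsilon>\<bar> = 1" using eps by auto
  let ?t = "x 0" and ?y = "restrict x {1..m}"
  let ?w = "\<lambda>\<xi>. chi_mult m \<epsilon> \<xi> (\<lambda>S. G 0 S \<xi>) T"
  have t: "?t \<in> I" using x by (simp add: halfspace_def)
  have y: "?y \<in> space (Mxi m)" by (simp add: space_Mxi)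
  have yx: "?y(0 := ?t) = x"
    using x by (auto simp: halfspace_def Rm1_def fun_eq_iff restrict_def PiE_def extensional_def)
  have vi: "vinner m ?y \<xi> = vinner m x \<xi>" for \<xi> by (simp add: vinner_def)
  have wi: "exp_integrable m a ?w"
    by (rule exp_integrable_of_weight[OF m measurable_chi_G[OF zero_in_I T] weight_finite[OF T]])
  let ?h = "\<lambda>\<xi>. complex_of_real (exp (- \<epsilon> * ?t * vnorm m \<xi>)) * ?w \<xi>"
  have [measurable]: "?w \<in> borel_measurable (Mxi m)" by (rule measurable_chi_G[OF zero_in_I T])
  have [measurable]: "G ?t T \<in> borel_measurable (Mxi m)" by (rule measurable_G[OF t T])
  \<comment> \<open>The opposite component is 0 at height 0 and propagation keeps it 0, so only the
    \<open>\<epsilon>\<close> component survives.\<close>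
  have AE: "AE \<xi> in Mxi m. G ?t T \<xi> = ?h \<xi>"
    using chi_G_propagation[OF zero_in_I t T e(1)] chi_G_propagation[OF zero_in_I t T e(2)] chi_opposite_G_eq_0[OF T]
  proof eventually_elim
    case (elim \<xi>)
    have "G ?t T \<xi> = chi_mult m \<epsilon> \<xi> (\<lambda>S. G ?t S \<xi>) T + chi_mult m (- \<epsilon>) \<xi> (\<lambda>S. G ?t S \<xi>) T"
      by (simp only: chi_mult_add_opposite)
    then show ?case using elim by simp
  qed
  have hi: "integrable (Mxi m) ?h"
    using wave_integrable[OF wi, of \<epsilon> "\<lambda>i. if i = 0 then ?t else 0"] t by (simp add: vinner_def)
  have Gi: "integrable (Mxi m) (G ?t T)"
    by (rule integrable_cong_AE_imp[OF hi]) (use AE in auto)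
  have "f (?y(0 := ?t)) T = complex_of_real (1 / (2 * pi) ^ m) * (\<integral>\<xi>. cis (vinner m ?y \<xi>) * G ?t T \<xi> \<partial>Mxi m)"
    by (rule fourier_inversion[OF is_ft_G[OF t T] Gi continuous_slice[OF t f_continuous[OF T]] y])
  also have "(\<integral>\<xi>. cis (vinner m ?y \<xi>) * G ?t T \<xi> \<partial>Mxi m) = (\<integral>\<xi>. cis (vinner m x \<xi>) * ?h \<xi> \<partial>Mxi m)"
    unfolding vi
  proof (rule integral_cong_AE)
    show "AE \<xi> in Mxi m. cis (vinner m x \<xi>) * G ?t T \<xi> = cis (vinner m x \<xi>) * ?h \<xi>"
      using AE by eventually_elim simp
  qed measurable
  finally show ?thesis unfolding yx wave_def .
qed

lemma is_L2_fourier_G: "is_L2_fourier m (restr0 f) (\<lambda>\<xi> T. G 0 T \<xi>)"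
proof -
  have ft: "is_ft m (\<lambda>y. f (y(0 := 0)) T) (G 0 T)" if "T \<in> Pow {1..m}" for T by (rule is_ft_G[OF zero_in_I that])
  have sum: "(\<integral>\<^sup>+\<xi>. ennreal (cl_norm2 m (\<lambda>T. v T \<xi>)) \<partial>Mxi m) = (\<Sum>T\<in>Pow {1..m}. l2 m (v T))"
    if [measurable]: "\<And>T. T \<in> Pow {1..m} \<Longrightarrow> v T \<in> borel_measurable (Mxi m)" for v
  proof -
    have "(\<integral>\<^sup>+\<xi>. ennreal (cl_norm2 m (\<lambda>T. v T \<xi>)) \<partial>Mxi m) = (\<integral>\<^sup>+\<xi>. (\<Sum>T\<in>Pow {1..m}. ennreal ((cmod (v T \<xi>))\<^sup>2)) \<partial>Mxi m)"
      by (simp add: cl_norm2_def)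
    also have "\<dots> = (\<Sum>T\<in>Pow {1..m}. l2 m (v T))"
      unfolding l2_def by (rule nn_integral_sum) measurable
    finally show ?thesis .
  qed
  have m1: "(\<lambda>y. f (y(0 := 0)) T) \<in> borel_measurable (Mxi m)" "G 0 T \<in> borel_measurable (Mxi m)" if "T \<in> Pow {1..m}" for T
    using ft[OF that] by (auto simp: is_ft_def)
  have fin: "l2 m (\<lambda>y. f (y(0 := 0)) T) < top" "l2 m (G 0 T) < top" if "T \<in> Pow {1..m}" for T
    using ft[OF that] by (auto simp: is_ft_def)
  have "L2 m (restr0 f)"
    unfolding L2_def restr0_def using sum[of "\<lambda>T y. f (y(0 := 0)) T"] m1 fin by (simp add: less_top)
  moreover have "L2 m (\<lambda>\<xi> T. G 0 T \<xi>)"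
    unfolding L2_def using sum[of "G 0"] m1 fin by (simp add: less_top)
  moreover have "((\<lambda>R. \<integral>\<^sup>+\<xi>. ennreal (cl_norm2 m (\<lambda>T. fourier_trunc m (restr0 f) R \<xi> T - G 0 T \<xi>)) \<partial>Mxi m) \<longlongrightarrow> 0) at_top"
  proof -
    have tr: "fourier_trunc m (restr0 f) R \<xi> T = ft m (-1) (trunc m R (\<lambda>y. f (y(0 := 0)) T)) \<xi>" for R \<xi> T
      by (simp add: fourier_trunc_def ft_def trunc_def restr0_def)
    have "(\<integral>\<^sup>+\<xi>. ennreal (cl_norm2 m (\<lambda>T. fourier_trunc m (restr0 f) R \<xi> T - G 0 T \<xi>)) \<partial>Mxi m)
       = (\<Sum>T\<in>Pow {1..m}. l2 m (\<lambda>\<xi>. ft m (-1) (trunc m R (\<lambda>y. f (y(0 := 0)) T)) \<xi> - G 0 T \<xi>))" for R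
      unfolding tr by (rule sum) (intro borel_measurable_diff measurable_ft measurable_trunc m1)
    moreover have "((\<lambda>R. \<Sum>T\<in>Pow {1..m}. l2 m (\<lambda>\<xi>. ft m (-1) (trunc m R (\<lambda>y. f (y(0 := 0)) T)) \<xi> - G 0 T \<xi>)) \<longlongrightarrow> (\<Sum>T\<in>Pow {1..m}. 0)) at_top"
      using ft by (intro tendsto_sum) (simp add: is_ft_def)
    ultimately show ?thesis by simp
  qed
  ultimately show ?thesis by (simp add: is_L2_fourier_def)
qed

end

end

section \<open>Equivalence of the two descriptions\<close>

lemma weight_finite_iff:
  assumes g: "\<And>T. T \<in> Pow {1..m} \<Longrightarrow> (\<lambda>\<xi>. g \<xi> T) \<in> borel_measurable (Mxi m)"
  shows "(\<integral>\<^sup>+\<xi>. ennreal (exp (2 * a * vnorm m \<xi>) * cl_norm2 m (cl_mult m (chi m \<epsilon> \<xi>) (g \<xi>)) / (2 * vnorm m \<xi>)) \<partial>Mxi m) < \<infinity>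
    \<longleftrightarrow> (\<forall>T\<in>Pow {1..m}. (\<integral>\<^sup>+\<xi>. ennreal (exp (2 * a * vnorm m \<xi>) * (cmod (chi_mult m \<epsilon> \<xi> (g \<xi>) T))\<^sup>2 / (2 * vnorm m \<xi>)) \<partial>Mxi m) < \<infinity>)"
proof -
  have "(\<integral>\<^sup>+\<xi>. ennreal (exp (2 * a * vnorm m \<xi>) * cl_norm2 m (cl_mult m (chi m \<epsilon> \<xi>) (g \<xi>)) / (2 * vnorm m \<xi>)) \<partial>Mxi m)
     = (\<integral>\<^sup>+\<xi>. (\<Sum>T\<in>Pow {1..m}. ennreal (exp (2 * a * vnorm m \<xi>) * (cmod (chi_mult m \<epsilon> \<xi> (g \<xi>) T))\<^sup>2 / (2 * vnorm m \<xi>))) \<partial>Mxi m)"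
    by (intro nn_integral_cong) (simp add: cl_norm2_cl_mult_chi sum_distrib_left sum_divide_distrib)
  also have "\<dots> = (\<Sum>T\<in>Pow {1..m}. \<integral>\<^sup>+\<xi>. ennreal (exp (2 * a * vnorm m \<xi>) * (cmod (chi_mult m \<epsilon> \<xi> (g \<xi>) T))\<^sup>2 / (2 * vnorm m \<xi>)) \<partial>Mxi m)"
  proof (rule nn_integral_sum)
    fix T assume T: "T \<in> Pow {1..m}"
    have [measurable]: "(\<lambda>\<xi>. chi_mult m \<epsilon> \<xi> (g \<xi>) T) \<in> borel_measurable (Mxi m)"
      by (rule measurable_chi_mult[OF T]) (use g in auto)
    show "(\<lambda>\<xi>. ennreal (exp (2 * a * vnorm m \<xi>) * (cmod (chi_mult m \<epsilon> \<xi> (g \<xi>) T))\<^sup>2 / (2 * vnorm m \<xi>))) \<in> borel_measurable (Mxi m)"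
      by measurable
  qed
  finally show ?thesis by (simp add: less_top)
qed

text \<open>The right side states integrability explicitly because a Bochner integral that does not
  exist has the value 0; the formula alone would not say that the integral converges.\<close>

theorem theorem3p7:
  fixes m :: nat and a \<epsilon> :: real and f :: "(nat \<Rightarrow> real) \<Rightarrow> nat set \<Rightarrow> complex"
  assumes "1 \<le> m" and "a > 0" and "\<epsilon> \<in> {1, -1}"
  shows "A2 m (halfspace m \<epsilon> a) f \<longleftrightarrow>
    (\<exists>g. is_L2_fourier m (restr0 f) g \<and>
      (1 / (2 * pi) ^ m) * (\<integral>\<^sup>+ \<xi>. ennreal (exp (2 * a * vnorm m \<xi>) *
          cl_norm2 m (cl_mult m (chi m \<epsilon> \<xi>) (g \<xi>)) / (2 * vnorm m \<xi>)) \<partial>Mxi m) < \<infinity> \<and>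
      (\<forall>x\<in>halfspace m \<epsilon> a. \<forall>T\<in>Pow {1..m}.
         integrable (Mxi m) (\<lambda>\<xi>. cl_mult m (ekernel m \<epsilon> x \<xi>) (g \<xi>) T) \<and>
         f x T = complex_of_real (1 / (2 * pi) ^ m) *
                 (\<integral>\<xi>. cl_mult m (ekernel m \<epsilon> x \<xi>) (g \<xi>) T \<partial>Mxi m)))"
proof -
  have eps: "\<epsilon> = 1 \<or> \<epsilon> = - 1" using assms(3) by auto
  have kernel: "(\<integral>\<xi>. cl_mult m (ekernel m \<epsilon> x \<xi>) (g \<xi>) T \<partial>Mxi m) = wave m \<epsilon> (\<lambda>\<xi>. chi_mult m \<epsilon> \<xi> (g \<xi>) T) x"
    if "T \<in> Pow {1..m}" for g x T
    unfolding wave_def by (simp only: cl_mult_ekernel[OF that])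
  \<comment> \<open>The prefactor is positive and finite in \<open>ennreal\<close>, so it does not
    affect finiteness.\<close>
  have const: "ennreal (1 / (2 * pi) ^ m) * z < \<infinity> \<longleftrightarrow> z < \<infinity>" for z
  proof -
    have "\<not> 2 ^ m * pi ^ m \<le> 0" by (simp add: not_le)
    then show ?thesis by (auto simp: ennreal_mult_less_top ennreal_eq_0_iff)
  qed
  show ?thesis
  proof (intro iffI; (elim exE conjE)?)
    assume A: "A2 m (halfspace m \<epsilon> a) f"
    interpret monogenic_halfspace m \<epsilon> a f by (rule monogenic_halfspace.intro[OF assms(1) eps A])
    let ?g = "\<lambda>\<xi> T. G 0 T \<xi>"
    have gm: "(\<lambda>\<xi>. ?g \<xi> T) \<in> borel_measurable (Mxi m)" if "T \<in> Pow {1..m}" for T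
      by (rule measurable_G[OF zero_in_I[OF assms(2)] that])
    show "\<exists>g. is_L2_fourier m (restr0 f) g \<and>
      (1 / (2 * pi) ^ m) * (\<integral>\<^sup>+ \<xi>. ennreal (exp (2 * a * vnorm m \<xi>) *
          cl_norm2 m (cl_mult m (chi m \<epsilon> \<xi>) (g \<xi>)) / (2 * vnorm m \<xi>)) \<partial>Mxi m) < \<infinity> \<and>
      (\<forall>x\<in>halfspace m \<epsilon> a. \<forall>T\<in>Pow {1..m}.
         integrable (Mxi m) (\<lambda>\<xi>. cl_mult m (ekernel m \<epsilon> x \<xi>) (g \<xi>) T) \<and>
         f x T = complex_of_real (1 / (2 * pi) ^ m) *
                 (\<integral>\<xi>. cl_mult m (ekernel m \<epsilon> x \<xi>) (g \<xi>) T \<partial>Mxi m))"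
      unfolding const
    proof (rule exI[of _ ?g], intro conjI ballI)
      show "is_L2_fourier m (restr0 f) ?g" by (rule is_L2_fourier_G[OF assms(2)])
      show "(\<integral>\<^sup>+ \<xi>. ennreal (exp (2 * a * vnorm m \<xi>) * cl_norm2 m (cl_mult m (chi m \<epsilon> \<xi>) (?g \<xi>)) / (2 * vnorm m \<xi>)) \<partial>Mxi m) < \<infinity>"
        using weight_finite[OF assms(2)] weight_finite_iff[where g="?g", OF gm] by blast
      fix x T assume x: "x \<in> halfspace m \<epsilon> a" and T: "T \<in> Pow {1..m}"
      have "exp_integrable m a (\<lambda>\<xi>. chi_mult m \<epsilon> \<xi> (?g \<xi>) T)"
        by (rule exp_integrable_of_weight[OF m measurable_chi_G[OF zero_in_I[OF assms(2)] T] weight_finite[OF assms(2) T]])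
      from wave_integrable[OF this, of \<epsilon> x] x
      show "integrable (Mxi m) (\<lambda>\<xi>. cl_mult m (ekernel m \<epsilon> x \<xi>) (?g \<xi>) T)"
        unfolding cl_mult_ekernel[OF T] by (simp add: halfspace_def)
      show "f x T = complex_of_real (1 / (2 * pi) ^ m) * (\<integral>\<xi>. cl_mult m (ekernel m \<epsilon> x \<xi>) (?g \<xi>) T \<partial>Mxi m)"
        unfolding kernel[OF T] by (rule representation[OF assms(2) x T])
    qed
  next
    fix g
    assume F: "is_L2_fourier m (restr0 f) g"
      and W: "(1 / (2 * pi) ^ m) * (\<integral>\<^sup>+ \<xi>. ennreal (exp (2 * a * vnorm m \<xi>) *
          cl_norm2 m (cl_mult m (chi m \<epsilon> \<xi>) (g \<xi>)) / (2 * vnorm m \<xi>)) \<partial>Mxi m) < \<infinity>"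
      and R: "\<forall>x\<in>halfspace m \<epsilon> a. \<forall>T\<in>Pow {1..m}.
         integrable (Mxi m) (\<lambda>\<xi>. cl_mult m (ekernel m \<epsilon> x \<xi>) (g \<xi>) T) \<and>
         f x T = complex_of_real (1 / (2 * pi) ^ m) *
                 (\<integral>\<xi>. cl_mult m (ekernel m \<epsilon> x \<xi>) (g \<xi>) T \<partial>Mxi m)"
    have gm: "(\<lambda>\<xi>. g \<xi> T) \<in> borel_measurable (Mxi m)" if "T \<in> Pow {1..m}" for T
      using F that unfolding is_L2_fourier_def L2_def by blast
    have fin: "\<forall>T\<in>Pow {1..m}. (\<integral>\<^sup>+\<xi>. ennreal (exp (2 * a * vnorm m \<xi>) * (cmod (chi_mult m \<epsilon> \<xi> (g \<xi>) T))\<^sup>2 / (2 * vnorm m \<xi>)) \<partial>Mxi m) < \<infinity>"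
      using W weight_finite_iff[where g=g, OF gm] unfolding const by blast
    show "A2 m (halfspace m \<epsilon> a) f"
    proof (rule A2_of_representation[OF assms(1) eps gm bspec[OF fin]])
      fix x T assume x: "x \<in> halfspace m \<epsilon> a" and T: "T \<in> Pow {1..m}"
      show "f x T = complex_of_real (1 / (2 * pi) ^ m) * wave m \<epsilon> (\<lambda>\<xi>. chi_mult m \<epsilon> \<xi> (g \<xi>) T) x"
        using bspec[OF bspec[OF R x] T] unfolding kernel[OF T] by (rule conjunct2)
    qed
  qed
qed

end
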